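(* Let $T=(T_1,\ldots,T_d)$ be a cyclic pure commuting row contraction on some Hilbert space $\mathfrak{H}$. Put $\mathcal{J}=\mathrm{Ann}_{\mathrm{c}}(T)$. Let $\mathfrak{M},\mathfrak{N}\subset\mathfrak{H}$ be closed co-invariant subspaces for $T$ such that \[ \mathrm{Ann}_{\mathrm{c}}(P_{\mathfrak{M}}T|_{\mathfrak{M}})=\mathrm{Ann}_{\mathrm{c}}(P_{\mathfrak{N}}T|_{\mathfrak{N}}). \] Then $\overline{X^*\mathfrak{M}}=\overline{X^*\mathfrak{N}}$ for every $X\in\mathcal{Q}(M_{\mathcal{J}},T)$. In particular, $\mathfrak{M}=\mathfrak{N}$ if $X^*\mathfrak{M}$ and $X^*\mathfrak{N}$ are closed for some $X\in\mathcal{Q}(M_{\mathcal{J}},T)$.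
   Context: Fix a positive integer $d$. The Drury--Arveson space $H^2_d$ is the Hilbert space of analytic functions $f=\sum_{\alpha\in\mathbb{N}^d}c_\alpha x^\alpha$ on the open unit ball $\mathbb{B}_d\subset\mathbb{C}^d$ with $\|f\|^2=\sum_{\alpha}\frac{\alpha!}{|\alpha|!}|c_\alpha|^2<\infty$; $x_1,\dots,x_d$ are the coordinate functions. $\mathcal{M}_d$ is its multiplier algebra, viewed as a weak-$*$ closed unital subalgebra of $B(H^2_d)$ via $\phi\mapsto M_\phi$, $M_\phi f=\phi f$. A $d$-tuple $T=(T_1,\dots,T_d)$ of bounded operators on $\mathfrak{H}$ is a row contraction if $\sum_{k=1}^d T_kT_k^*\le I$; it is commuting if the $T_k$ commute with each other; it is pure if $\lim_{n\to\infty}\sum_{|w|=n}\|T_w^*\xi\|^2=0$ for all $\xi\in\mathfrak{H}$, where $w=i_1\cdots i_n$ ranges over words of length $n$ in $\{1,\dots,d\}$ and $T_w=T_{i_1}\cdots T_{i_n}$. $T$ is cyclic if there is a vector $\xi$ such that $\mathfrak{H}$ is the closed linear span of $\{T_w\xi\}$ over all words $w$ (including the empty word). For a pure commuting row contraction $T$ there is a unique unital completely contractive weak-$*$ continuous homomorphism $\mathcal{M}_d\to B(\mathfrak{H})$ sending $M_{x_k}$ to $T_k$ for each $k$; the image of $\phi$ is written $\phi(T)$. $\mathrm{Ann}_{\mathrm{c}}(T)=\{\phi\in\mathcal{M}_d:\phi(T)=0\}$, a weak-$*$ closed ideal. A closed subspace $\mathfrak{M}$ is co-invariant for $T$ if $T_k^*\mathfrak{M}\subset\mathfrak{M}$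 for all $k$; then $P_{\mathfrak{M}}T|_{\mathfrak{M}}=(P_{\mathfrak{M}}T_1|_{\mathfrak{M}},\ldots,P_{\mathfrak{M}}T_d|_{\mathfrak{M}})$ is again a pure commuting row contraction. For a weak-$*$ closed ideal $\mathcal{J}\subset\mathcal{M}_d$, let $[\mathcal{J}H^2_d]$ be the closed linear span of $\{\theta f:\theta\in\mathcal{J},f\in H^2_d\}$, $H_{\mathcal{J}}=H^2_d\ominus[\mathcal{J}H^2_d]$, and $M_{\mathcal{J}}=(P_{H_{\mathcal{J}}}M_{x_1}|_{H_{\mathcal{J}}},\ldots,P_{H_{\mathcal{J}}}M_{x_d}|_{H_{\mathcal{J}}})$. For $d$-tuples $S$ on $\mathfrak{H}$ and $S'$ on $\mathfrak{H}'$, $\mathcal{Q}(S',S)$ denotes the collection of injective bounded linear operators $X:\mathfrak{H}'\to\mathfrak{H}$ with dense range such that $XS'_k=S_kX$ for every $k=1,\dots,d$. *)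

theory Defs
  imports "HOL-Analysis.Analysis"
begin


text \<open>Inner products are linear in the first argument.  The library's real inner product is the
  real part of the complex one, so norm and topology are inherited from \<^class>\<open>real_inner\<close>.\<close>

class complex_inner_space = real_inner +
  fixes scaleC :: "complex \<Rightarrow> 'a \<Rightarrow> 'a" (infixr \<open>*\<^sub>C\<close> 75)
    and cinner :: "'a \<Rightarrow> 'a \<Rightarrow> complex"
  assumes scaleC_add_right: "c *\<^sub>C (x + y) = c *\<^sub>C x + c *\<^sub>C y"
    and scaleC_add_left: "(c + c') *\<^sub>C x = c *\<^sub>C x + c' *\<^sub>C x"
    and scaleC_scaleC: "c *\<^sub>C (c' *\<^sub>C x) = (c * c') *\<^sub>C x"
    and scaleR_eq_scaleC: "scaleR r x = complex_of_real r *\<^sub>C x"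
    and cinner_commute: "cinner x y = cnj (cinner y x)"
    and cinner_add_left: "cinner (x + y) z = cinner x z + cinner y z"
    and cinner_scaleC_left: "cinner (c *\<^sub>C x) y = c * cinner x y"
    and inner_eq_Re_cinner: "inner x y = Re (cinner x y)"

class complex_hilbert_space = complex_inner_space + complete_space

interpretation cvs: vector_space "scaleC :: complex \<Rightarrow> 'a \<Rightarrow> 'a::complex_inner_space"
proof
  show "1 *\<^sub>C x = x" for x :: 'a
    using scaleR_eq_scaleC[of 1 x] by simp
qed (simp_all add: scaleC_add_right scaleC_add_left scaleC_scaleC)

text \<open>Multi-indices in $N^d$ are functions on a finite index type \<open>'d\<close>, with $d$ = \<open>CARD('d)\<close> (positive,
  since types are nonempty).\<close>

definition zpow :: "complex ^ 'd \<Rightarrow> ('d::finite \<Rightarrow> nat) \<Rightarrow> complex" where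
  "zpow z \<alpha> = (\<Prod>k\<in>UNIV. (z $ k) ^ \<alpha> k)"

text \<open>The weight $\alpha!/|\alpha|!$.\<close>

definition da_weight :: "('d::finite \<Rightarrow> nat) \<Rightarrow> real" where
  "da_weight \<alpha> = (\<Prod>k\<in>UNIV. fact (\<alpha> k)) / fact (\<Sum>k\<in>UNIV. \<alpha> k)"

text \<open>Functions on the open unit ball are represented by functions that vanish outside it.\<close>

definition da_expansion :: "(('d::finite \<Rightarrow> nat) \<Rightarrow> complex) \<Rightarrow> (complex ^ 'd \<Rightarrow> complex) \<Rightarrow> bool" where
  "da_expansion c f \<longleftrightarrow>
     (\<lambda>\<alpha>. da_weight \<alpha> * (cmod (c \<alpha>))\<^sup>2) summable_on UNIV \<and>
     (\<forall>z\<in>ball 0 1. ((\<lambda>\<alpha>. c \<alpha> * zpow z \<alpha>) has_sum f z) UNIV) \<and>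
     (\<forall>z. z \<notin> ball 0 1 \<longrightarrow> f z = 0)"

lemma da_weight_pos: "da_weight \<alpha> > 0"
  unfolding da_weight_def by (intro divide_pos_pos prod_pos) auto

lemma powser_zero_imp_coeffs_zero:
  fixes a :: "nat \<Rightarrow> complex"
  assumes "\<And>s. norm s < 1 \<Longrightarrow> (\<lambda>n. a n * s ^ n) sums 0"
  shows "a n = 0"
proof -
  have "conv_radius a \<ge> 1"
  proof (rule conv_radius_geI_ex')
    fix r :: real assume "0 < r" "ereal r < 1"
    hence "norm (of_real r :: complex) < 1" by simp
    from assms[OF this] show "summable (\<lambda>n. a n * of_real r ^ n)" by (rule sums_summable)
  qed
  hence R: "fps_conv_radius (Abs_fps a) > 0"
    unfolding fps_conv_radius_def by (cases "conv_radius a") simp_all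
  have "Abs_fps a = 0"
  proof (rule eval_fps_eqD)
    show "eventually (\<lambda>z. eval_fps (Abs_fps a) z = eval_fps 0 z) (nhds 0)"
    proof (rule eventually_nhds_in_open[of "ball 0 1", THEN eventually_mono])
      fix z :: complex assume "z \<in> ball 0 1"
      then show "eval_fps (Abs_fps a) z = eval_fps 0 z"
        using assms[of z] by (simp add: eval_fps_def sums_iff)
    qed auto
  qed (use R in auto)
  thus ?thesis by (metis fps_nth_Abs_fps fps_zero_nth)
qed

lemma zpow_scale_coord:
  "zpow (\<chi> i. if i = k then s * z $ i else z $ i) \<alpha> = s ^ \<alpha> k * zpow z \<alpha>"
proof -
  have "zpow (\<chi> i. if i = k then s * z $ i else z $ i) \<alpha> =
        (\<Prod>i\<in>UNIV. (if i = k then s ^ \<alpha> k else 1) * (z $ i) ^ \<alpha> i)"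
    unfolding zpow_def by (intro prod.cong) (auto simp: power_mult_distrib)
  also have "\<dots> = s ^ \<alpha> k * zpow z \<alpha>"
    by (simp add: prod.distrib zpow_def prod.delta)
  finally show ?thesis .
qed

lemma scale_coord_in_ball:
  assumes "z \<in> ball 0 1" "norm s < 1"
  shows "(\<chi> i. if i = k then s * z $ i else z $ i) \<in> ball (0::complex^'d) 1"
proof -
  have "norm (\<chi> i. if i = k then s * z $ i else z $ i) \<le> norm z"
    by (rule norm_le_componentwise_cart)
       (use assms(2) in \<open>auto simp: norm_mult intro: mult_left_le_one_le\<close>)
  thus ?thesis using assms(1) by simp
qed

lemma power_series_split_zero:
  fixes c :: "('d::finite \<Rightarrow> nat) \<Rightarrow> complex"
  assumes "\<And>z. z \<in> ball 0 1 \<Longrightarrow> ((\<lambda>\<alpha>. c \<alpha> * zpow z \<alpha>) has_sum 0) A"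
  assumes z: "z \<in> ball 0 1"
  shows "((\<lambda>\<alpha>. c \<alpha> * zpow z \<alpha>) has_sum 0) (A \<inter> {\<alpha>. \<alpha> k = j})"
proof -
  define b where "b j = (\<Sum>\<^sub>\<infinity>\<alpha>\<in>A \<inter> {\<alpha>. \<alpha> k = j}. c \<alpha> * zpow z \<alpha>)" for j
  have sub: "((\<lambda>\<alpha>. c \<alpha> * zpow z \<alpha>) has_sum b j) (A \<inter> {\<alpha>. \<alpha> k = j})" for j
    unfolding b_def using assms(1)[OF z] summable_on_def
    by (intro has_sum_infsum) (blast intro: summable_on_subset_banach)
  have "(\<lambda>n. b n * s ^ n) sums 0" if s: "norm s < 1" for s
  proof -
    have "((\<lambda>\<alpha>. s ^ \<alpha> k * (c \<alpha> * zpow z \<alpha>)) has_sum 0) A"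
      using assms(1)[OF scale_coord_in_ball[OF z s]]
      by (simp add: zpow_scale_coord mult_ac)
    moreover have "bij_betw (\<lambda>p. snd p) (Sigma UNIV (\<lambda>j. A \<inter> {\<alpha>. \<alpha> k = j})) A"
      by (rule bij_betwI[where g = "\<lambda>\<alpha>. (\<alpha> k, \<alpha>)"]) auto
    ultimately have "((\<lambda>p. s ^ (snd p) k * (c (snd p) * zpow z (snd p))) has_sum 0)
          (Sigma UNIV (\<lambda>j. A \<inter> {\<alpha>. \<alpha> k = j}))"
      using has_sum_reindex_bij_betw[of snd _ A "\<lambda>\<alpha>. s ^ \<alpha> k * (c \<alpha> * zpow z \<alpha>)"] by blast
    hence "((\<lambda>j. b j * s ^ j) has_sum 0) UNIV"
    proof (rule has_sum_SigmaD)
      fix j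
      have "((\<lambda>\<alpha>. s ^ j * (c \<alpha> * zpow z \<alpha>)) has_sum s ^ j * b j) (A \<inter> {\<alpha>. \<alpha> k = j})"
        by (rule has_sum_cmult_right[OF sub])
      thus "((\<lambda>\<alpha>. s ^ (snd (j, \<alpha>)) k * (c (snd (j, \<alpha>)) * zpow z (snd (j, \<alpha>)))) has_sum b j * s ^ j)
              (A \<inter> {\<alpha>. \<alpha> k = j})"
        by (subst mult.commute[of "b j"]) (rule has_sum_cong[THEN iffD1, rotated], auto)
    qed
    thus ?thesis by (rule has_sum_imp_sums)
  qed
  hence "b j = 0" by (rule powser_zero_imp_coeffs_zero)
  with sub[of j] show ?thesis by simp
qed

lemma power_series_zero_imp_coeffs_zero:
  fixes c :: "('d::finite \<Rightarrow> nat) \<Rightarrow> complex"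
  assumes "\<And>z. z \<in> ball 0 1 \<Longrightarrow> ((\<lambda>\<alpha>. c \<alpha> * zpow z \<alpha>) has_sum 0) UNIV"
  shows "c \<beta> = 0"
proof -
  have "\<forall>z\<in>ball 0 1. ((\<lambda>\<alpha>. c \<alpha> * zpow z \<alpha>) has_sum 0) {\<alpha>. \<forall>k\<in>S. \<alpha> k = \<beta> k}"
    if "finite S" for S
    using that
  proof induction
    case empty
    then show ?case using assms by simp
  next
    case (insert k S)
    have *: "{\<alpha>. \<forall>i\<in>insert k S. \<alpha> i = \<beta> i} = {\<alpha>. \<forall>i\<in>S. \<alpha> i = \<beta> i} \<inter> {\<alpha>. \<alpha> k = \<beta> k}" by auto
    show ?case unfolding * by (intro ballI power_series_split_zero) (use insert.IH in blast)+
  qed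
  from this[of UNIV] have "\<forall>z\<in>ball 0 1. ((\<lambda>\<alpha>. c \<alpha> * zpow z \<alpha>) has_sum 0) {\<alpha>. \<forall>k\<in>UNIV. \<alpha> k = \<beta> k}"
    by simp
  moreover have "{\<alpha>. \<forall>k\<in>UNIV. \<alpha> k = \<beta> k} = {\<beta>}" by auto
  ultimately have *: "\<forall>z\<in>ball 0 1. ((\<lambda>\<alpha>. c \<alpha> * zpow z \<alpha>) has_sum 0) {\<beta>}" by (simp only:)
  define z :: "complex ^ 'd" where "z = (\<chi> i. 1 / (2 * of_nat CARD('d)))"
  have "norm z \<le> (\<Sum>i\<in>UNIV. norm (z $ i))" 
    unfolding norm_vec_def by (rule L2_set_le_sum) simp
  also have "\<dots> = 1/2" by (simp add: z_def norm_divide norm_mult)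
  finally have "z \<in> ball 0 1" by simp
  with * have "((\<lambda>\<alpha>. c \<alpha> * zpow z \<alpha>) has_sum 0) {\<beta>}" by blast
  hence "c \<beta> * zpow z \<beta> = 0" by (simp add: has_sum_finite_iff)
  moreover have "zpow z \<beta> \<noteq> 0" by (simp add: zpow_def z_def)
  ultimately show ?thesis by simp
qed

lemma da_expansion_unique:
  assumes "da_expansion c f" "da_expansion c' f"
  shows "c = c'"
proof
  fix \<beta>
  have "((\<lambda>\<alpha>. (c \<alpha> - c' \<alpha>) * zpow z \<alpha>) has_sum 0) UNIV" if "z \<in> ball 0 1" for z
  proof -
    have 1: "((\<lambda>\<alpha>. c \<alpha> * zpow z \<alpha>) has_sum f z) UNIV" "((\<lambda>\<alpha>. c' \<alpha> * zpow z \<alpha>) has_sum f z) UNIV"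
      using assms that by (auto simp: da_expansion_def)
    from has_sum_add[OF 1(1) has_sum_uminusI[OF 1(2)]] show ?thesis by (simp add: algebra_simps)
  qed
  from power_series_zero_imp_coeffs_zero[of "\<lambda>\<alpha>. c \<alpha> - c' \<alpha>", OF this] show "c \<beta> = c' \<beta>" by simp
qed

lemma prod_fun_upd:
  fixes \<alpha> :: "'d::finite \<Rightarrow> nat" and h :: "'d \<Rightarrow> nat \<Rightarrow> 'b::comm_monoid_mult"
  shows "(\<Prod>i\<in>UNIV. h i ((\<alpha>(k := v)) i)) = h k v * (\<Prod>i\<in>UNIV - {k}. h i (\<alpha> i))"
  by (simp add: prod.remove[of UNIV k])

lemma sum_fun_upd_Suc:
  fixes \<alpha> :: "'d::finite \<Rightarrow> nat"
  shows "(\<Sum>i\<in>UNIV. (\<alpha>(k := Suc (\<alpha> k))) i) = Suc (\<Sum>i\<in>UNIV. \<alpha> i)"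
  by (simp add: sum.remove[of UNIV k])

lemma finite_degree_eq: "finite {\<alpha> :: 'd::finite \<Rightarrow> nat. (\<Sum>k\<in>UNIV. \<alpha> k) = n}"
proof (rule finite_subset)
  show "{\<alpha> :: 'd \<Rightarrow> nat. (\<Sum>k\<in>UNIV. \<alpha> k) = n} \<subseteq> PiE UNIV (\<lambda>_. {..n})"
    by (auto intro: member_le_sum)
  show "finite (PiE (UNIV :: 'd set) (\<lambda>_. {..n}))" by (rule finite_PiE) auto
qed

lemma multinomial_sum:
  fixes x :: "'d::finite \<Rightarrow> real"
  shows "(\<Sum>\<alpha>\<in>{\<alpha>. (\<Sum>k\<in>UNIV. \<alpha> k) = n}. (\<Prod>k\<in>UNIV. x k ^ \<alpha> k) / da_weight \<alpha>) = (\<Sum>k\<in>UNIV. x k) ^ n"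
proof (induction n)
  case 0
  have "{\<alpha> :: 'd \<Rightarrow> nat. (\<Sum>k\<in>UNIV. \<alpha> k) = 0} = {\<lambda>_. 0}" by auto
  then show ?case by (simp add: da_weight_def)
next
  case (Suc n)
  define D where "D m = {\<alpha> :: 'd \<Rightarrow> nat. (\<Sum>k\<in>UNIV. \<alpha> k) = m}" for m
  define g where "g \<alpha> = (\<Prod>k\<in>UNIV. x k ^ \<alpha> k) / da_weight \<alpha>" for \<alpha>
  have fin: "finite (D m)" for m unfolding D_def by (rule finite_degree_eq)
  have shift: "real (Suc (\<beta> k)) / real (Suc n) * g (\<beta>(k := Suc (\<beta> k))) = x k * g \<beta>"
    if "\<beta> \<in> D n" for \<beta> k
  proof -
    have n: "(\<Sum>k\<in>UNIV. \<beta> k) = n" using that by (simp add: D_def)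
    have 1: "(\<Prod>i\<in>UNIV. x i ^ (\<beta>(k := Suc (\<beta> k))) i) = x k * (\<Prod>i\<in>UNIV. x i ^ \<beta> i)"
      by (subst prod_fun_upd[of "\<lambda>i m. x i ^ m"]) (simp add: prod.remove[of UNIV k])
    have 2: "(\<Prod>i\<in>UNIV. fact ((\<beta>(k := Suc (\<beta> k))) i)) = real (Suc (\<beta> k)) * (\<Prod>i\<in>UNIV. fact (\<beta> i))"
      by (subst prod_fun_upd[of "\<lambda>i m. fact m"]) (simp add: prod.remove[of UNIV k])
    have 3: "da_weight (\<beta>(k := Suc (\<beta> k))) = real (Suc (\<beta> k)) / real (Suc n) * da_weight \<beta>"
      unfolding da_weight_def 2 sum_fun_upd_Suc n by simp
    show ?thesis
      using da_weight_pos[of \<beta>] unfolding g_def 1 3 by (simp add: field_simps del: of_nat_Suc)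
  qed
  have "sum g (D (Suc n)) = (\<Sum>\<alpha>\<in>D (Suc n). \<Sum>k\<in>UNIV. real (\<alpha> k) / real (Suc n) * g \<alpha>)"
  proof (rule sum.cong)
    fix \<alpha> assume "\<alpha> \<in> D (Suc n)"
    hence "(\<Sum>k\<in>UNIV. real (\<alpha> k)) = real (Suc n)" by (simp add: D_def flip: of_nat_sum del: of_nat_Suc)
    thus "g \<alpha> = (\<Sum>k\<in>UNIV. real (\<alpha> k) / real (Suc n) * g \<alpha>)"
      by (simp add: sum_distrib_right[symmetric] sum_divide_distrib[symmetric] del: of_nat_Suc)
  qed simp
  also have "\<dots> = (\<Sum>k\<in>UNIV. \<Sum>\<alpha>\<in>D (Suc n). real (\<alpha> k) / real (Suc n) * g \<alpha>)"
    by (rule sum.swap)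
  also have "\<dots> = (\<Sum>k\<in>UNIV. \<Sum>\<beta>\<in>D n. x k * g \<beta>)"
  proof (rule sum.cong)
    fix k :: 'd
    have "(\<Sum>\<alpha>\<in>D (Suc n). real (\<alpha> k) / real (Suc n) * g \<alpha>) =
          (\<Sum>\<alpha>\<in>{\<alpha>\<in>D (Suc n). \<alpha> k > 0}. real (\<alpha> k) / real (Suc n) * g \<alpha>)"
      by (rule sum.mono_neutral_right) (auto simp: fin)
    also have "\<dots> = (\<Sum>\<beta>\<in>D n. x k * g \<beta>)"
    proof (rule sum.reindex_bij_witness[of _ "\<lambda>\<beta>. \<beta>(k := Suc (\<beta> k))" "\<lambda>\<alpha>. \<alpha>(k := \<alpha> k - 1)"])
      fix \<alpha> assume a: "\<alpha> \<in> {\<alpha>\<in>D (Suc n). \<alpha> k > 0}"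
      define \<beta> where "\<beta> = \<alpha>(k := \<alpha> k - 1)"
      have ab: "\<alpha> = \<beta>(k := Suc (\<beta> k))" using a by (auto simp: \<beta>_def)
      show b: "\<alpha>(k := \<alpha> k - 1) \<in> D n"
        using a sum_fun_upd_Suc[of \<beta> k] unfolding \<beta>_def[symmetric] by (simp add: D_def flip: ab)
      show "x k * g (\<alpha>(k := \<alpha> k - 1)) = real (\<alpha> k) / real (Suc n) * g \<alpha>"
        using shift[OF b, of k] unfolding \<beta>_def[symmetric] ab[symmetric]
        by (metis ab fun_upd_same)
      show "(\<alpha>(k := \<alpha> k - 1))(k := Suc ((\<alpha>(k := \<alpha> k - 1)) k)) = \<alpha>"
        using a by auto
    next
      fix \<beta> assume "\<beta> \<in> D n"
      thus "\<beta>(k := Suc (\<beta> k)) \<in> {\<alpha>\<in>D (Suc n). \<alpha> k > 0}"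
        unfolding D_def mem_Collect_eq sum_fun_upd_Suc by simp
    qed auto
    finally show "(\<Sum>\<alpha>\<in>D (Suc n). real (\<alpha> k) / real (Suc n) * g \<alpha>) = (\<Sum>\<beta>\<in>D n. x k * g \<beta>)" .
  qed simp
  also have "\<dots> = (\<Sum>k\<in>UNIV. x k) * sum g (D n)"
    by (simp only: sum_distrib_left[symmetric] sum_distrib_right[symmetric])
  also have "sum g (D n) = (\<Sum>k\<in>UNIV. x k) ^ n"
    using Suc.IH by (simp add: D_def g_def)
  finally show ?case by (simp add: D_def g_def)
qed

lemma da_kernel_summable:
  fixes z :: "complex ^ 'd::finite"
  assumes "z \<in> ball 0 1"
  shows "(\<lambda>\<alpha>. (cmod (zpow z \<alpha>))\<^sup>2 / da_weight \<alpha>) summable_on UNIV"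
proof (rule nonneg_bdd_above_summable_on)
  define r where "r = (norm z)\<^sup>2"
  have r: "0 \<le> r" "r < 1" using assms by (auto simp: r_def abs_square_less_1)
  have r_sum: "(\<Sum>k\<in>UNIV. (cmod (z $ k))\<^sup>2) = r"
    by (simp add: r_def norm_vec_def L2_set_def sum_nonneg)
  define D where "D m = {\<alpha> :: 'd \<Rightarrow> nat. (\<Sum>k\<in>UNIV. \<alpha> k) = m}" for m
  define g where "g \<alpha> = (cmod (zpow z \<alpha>))\<^sup>2 / da_weight \<alpha>" for \<alpha>
  have g0: "g \<alpha> \<ge> 0" for \<alpha> using da_weight_pos[of \<alpha>] by (simp add: g_def)
  have gD: "sum g (D n) = r ^ n" for n
    using multinomial_sum[of "\<lambda>k. (cmod (z $ k))\<^sup>2" n] r_sum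
    by (simp add: D_def g_def zpow_def prod_norm[symmetric] norm_power prod_power_distrib
        power_mult[symmetric] mult.commute[of 2])
  show "bdd_above (sum (\<lambda>\<alpha>. (cmod (zpow z \<alpha>))\<^sup>2 / da_weight \<alpha>) ` {F. F \<subseteq> UNIV \<and> finite F})"
  proof (rule bdd_aboveI2)
    fix F :: "('d \<Rightarrow> nat) set" assume "F \<in> {F. F \<subseteq> UNIV \<and> finite F}"
    hence F: "finite F" by simp
    define N where "N = Suc (Max (insert 0 ((\<lambda>\<alpha>. \<Sum>k\<in>UNIV. \<alpha> k) ` F)))"
    have "F \<subseteq> (\<Union>n<N. D n)"
      using F by (auto simp: D_def N_def less_Suc_eq_le intro!: Max_ge)
    hence "sum g F \<le> sum g (\<Union>n<N. D n)"
      by (intro sum_mono2) (auto simp: g0 D_def finite_degree_eq)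
    also have "\<dots> = (\<Sum>n<N. sum g (D n))"
      by (rule sum.UNION_disjoint) (auto simp: D_def finite_degree_eq)
    also have "\<dots> = (\<Sum>n<N. r ^ n)" by (simp add: gD)
    also have "\<dots> \<le> (\<Sum>n. r ^ n)"
      by (rule sum_le_suminf) (use r in \<open>auto intro: summable_geometric\<close>)
    finally show "sum (\<lambda>\<alpha>. (cmod (zpow z \<alpha>))\<^sup>2 / da_weight \<alpha>) F \<le> (\<Sum>n. r ^ n)"
      by (simp add: g_def)
  qed
qed (auto intro!: divide_nonneg_nonneg less_imp_le[OF da_weight_pos])

lemma da_summable_mult:
  fixes a b :: "'i \<Rightarrow> complex" and w :: "'i \<Rightarrow> real"
  assumes "\<And>i. w i > 0"
  assumes "(\<lambda>i. w i * (cmod (a i))\<^sup>2) summable_on UNIV" "(\<lambda>i. (cmod (b i))\<^sup>2 / w i) summable_on UNIV"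
  shows "(\<lambda>i. a i * b i) summable_on UNIV"
proof (rule abs_summable_summable, rule summable_on_comparison_test)
  show "(\<lambda>i. w i * (cmod (a i))\<^sup>2 + (cmod (b i))\<^sup>2 / w i) summable_on UNIV"
    by (rule summable_on_add[OF assms(2,3)])
  fix i
  define u where "u = sqrt (w i)"
  have u: "u > 0" "w i = u\<^sup>2" using assms(1)[of i] by (auto simp: u_def less_imp_le)
  have "0 \<le> (u * cmod (a i) - cmod (b i) / u)\<^sup>2" by simp
  also have "\<dots> = w i * (cmod (a i))\<^sup>2 + (cmod (b i))\<^sup>2 / w i - 2 * (cmod (a i) * cmod (b i))"
    using u by (simp add: power2_eq_square field_simps)
  finally show "norm (a i * b i) \<le> w i * (cmod (a i))\<^sup>2 + (cmod (b i))\<^sup>2 / w i"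
    using mult_nonneg_nonneg[OF norm_ge_zero[of "a i"] norm_ge_zero[of "b i"]]
    unfolding norm_mult by linarith
qed auto

lemma da_expansion_exists:
  fixes c :: "('d::finite \<Rightarrow> nat) \<Rightarrow> complex"
  assumes "(\<lambda>\<alpha>. da_weight \<alpha> * (cmod (c \<alpha>))\<^sup>2) summable_on UNIV"
  shows "\<exists>f. da_expansion c f"
proof -
  have "da_expansion c (\<lambda>z. if z \<in> ball 0 1 then \<Sum>\<^sub>\<infinity>\<alpha>. c \<alpha> * zpow z \<alpha> else 0)"
    unfolding da_expansion_def
    using assms da_summable_mult[OF da_weight_pos assms da_kernel_summable] by (auto intro: has_sum_infsum)
  thus ?thesis by blast
qed


text \<open>The Drury--Arveson space.  Elements are functions on the ball; Taylor coefficients are unique by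
  \<open>da_expansion_unique\<close>, so \<open>da_coeff\<close> below is well defined.\<close>

typedef ('d::finite) drury_arveson =
  "{f :: complex ^ 'd \<Rightarrow> complex. \<exists>c. da_expansion c f}"
  morphisms da_fun Abs_da
proof -
  have "da_expansion (\<lambda>_. 0) (\<lambda>_. 0)" by (simp add: da_expansion_def)
  thus ?thesis by blast
qed

definition da_coeff :: "'d::finite drury_arveson \<Rightarrow> ('d \<Rightarrow> nat) \<Rightarrow> complex" where
  "da_coeff f = (THE c. da_expansion c (da_fun f))"

lemma da_expansion_coeff: "da_expansion (da_coeff f) (da_fun f)"
proof -
  obtain c where "da_expansion c (da_fun f)" using da_fun[of f] by blast
  thus ?thesis unfolding da_coeff_def by (metis theI da_expansion_unique)
qed

lemma da_coeff_eqI: "da_expansion c (da_fun f) \<Longrightarrow> da_coeff f = c"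
  by (rule da_expansion_unique[OF da_expansion_coeff])

lemma da_expansion_Abs: "da_expansion c g \<Longrightarrow> da_fun (Abs_da g) = g"
  by (rule Abs_da_inverse) blast

lemma da_coeff_Abs: "da_expansion c g \<Longrightarrow> da_coeff (Abs_da g) = c"
  by (rule da_coeff_eqI) (simp add: da_expansion_Abs)

lemma da_expansion_fun_unique:
  assumes "da_expansion c f" "da_expansion c g" shows "f = g"
proof
  fix z show "f z = g z"
  proof (cases "z \<in> ball 0 1")
    case True
    with assms have "((\<lambda>\<alpha>. c \<alpha> * zpow z \<alpha>) has_sum f z) UNIV" "((\<lambda>\<alpha>. c \<alpha> * zpow z \<alpha>) has_sum g z) UNIV"
      by (auto simp: da_expansion_def)
    thus ?thesis by (rule has_sum_unique)
  next
    case False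
    with assms show ?thesis by (simp add: da_expansion_def)
  qed
qed

lemma da_coeff_inject: "da_coeff f = da_coeff g \<longleftrightarrow> f = g"
  by (metis da_expansion_fun_unique da_expansion_coeff da_fun_inject)

lemma da_coeff_summable: "(\<lambda>\<alpha>. da_weight \<alpha> * (cmod (da_coeff f \<alpha>))\<^sup>2) summable_on UNIV"
  using da_expansion_coeff[of f] by (simp add: da_expansion_def)

lemma da_summable_add:
  fixes w :: "'i \<Rightarrow> real"
  assumes "\<And>i. w i > 0"
    and "(\<lambda>i. w i * (cmod (a i))\<^sup>2) summable_on UNIV" "(\<lambda>i. w i * (cmod (b i))\<^sup>2) summable_on UNIV"
  shows "(\<lambda>i. w i * (cmod (a i + b i))\<^sup>2) summable_on UNIV"
proof (rule summable_on_comparison_test)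
  show "(\<lambda>i. 2 * (w i * (cmod (a i))\<^sup>2 + w i * (cmod (b i))\<^sup>2)) summable_on UNIV"
    by (intro summable_on_cmult_right summable_on_add assms)
  fix i
  have "(cmod (a i + b i))\<^sup>2 \<le> (cmod (a i) + cmod (b i))\<^sup>2"
    by (intro power_mono norm_triangle_ineq) simp
  also have "\<dots> \<le> 2 * (cmod (a i))\<^sup>2 + 2 * (cmod (b i))\<^sup>2"
    using sum_squares_bound[of "cmod (a i)" "cmod (b i)"] by (simp add: power2_sum)
  finally have "w i * (cmod (a i + b i))\<^sup>2 \<le> w i * (2 * (cmod (a i))\<^sup>2 + 2 * (cmod (b i))\<^sup>2)"
    using assms(1)[of i] by (intro mult_left_mono) auto
  thus "w i * (cmod (a i + b i))\<^sup>2 \<le> 2 * (w i * (cmod (a i))\<^sup>2 + w i * (cmod (b i))\<^sup>2)"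
    by (simp add: algebra_simps)
qed (use assms(1) in \<open>auto simp: less_imp_le\<close>)

lemma da_expansion_add:
  assumes "da_expansion c f" "da_expansion c' g"
  shows "da_expansion (\<lambda>\<alpha>. c \<alpha> + c' \<alpha>) (\<lambda>z. f z + g z)"
  using assms da_summable_add[OF da_weight_pos] unfolding da_expansion_def
  by (auto simp: distrib_right intro!: has_sum_add)

lemma da_expansion_scale:
  assumes "da_expansion c f"
  shows "da_expansion (\<lambda>\<alpha>. s * c \<alpha>) (\<lambda>z. s * f z)"
proof -
  have "(\<lambda>\<alpha>. (cmod s)\<^sup>2 * (da_weight \<alpha> * (cmod (c \<alpha>))\<^sup>2)) summable_on UNIV"
    using assms by (intro summable_on_cmult_right) (simp add: da_expansion_def)
  thus ?thesis using assms unfolding da_expansion_def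
    by (auto simp: norm_mult power_mult_distrib mult_ac intro!: has_sum_cmult_right)
qed

lemma da_surj:
  assumes "(\<lambda>\<alpha>. da_weight \<alpha> * (cmod (c \<alpha>))\<^sup>2) summable_on UNIV"
  obtains f where "da_coeff f = c"
  using da_expansion_exists[OF assms] da_coeff_Abs by blast

instantiation drury_arveson :: (finite) complex_inner_space
begin

definition "0 = Abs_da (\<lambda>_. 0)"
definition "f + g = Abs_da (\<lambda>z. da_fun f z + da_fun g z)"
definition "c *\<^sub>C f = Abs_da (\<lambda>z. c * da_fun f z)"
definition "scaleR r f = complex_of_real r *\<^sub>C f" for f :: "'a drury_arveson"
definition "- f = (- 1) *\<^sub>C f" for f :: "'a drury_arveson"
definition "f - g = f + (- g)" for f g :: "'a drury_arveson"
definition "cinner f g = (\<Sum>\<^sub>\<infinity>\<alpha>. complex_of_real (da_weight \<alpha>) * da_coeff f \<alpha> * cnj (da_coeff g \<alpha>))"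
definition "inner f g = Re (cinner f g)" for f g :: "'a drury_arveson"
definition "norm f = sqrt (\<Sum>\<^sub>\<infinity>\<alpha>. da_weight \<alpha> * (cmod (da_coeff f \<alpha>))\<^sup>2)" for f :: "'a drury_arveson"
definition "sgn f = scaleR (inverse (norm f)) f" for f :: "'a drury_arveson"
definition "dist f g = norm (f - g)" for f g :: "'a drury_arveson"
definition [code del]: "uniformity = (INF e\<in>{0<..}. principal {(f :: 'a drury_arveson, g). dist f g < e})"
definition [code del]: "open U = (\<forall>f\<in>U. eventually (\<lambda>(f', g). f' = f \<longrightarrow> g \<in> U) uniformity)"
  for U :: "'a drury_arveson set"

lemma da_coeff_zero: "da_coeff 0 = (\<lambda>_. 0)"
  unfolding zero_drury_arveson_def by (rule da_coeff_Abs) (simp add: da_expansion_def)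

lemma da_coeff_add: "da_coeff (f + g) = (\<lambda>\<alpha>. da_coeff f \<alpha> + da_coeff g \<alpha>)"
  unfolding plus_drury_arveson_def by (intro da_coeff_Abs da_expansion_add da_expansion_coeff)

lemma da_coeff_scaleC: "da_coeff (c *\<^sub>C f) = (\<lambda>\<alpha>. c * da_coeff f \<alpha>)"
  unfolding scaleC_drury_arveson_def by (intro da_coeff_Abs da_expansion_scale da_expansion_coeff)

lemma da_coeff_scaleR: "da_coeff (scaleR r f) = (\<lambda>\<alpha>. complex_of_real r * da_coeff f \<alpha>)"
  by (simp add: scaleR_drury_arveson_def da_coeff_scaleC)

lemma da_coeff_uminus: "da_coeff (- f) = (\<lambda>\<alpha>. - da_coeff f \<alpha>)"
  by (simp add: uminus_drury_arveson_def da_coeff_scaleC)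

lemma da_coeff_minus: "da_coeff (f - g) = (\<lambda>\<alpha>. da_coeff f \<alpha> - da_coeff g \<alpha>)"
  by (simp add: minus_drury_arveson_def da_coeff_add da_coeff_uminus)

lemmas da_coeff_simps =
  da_coeff_zero da_coeff_add da_coeff_scaleC da_coeff_scaleR da_coeff_uminus da_coeff_minus

lemma cinner_da_summable:
  "(\<lambda>\<alpha>. complex_of_real (da_weight \<alpha>) * da_coeff f \<alpha> * cnj (da_coeff g \<alpha>)) summable_on UNIV"
proof -
  have "(cmod (complex_of_real (da_weight \<alpha>) * cnj (da_coeff g \<alpha>)))\<^sup>2 / da_weight \<alpha>
        = da_weight \<alpha> * (cmod (da_coeff g \<alpha>))\<^sup>2" for \<alpha>
    using da_weight_pos[of \<alpha>] by (simp add: norm_mult power2_eq_square)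
  then have "(\<lambda>\<alpha>. da_coeff f \<alpha> * (complex_of_real (da_weight \<alpha>) * cnj (da_coeff g \<alpha>))) summable_on UNIV"
    by (intro da_summable_mult[OF da_weight_pos da_coeff_summable]) (simp add: da_coeff_summable)
  thus ?thesis by (simp add: mult_ac)
qed

lemma cinner_da_self:
  "cinner f f = complex_of_real (\<Sum>\<^sub>\<infinity>\<alpha>. da_weight \<alpha> * (cmod (da_coeff f \<alpha>))\<^sup>2)"
proof -
  have "((\<lambda>\<alpha>. complex_of_real (da_weight \<alpha> * (cmod (da_coeff f \<alpha>))\<^sup>2)) has_sum
      complex_of_real (\<Sum>\<^sub>\<infinity>\<alpha>. da_weight \<alpha> * (cmod (da_coeff f \<alpha>))\<^sup>2)) UNIV"
    by (rule has_sum_of_real) (rule has_sum_infsum[OF da_coeff_summable])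
  moreover have "complex_of_real (da_weight \<alpha> * (cmod (da_coeff f \<alpha>))\<^sup>2) =
      complex_of_real (da_weight \<alpha>) * da_coeff f \<alpha> * cnj (da_coeff f \<alpha>)" for \<alpha>
    by (simp only: of_real_mult complex_norm_square mult.assoc)
  ultimately show ?thesis unfolding cinner_drury_arveson_def by (simp only: infsumI)
qed

instance
proof
  fix f g h :: "'a drury_arveson" and a b :: real and c d :: complex
  show "f + g + h = f + (g + h)" "f + g = g + f" "0 + f = f" "- f + f = 0" "f - g = f + - g"
    "scaleR a (f + g) = scaleR a f + scaleR a g"
    "scaleR (a + b) f = scaleR a f + scaleR b f"
    "scaleR a (scaleR b f) = scaleR (a * b) f"
    "scaleR 1 f = f"
    "c *\<^sub>C (f + g) = c *\<^sub>C f + c *\<^sub>C g"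
    "(c + d) *\<^sub>C f = c *\<^sub>C f + d *\<^sub>C f"
    "c *\<^sub>C d *\<^sub>C f = (c * d) *\<^sub>C f"
    "scaleR a f = complex_of_real a *\<^sub>C f"
    unfolding da_coeff_inject[symmetric] by (simp_all add: da_coeff_simps algebra_simps)
  show "dist f g = norm (f - g)" by (fact dist_drury_arveson_def)
  show "sgn f = scaleR (inverse (norm f)) f" by (fact sgn_drury_arveson_def)
  show "uniformity = (INF e\<in>{0<..}. principal {(f :: 'a drury_arveson, g). dist f g < e})"
    by (fact uniformity_drury_arveson_def)
  show "open U = (\<forall>f\<in>U. eventually (\<lambda>(f', g). f' = f \<longrightarrow> g \<in> U) uniformity)"
    for U :: "'a drury_arveson set" by (fact open_drury_arveson_def)
  show cc: "cinner f g = cnj (cinner g f)" for f g :: "'a drury_arveson"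
    unfolding cinner_drury_arveson_def infsum_cnj[symmetric] by (simp add: mult_ac)
  show ca: "cinner (f + g) h = cinner f h + cinner g h"
    unfolding cinner_drury_arveson_def
    by (subst infsum_add[OF cinner_da_summable cinner_da_summable, symmetric])
       (simp add: da_coeff_add algebra_simps)
  show cs: "cinner (c *\<^sub>C f) g = c * cinner f g" for c
    unfolding cinner_drury_arveson_def
    by (subst infsum_cmult_right[OF cinner_da_summable, symmetric])
       (simp add: da_coeff_scaleC mult_ac)
  show "inner f g = Re (cinner f g)" by (fact inner_drury_arveson_def)
  show "inner f g = inner g f"
    unfolding inner_drury_arveson_def by (subst cc) simp
  show "inner (f + g) h = inner f h + inner g h" by (simp add: inner_drury_arveson_def ca)
  show "inner (scaleR a f) g = a * inner f g"
    by (simp add: inner_drury_arveson_def scaleR_drury_arveson_def cs)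
  have self: "inner f f = (\<Sum>\<^sub>\<infinity>\<alpha>. da_weight \<alpha> * (cmod (da_coeff f \<alpha>))\<^sup>2)"
    by (simp add: inner_drury_arveson_def cinner_da_self)
  show "norm f = sqrt (inner f f)" unfolding self norm_drury_arveson_def ..
  have nonneg: "0 \<le> da_weight \<alpha> * (cmod (da_coeff f \<alpha>))\<^sup>2" for \<alpha>
    by (intro mult_nonneg_nonneg less_imp_le[OF da_weight_pos]) auto
  show "0 \<le> inner f f" unfolding self by (intro infsum_nonneg nonneg)
  show "inner f f = 0 \<longleftrightarrow> f = 0"
  proof
    assume 0: "inner f f = 0"
    have "da_weight \<alpha> * (cmod (da_coeff f \<alpha>))\<^sup>2 = 0" for \<alpha>
      by (rule nonneg_infsum_le_0D[OF _ da_coeff_summable]) (use 0 self nonneg in auto)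
    hence "da_coeff f \<alpha> = 0" for \<alpha>
      using da_weight_pos[of \<alpha>] by (metis less_irrefl mult_eq_0_iff norm_eq_zero power_eq_0_iff)
    thus "f = 0" unfolding da_coeff_inject[symmetric] by (auto simp: da_coeff_zero)
  next
    assume "f = 0"
    thus "inner f f = 0" unfolding self by (simp add: da_coeff_zero)
  qed
qed

end

lemma norm_da_sq: "(norm f)\<^sup>2 = (\<Sum>\<^sub>\<infinity>\<alpha>. da_weight \<alpha> * (cmod (da_coeff f \<alpha>))\<^sup>2)"
  for f :: "'d::finite drury_arveson"
  unfolding norm_drury_arveson_def
  by (rule real_sqrt_pow2) (auto intro!: infsum_nonneg mult_nonneg_nonneg less_imp_le[OF da_weight_pos])

lemma finite_sum_le_norm_da:
  fixes f :: "'d::finite drury_arveson"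
  assumes "finite F"
  shows "(\<Sum>\<alpha>\<in>F. da_weight \<alpha> * (cmod (da_coeff f \<alpha>))\<^sup>2) \<le> (norm f)\<^sup>2"
  unfolding norm_da_sq
  by (rule finite_sum_le_infsum[OF da_coeff_summable assms])
     (auto intro!: mult_nonneg_nonneg less_imp_le[OF da_weight_pos])

lemma Cauchy_da_convergent:
  fixes X :: "nat \<Rightarrow> 'd::finite drury_arveson"
  assumes "\<And>e. e > 0 \<Longrightarrow> \<exists>N. \<forall>m\<ge>N. \<forall>n\<ge>N. norm (X m - X n) < e"
  shows "\<exists>f. \<forall>e>0. \<exists>N. \<forall>n\<ge>N. norm (X n - f) \<le> e"
proof -
  have coeff_le: "sqrt (da_weight \<alpha>) * cmod (da_coeff f \<alpha>) \<le> norm f" for f :: "'d drury_arveson" and \<alpha>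
  proof (rule power2_le_imp_le)
    show "(sqrt (da_weight \<alpha>) * cmod (da_coeff f \<alpha>))\<^sup>2 \<le> (norm f)\<^sup>2"
      using finite_sum_le_norm_da[of "{\<alpha>}" f] da_weight_pos[of \<alpha>] by (simp add: power_mult_distrib)
  qed simp
  have "Cauchy (\<lambda>n. da_coeff (X n) \<alpha>)" for \<alpha>
  proof (rule CauchyI)
    fix e :: real assume "e > 0"
    define w where "w = sqrt (da_weight \<alpha>)"
    have w: "w > 0" using da_weight_pos by (simp add: w_def)
    obtain N where N: "\<forall>m\<ge>N. \<forall>n\<ge>N. norm (X m - X n) < w * e"
      using assms[of "w * e"] w \<open>e > 0\<close> by auto
    have "norm (da_coeff (X m) \<alpha> - da_coeff (X n) \<alpha>) < e" if "m \<ge> N" "n \<ge> N" for m n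
    proof -
      have "w * cmod (da_coeff (X m) \<alpha> - da_coeff (X n) \<alpha>) < w * e"
        using coeff_le[of \<alpha> "X m - X n"] N that unfolding w_def da_coeff_minus
        by (meson le_less_trans)
      thus ?thesis using w by simp
    qed
    thus "\<exists>N. \<forall>m\<ge>N. \<forall>n\<ge>N. norm (da_coeff (X m) \<alpha> - da_coeff (X n) \<alpha>) < e" by blast
  qed
  hence "\<forall>\<alpha>. \<exists>l. (\<lambda>n. da_coeff (X n) \<alpha>) \<longlonglongrightarrow> l"
    by (simp add: Cauchy_convergent_iff convergent_def)
  then obtain c where c: "\<And>\<alpha>. (\<lambda>n. da_coeff (X n) \<alpha>) \<longlonglongrightarrow> c \<alpha>" by metis
  have bound: "(\<Sum>\<alpha>\<in>F. da_weight \<alpha> * (cmod (da_coeff (X n) \<alpha> - c \<alpha>))\<^sup>2) \<le> e\<^sup>2"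
    if N: "\<forall>m\<ge>N. \<forall>n\<ge>N. norm (X m - X n) < e" and "n \<ge> N" "finite F" for e N n F
  proof (rule LIMSEQ_le_const2)
    show "(\<lambda>m. \<Sum>\<alpha>\<in>F. da_weight \<alpha> * (cmod (da_coeff (X n) \<alpha> - da_coeff (X m) \<alpha>))\<^sup>2) \<longlonglongrightarrow>
        (\<Sum>\<alpha>\<in>F. da_weight \<alpha> * (cmod (da_coeff (X n) \<alpha> - c \<alpha>))\<^sup>2)"
      by (intro tendsto_intros c)
    have "(\<Sum>\<alpha>\<in>F. da_weight \<alpha> * (cmod (da_coeff (X n) \<alpha> - da_coeff (X m) \<alpha>))\<^sup>2) \<le> e\<^sup>2" if "m \<ge> N" for m
    proof -
      have "(\<Sum>\<alpha>\<in>F. da_weight \<alpha> * (cmod (da_coeff (X n) \<alpha> - da_coeff (X m) \<alpha>))\<^sup>2) \<le> (norm (X n - X m))\<^sup>2"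
        using finite_sum_le_norm_da[OF \<open>finite F\<close>, of "X n - X m"] by (simp add: da_coeff_minus)
      also have "\<dots> \<le> e\<^sup>2"
      proof (rule power_mono)
        show "norm (X n - X m) \<le> e" using N \<open>m \<ge> N\<close> \<open>n \<ge> N\<close> by (simp add: less_imp_le)
  qed simp
      finally show ?thesis .
    qed
    thus "\<exists>M. \<forall>m\<ge>M. (\<Sum>\<alpha>\<in>F. da_weight \<alpha> * (cmod (da_coeff (X n) \<alpha> - da_coeff (X m) \<alpha>))\<^sup>2) \<le> e\<^sup>2"
      by blast
  qed
  have summ: "(\<lambda>\<alpha>. da_weight \<alpha> * (cmod (da_coeff (X n) \<alpha> - c \<alpha>))\<^sup>2) summable_on UNIV"
    if "\<forall>m\<ge>N. \<forall>n\<ge>N. norm (X m - X n) < e" and "n \<ge> N" for e N n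
  proof (rule nonneg_bdd_above_summable_on)
    show "bdd_above (sum (\<lambda>\<alpha>. da_weight \<alpha> * (cmod (da_coeff (X n) \<alpha> - c \<alpha>))\<^sup>2) ` {F. F \<subseteq> UNIV \<and> finite F})"
      by (rule bdd_aboveI2[where M = "e\<^sup>2"]) (use bound[OF that] in auto)
  qed (auto intro!: mult_nonneg_nonneg less_imp_le[OF da_weight_pos])
  obtain N1 where N1: "\<forall>m\<ge>N1. \<forall>n\<ge>N1. norm (X m - X n) < 1" using assms[of 1] by auto
  have "(\<lambda>\<alpha>. da_weight \<alpha> * (cmod (da_coeff (X N1) \<alpha> + (-1) * (da_coeff (X N1) \<alpha> - c \<alpha>)))\<^sup>2) summable_on UNIV"
    by (rule da_summable_add[OF da_weight_pos da_coeff_summable])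
       (use summ[OF N1 order_refl] in \<open>simp add: norm_minus_commute\<close>)
  hence "(\<lambda>\<alpha>. da_weight \<alpha> * (cmod (c \<alpha>))\<^sup>2) summable_on UNIV" by simp
  then obtain f :: "'d drury_arveson" where f: "da_coeff f = c" by (rule da_surj)
  have "\<exists>N. \<forall>n\<ge>N. norm (X n - f) \<le> e" if "e > 0" for e
  proof -
    obtain N where N: "\<forall>m\<ge>N. \<forall>n\<ge>N. norm (X m - X n) < e" using assms[OF \<open>e > 0\<close>] by blast
    have "norm (X n - f) \<le> e" if "n \<ge> N" for n
    proof (rule power2_le_imp_le)
      show "(norm (X n - f))\<^sup>2 \<le> e\<^sup>2" unfolding norm_da_sq
        by (rule infsum_le_finite_sums[OF da_coeff_summable])
           (use bound[OF N that] f in \<open>simp add: da_coeff_minus\<close>)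
    qed (use \<open>e > 0\<close> in simp)
    thus ?thesis by blast
  qed
  thus ?thesis by blast
qed


instance drury_arveson :: (finite) complex_hilbert_space
proof
  fix X :: "nat \<Rightarrow> 'a drury_arveson" assume X: "Cauchy X"
  have "\<exists>f. \<forall>e>0. \<exists>N. \<forall>n\<ge>N. norm (X n - f) \<le> e"
    by (rule Cauchy_da_convergent) (use CauchyD[OF X] in blast)
  then obtain f where f: "\<And>e. e > 0 \<Longrightarrow> \<exists>N. \<forall>n\<ge>N. norm (X n - f) \<le> e" by blast
  have "X \<longlonglongrightarrow> f"
  proof (rule LIMSEQ_I)
    fix e :: real assume "e > 0"
    with f[of "e / 2"] obtain N where "\<forall>n\<ge>N. norm (X n - f) \<le> e / 2" by auto
    with \<open>e > 0\<close> show "\<exists>N. \<forall>n\<ge>N. norm (X n - f) < e"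
      by (intro exI[of _ N]) (auto intro: le_less_trans)
  qed
  thus "convergent X" by (rule convergentI)
qed


definition closed_csubspace :: "'a::complex_inner_space set \<Rightarrow> bool" where
  "closed_csubspace M \<longleftrightarrow> cvs.subspace M \<and> closed M"

text \<open>A Hilbert space is given either by a whole type (carrier \<^term>\<open>UNIV\<close>) or by a closed subspace of such
  a type, so that compressions to subspaces are again operators on a Hilbert space.  Operators
  from \<open>H\<close> to \<open>K\<close> are extensional functions, hence are equal iff they agree on \<open>H\<close>.\<close>

definition bounded_ops :: "'a::complex_inner_space set \<Rightarrow> 'b::complex_inner_space set \<Rightarrow> ('a \<Rightarrow> 'b) set" where
  "bounded_ops H K = {A \<in> H \<rightarrow>\<^sub>E K.
     (\<forall>x\<in>H. \<forall>y\<in>H. A (x + y) = A x + A y) \<and>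
     (\<forall>c. \<forall>x\<in>H. A (c *\<^sub>C x) = c *\<^sub>C A x) \<and>
     (\<exists>B. \<forall>x\<in>H. norm (A x) \<le> B * norm x)}"

definition hadj :: "'a::complex_inner_space set \<Rightarrow> 'b::complex_inner_space set \<Rightarrow> ('a \<Rightarrow> 'b) \<Rightarrow> 'b \<Rightarrow> 'a" where
  "hadj H K A = (THE B. B \<in> bounded_ops K H \<and> (\<forall>x\<in>H. \<forall>y\<in>K. cinner (A x) y = cinner x (B y)))"

definition orth_compl :: "'a::complex_inner_space set \<Rightarrow> 'a set" where
  "orth_compl S = {x. \<forall>y\<in>S. cinner x y = 0}"

definition orth_proj :: "'a::complex_inner_space set \<Rightarrow> 'a \<Rightarrow> 'a" where
  "orth_proj M x = (THE y. y \<in> M \<and> x - y \<in> orth_compl M)"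

definition compression :: "'a::complex_inner_space set \<Rightarrow> ('d \<Rightarrow> 'a \<Rightarrow> 'a) \<Rightarrow> 'd \<Rightarrow> 'a \<Rightarrow> 'a" where
  "compression M T k = (\<lambda>x\<in>M. orth_proj M (T k x))"

primrec word_op :: "'a set \<Rightarrow> ('d \<Rightarrow> 'a \<Rightarrow> 'a) \<Rightarrow> 'd list \<Rightarrow> 'a \<Rightarrow> 'a" where
  "word_op H T [] = (\<lambda>x\<in>H. x)"
| "word_op H T (i # w) = compose H (T i) (word_op H T w)"

text \<open>The order on \<^typ>\<open>complex\<close> requires equal imaginary parts, so this is the operator inequality
  $\sum_k T_k T_k^* \le I$.\<close>

definition row_contraction :: "'a::complex_inner_space set \<Rightarrow> ('d::finite \<Rightarrow> 'a \<Rightarrow> 'a) \<Rightarrow> bool" where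
  "row_contraction H T \<longleftrightarrow>
     (\<forall>k. T k \<in> bounded_ops H H) \<and>
     (\<forall>\<xi>\<in>H. cinner (\<Sum>k\<in>UNIV. T k (hadj H H (T k) \<xi>)) \<xi> \<le> cinner \<xi> \<xi>)"

definition commuting_tuple :: "'a set \<Rightarrow> ('d \<Rightarrow> 'a \<Rightarrow> 'a) \<Rightarrow> bool" where
  "commuting_tuple H T \<longleftrightarrow> (\<forall>j k. \<forall>x\<in>H. T j (T k x) = T k (T j x))"

definition pure_tuple :: "'a::complex_inner_space set \<Rightarrow> ('d::finite \<Rightarrow> 'a \<Rightarrow> 'a) \<Rightarrow> bool" where
  "pure_tuple H T \<longleftrightarrow>
     (\<forall>\<xi>\<in>H. (\<lambda>n. \<Sum>w | length w = n. (norm (hadj H H (word_op H T w) \<xi>))\<^sup>2) \<longlonglongrightarrow> 0)"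

definition cyclic_tuple :: "'a::complex_inner_space set \<Rightarrow> ('d \<Rightarrow> 'a \<Rightarrow> 'a) \<Rightarrow> bool" where
  "cyclic_tuple H T \<longleftrightarrow> (\<exists>\<xi>\<in>H. H = closure (cvs.span (range (\<lambda>w. word_op H T w \<xi>))))"

definition coinvariant :: "'a::complex_inner_space set \<Rightarrow> ('d \<Rightarrow> 'a \<Rightarrow> 'a) \<Rightarrow> 'a set \<Rightarrow> bool" where
  "coinvariant H T M \<longleftrightarrow> M \<subseteq> H \<and> (\<forall>k. hadj H H (T k) ` M \<subseteq> M)"

text \<open>$Q(S',S)$ for tuples \<open>S'\<close> on \<open>H'\<close> and \<open>S\<close> on \<open>H\<close>.\<close>

definition quasi_intertwiners :: "'b::complex_inner_space set \<Rightarrow> ('d \<Rightarrow> 'b \<Rightarrow> 'b) \<Rightarrow>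
    'a::complex_inner_space set \<Rightarrow> ('d \<Rightarrow> 'a \<Rightarrow> 'a) \<Rightarrow> ('b \<Rightarrow> 'a) set" where
  "quasi_intertwiners H' S' H S = {X \<in> bounded_ops H' H.
     inj_on X H' \<and> H \<subseteq> closure (X ` H') \<and> (\<forall>k. \<forall>x\<in>H'. X (S' k x) = S k (X x))}"

text \<open>The weak-* topology of $B(H)$ as the dual of the trace class: the trace-class operators are the
  sums $\sum_n \xi_n \otimes \eta_n^*$ with square-summable sequences of norms, acting on $A$ by
  $\sum_n \langle A \xi_n, \eta_n\rangle$.\<close>

definition weak_star :: "'a::complex_inner_space set \<Rightarrow> ('a \<Rightarrow> 'a) topology" where
  "weak_star H = topology_generated_by
     {{A \<in> bounded_ops H H. (\<Sum>n. cinner (A (\<xi> n)) (\<eta> n)) \<in> U} | \<xi> \<eta> U.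
        range \<xi> \<subseteq> H \<and> range \<eta> \<subseteq> H \<and> summable (\<lambda>n. (norm (\<xi> n))\<^sup>2) \<and> summable (\<lambda>n. (norm (\<eta> n))\<^sup>2) \<and> open U}"

text \<open>Norm of an $n \times n$ operator matrix acting on the $n$-fold Hilbert space direct sum of \<open>H\<close>.\<close>

definition matrix_norm :: "'a::complex_inner_space set \<Rightarrow> nat \<Rightarrow> (nat \<Rightarrow> nat \<Rightarrow> 'a \<Rightarrow> 'a) \<Rightarrow> real" where
  "matrix_norm H n A = Inf {C. C \<ge> 0 \<and> (\<forall>x. (\<forall>j<n. x j \<in> H) \<longrightarrow>
     sqrt (\<Sum>i<n. (norm (\<Sum>j<n. A i j (x j)))\<^sup>2) \<le> C * sqrt (\<Sum>j<n. (norm (x j))\<^sup>2))}"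

definition mult_op :: "(complex ^ 'd \<Rightarrow> complex) \<Rightarrow> 'd::finite drury_arveson \<Rightarrow> 'd drury_arveson" where
  "mult_op \<phi> f = Abs_da (\<lambda>z. \<phi> z * da_fun f z)"

text \<open>The multiplier algebra as a subset of $B(H^2_d)$, a multiplier being identified with its
  multiplication operator.  (Boundedness is automatic by the closed graph theorem.)\<close>

definition multiplier_algebra :: "('d::finite drury_arveson \<Rightarrow> 'd drury_arveson) set" where
  "multiplier_algebra = {mult_op \<phi> | \<phi>.
     (\<forall>f. (\<lambda>z. \<phi> z * da_fun f z) \<in> range da_fun) \<and> mult_op \<phi> \<in> bounded_ops UNIV UNIV}"

definition coord_mult :: "'d::finite \<Rightarrow> 'd drury_arveson \<Rightarrow> 'd drury_arveson" where
  "coord_mult k = mult_op (\<lambda>z. z $ k)"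

text \<open>Unital completely contractive weak-* continuous homomorphisms from the multiplier algebra to
  $B(H)$ sending the coordinate multipliers to the \<open>T k\<close>.\<close>

definition is_functional_calculus ::
    "'a::complex_inner_space set \<Rightarrow> ('d::finite \<Rightarrow> 'a \<Rightarrow> 'a) \<Rightarrow>
     (('d drury_arveson \<Rightarrow> 'd drury_arveson) \<Rightarrow> 'a \<Rightarrow> 'a) \<Rightarrow> bool" where
  "is_functional_calculus H T \<Phi> \<longleftrightarrow>
     \<Phi> \<in> multiplier_algebra \<rightarrow>\<^sub>E bounded_ops H H \<and>
     \<Phi> (\<lambda>f. f) = (\<lambda>x\<in>H. x) \<and>
     (\<forall>A\<in>multiplier_algebra. \<forall>B\<in>multiplier_algebra. \<forall>x\<in>H.
        \<Phi> (\<lambda>f. A f + B f) x = \<Phi> A x + \<Phi> B x \<and> \<Phi> (\<lambda>f. A (B f)) x = \<Phi> A (\<Phi> B x)) \<and>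
     (\<forall>c. \<forall>A\<in>multiplier_algebra. \<forall>x\<in>H. \<Phi> (\<lambda>f. c *\<^sub>C A f) x = c *\<^sub>C \<Phi> A x) \<and>
     (\<forall>n A. (\<forall>i<n. \<forall>j<n. A i j \<in> multiplier_algebra) \<longrightarrow>
        matrix_norm H n (\<lambda>i j. \<Phi> (A i j)) \<le> matrix_norm UNIV n A) \<and>
     continuous_map (subtopology (weak_star UNIV) multiplier_algebra) (weak_star H) \<Phi> \<and>
     (\<forall>k. \<Phi> (coord_mult k) = T k)"

definition functional_calculus ::
    "'a::complex_inner_space set \<Rightarrow> ('d::finite \<Rightarrow> 'a \<Rightarrow> 'a) \<Rightarrow>
     ('d drury_arveson \<Rightarrow> 'd drury_arveson) \<Rightarrow> 'a \<Rightarrow> 'a" where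
  "functional_calculus H T = (THE \<Phi>. is_functional_calculus H T \<Phi>)"

definition Ann_c :: "'a::complex_inner_space set \<Rightarrow> ('d::finite \<Rightarrow> 'a \<Rightarrow> 'a) \<Rightarrow>
    ('d drury_arveson \<Rightarrow> 'd drury_arveson) set" where
  "Ann_c H T = {A \<in> multiplier_algebra. \<forall>x\<in>H. functional_calculus H T A x = 0}"

text \<open>$H_J$ and $M_J$.\<close>

definition model_space :: "('d::finite drury_arveson \<Rightarrow> 'd drury_arveson) set \<Rightarrow> 'd drury_arveson set" where
  "model_space J = orth_compl (closure (cvs.span {\<theta> f | \<theta> f. \<theta> \<in> J}))"

definition model_tuple :: "('d::finite drury_arveson \<Rightarrow> 'd drury_arveson) set \<Rightarrow>
    'd \<Rightarrow> 'd drury_arveson \<Rightarrow> 'd drury_arveson" where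
  "model_tuple J = compression (model_space J) coord_mult"

end

(* Let X be in Q(M_J, T) and put Y = P_M X P_{H_J}, a map from the Drury-Arveson space to M with dense range
   that intertwines the coordinate multipliers with the compression of T to M.  Then phi(P_M T|_M) Y = Y M_phi
   and Y^* = X^* on M, so phi annihilates P_M T|_M iff the range of M_phi lies in the orthogonal complement E
   of X^* M.  Since E is invariant, it is generated by the ranges of the multipliers that it contains (a
   Beurling-type theorem).  Hence the annihilator determines E and the closure of X^* M, and X^* is injective
   because X has dense range.

   The functional calculus is phi(T) = V^* (M_phi (x) I) V, where V is the isometry with components the
   Poisson maps K_v h = sum_alpha <T^*alpha h, v> x^alpha / weight(alpha), and v runs over the vectors of a
   rank-one decomposition of the defect operator I - sum_k T_k T_k^*.  It is unique because the Fejer means of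
   a multiplier are polynomials of no larger norm converging to it in the weak-* topology. *)

theory Submission
  imports Defs
begin

section \<open>Complex inner product spaces\<close>

text \<open>\<open>functional_calculus\<close> is a definite description, so an annihilator of a
  compression means something only once a calculus with all the prescribed properties, complete
  contractivity and weak-star continuity included, is known to exist and to be unique. The classical
  construction embeds the space into the tensor product of H^2_d with the closed range of the square
  root of the defect operator. Here the square root and the tensor product are both replaced by a
  sequence of scalar Poisson maps: Cholesky elimination along a sequence with dense span splits the
  defect form into squares |<x, v_i>|^2, and cyclicity provides such a sequence, since the words,
  and hence the orbit of the cyclic vector, are countable. The Beurling-type step applies the same
  maps to the coordinate multipliers on \<open>E\<close>. There the single vectors
  \<open>defect_op g\<close> with \<open>g\<close> in \<open>E\<close> take the place of the
  Cholesky vectors, and the adjoints of their Poisson maps are themselves the required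
  multipliers.\<close>

lemma cinner_add_right: "cinner x (y + z) = cinner x y + cinner x (z :: 'a::complex_inner_space)"
  by (metis cinner_add_left cinner_commute complex_cnj_add)

lemma cinner_scaleC_right: "cinner x (c *\<^sub>C y) = cnj c * cinner x (y :: 'a::complex_inner_space)"
  by (metis cinner_commute cinner_scaleC_left complex_cnj_mult)

lemma cinner_self: "cinner x x = complex_of_real ((norm (x :: 'a::complex_inner_space))\<^sup>2)"
proof (rule complex_eqI)
  show "Re (cinner x x) = Re (complex_of_real ((norm x)\<^sup>2))"
    by (simp add: power2_norm_eq_inner inner_eq_Re_cinner)
  have "cinner x x = cnj (cinner x x)"
    by (rule cinner_commute)
  then have "Im (cinner x x) = Im (cnj (cinner x x))"
    by (rule arg_cong)
  then show "Im (cinner x x) = Im (complex_of_real ((norm x)\<^sup>2))"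
    by simp
qed

lemma norm_scaleC: "norm (c *\<^sub>C x) = cmod c * norm (x :: 'a::complex_inner_space)"
proof -
  have "complex_of_real ((norm (c *\<^sub>C x))\<^sup>2) = c * cnj c * complex_of_real ((norm x)\<^sup>2)"
    unfolding cinner_self[symmetric] cinner_scaleC_left cinner_scaleC_right by simp
  also have "\<dots> = complex_of_real ((cmod c * norm x)\<^sup>2)"
    by (simp add: complex_norm_square[symmetric] power_mult_distrib flip: of_real_power of_real_mult)
  finally have "(norm (c *\<^sub>C x))\<^sup>2 = (cmod c * norm x)\<^sup>2"
    using of_real_eq_iff by blast
  then show ?thesis
    by (rule power2_eq_imp_eq) auto
qed

lemma norm_cinner_le: "cmod (cinner x y) \<le> norm x * norm (y :: 'a::complex_inner_space)"
proof (cases "cinner x y = 0")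
  case False
  \<comment> \<open>Rotating \<open>x\<close> by the unimodular \<open>c\<close> makes the inner
    product real and nonnegative, so that the real Cauchy-Schwarz inequality applies.\<close>
  define c where "c = cnj (cinner x y) / complex_of_real (cmod (cinner x y))"
  have "cmod c = 1"
    using False by (simp add: c_def norm_divide)
  have "c * cinner x y = complex_of_real (cmod (cinner x y))"
    using False complex_norm_square[of "cinner x y"]
    by (simp add: c_def field_simps power2_eq_square)
  then have "cmod (cinner x y) = Re (cinner (c *\<^sub>C x) y)"
    by (simp add: cinner_scaleC_left)
  also have "\<dots> = inner (c *\<^sub>C x) y"
    by (simp add: inner_eq_Re_cinner)
  also have "\<dots> \<le> norm (c *\<^sub>C x) * norm y"
    by (rule norm_cauchy_schwarz)
  finally show ?thesis
    using \<open>cmod c = 1\<close> by (simp add: norm_scaleC)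
qed simp

text \<open>Conjugate linearity is still real linearity, so the theory of real bounded bilinear maps
  supplies limits, differences and finite sums for \<open>cinner\<close>.\<close>

lemma bounded_bilinear_cinner:
  "bounded_bilinear (cinner :: 'a::complex_inner_space \<Rightarrow> 'a \<Rightarrow> complex)"
proof
  show "\<exists>K. \<forall>a b :: 'a. norm (cinner a b) \<le> norm a * norm b * K"
    by (rule exI[of _ 1]) (simp add: norm_cinner_le)
qed (simp_all add: cinner_add_left cinner_add_right scaleR_eq_scaleC cinner_scaleC_left
      cinner_scaleC_right scaleR_conv_of_real)

interpretation cinner: bounded_bilinear
  "cinner :: 'a::complex_inner_space \<Rightarrow> 'a \<Rightarrow> complex"
  by (rule bounded_bilinear_cinner)

lemma bounded_bilinear_scaleC:
  "bounded_bilinear (scaleC :: complex \<Rightarrow> 'a::complex_inner_space \<Rightarrow> 'a)"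
proof
  show "\<exists>K. \<forall>a (b :: 'a). norm (a *\<^sub>C b) \<le> norm a * norm b * K"
    by (rule exI[of _ 1]) (simp add: norm_scaleC)
qed (simp_all add: scaleC_add_left scaleC_add_right scaleR_eq_scaleC scaleC_scaleC
      scaleR_conv_of_real mult.commute)

interpretation scaleC: bounded_bilinear
  "scaleC :: complex \<Rightarrow> 'a::complex_inner_space \<Rightarrow> 'a"
  by (rule bounded_bilinear_scaleC)

lemma minus_eq_scaleC: "x - y = x + (- 1) *\<^sub>C (y :: 'a::complex_inner_space)"
  by (metis cvs.scale_minus_left cvs.scale_one diff_conv_add_uminus)

lemma cinner_eq_0_commute: "cinner x y = 0 \<longleftrightarrow> cinner y (x :: 'a::complex_inner_space) = 0"
  by (metis cinner_commute complex_cnj_zero)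

lemma cinner_ext:
  fixes x y :: "'a::complex_inner_space"
  assumes M: "cvs.subspace M" and "x \<in> M" "y \<in> M" and eq: "\<And>z. z \<in> M \<Longrightarrow> cinner x z = cinner y z"
  shows "x = y"
proof -
  have "x - y \<in> M"
    using assms by (simp add: cvs.subspace_diff)
  then have "cinner (x - y) (x - y) = 0"
    using eq by (simp add: cinner.diff_left)
  then show ?thesis
    by (simp add: cinner_self)
qed

text \<open>This is what upgrades the norm identity \<open>K_norm\<close> of the Poisson maps to the
  inner product identity \<open>K_cinner\<close>.\<close>

lemma polarization:
  fixes x y :: "'a::complex_inner_space"
  shows "4 * cinner x y = of_real ((norm (x + y))\<^sup>2) - of_real ((norm (x - y))\<^sup>2)
    + \<i> * of_real ((norm (x + \<i> *\<^sub>C y))\<^sup>2) - \<i> * of_real ((norm (x - \<i> *\<^sub>C y))\<^sup>2)"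
  unfolding cinner_self[symmetric]
  by (simp add: cinner.add_left cinner.add_right cinner.diff_left cinner.diff_right
      cinner_scaleC_left cinner_scaleC_right algebra_simps)

section \<open>Projections and the Riesz representation\<close>

lemma closed_csubspace_UNIV [simp]: "closed_csubspace UNIV"
  by (simp add: closed_csubspace_def cvs.subspace_def)

lemma closed_csubspaceD:
  assumes "closed_csubspace M"
  shows "cvs.subspace M" "closed M" "0 \<in> M"
    "\<And>x y. x \<in> M \<Longrightarrow> y \<in> M \<Longrightarrow> x + y \<in> M"
    "\<And>x y. x \<in> M \<Longrightarrow> y \<in> M \<Longrightarrow> x - y \<in> M"
    "\<And>c x. x \<in> M \<Longrightarrow> c *\<^sub>C x \<in> M"
  using assms unfolding closed_csubspace_def
  by (auto simp: cvs.subspace_0 cvs.subspace_add cvs.subspace_diff cvs.subspace_scale)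

lemma closed_csubspace_orth_compl: "closed_csubspace (orth_compl S)"
proof -
  have "orth_compl S = (\<Inter>y\<in>S. {x. cinner x y = 0})"
    by (auto simp: orth_compl_def)
  moreover have "closed {x. cinner x y = 0}" for y :: 'a
    by (intro closed_Collect_eq continuous_intros cinner.continuous_on)
  ultimately have "closed (orth_compl S)"
    by auto
  then show ?thesis
    unfolding closed_csubspace_def cvs.subspace_def orth_compl_def
    by (auto simp: cinner.add_left cinner_scaleC_left cinner.zero_left)
qed

lemma closed_csubspace_closure:
  assumes "cvs.subspace S"
  shows "closed_csubspace (closure S)"
proof -
  have "x + y \<in> closure S" if "x \<in> closure S" "y \<in> closure S" for x y
  proof -
    obtain a b where "\<And>n. a n \<in> S" "a \<longlonglongrightarrow> x" "\<And>n. b n \<in> S" "b \<longlonglongrightarrow> y"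
      using \<open>x \<in> closure S\<close> \<open>y \<in> closure S\<close> unfolding closure_sequential by blast
    then have "(\<lambda>n. a n + b n) \<longlonglongrightarrow> x + y" "\<And>n. a n + b n \<in> S"
      using assms by (auto intro: tendsto_add cvs.subspace_add)
    then show ?thesis
      unfolding closure_sequential by (intro exI[of _ "\<lambda>n. a n + b n"] conjI allI)
  qed
  moreover have "c *\<^sub>C x \<in> closure S" if x: "x \<in> closure S" for c x
  proof -
    obtain a where "\<And>n. a n \<in> S" "a \<longlonglongrightarrow> x"
      using x unfolding closure_sequential by blast
    then have "(\<lambda>n. c *\<^sub>C a n) \<longlonglongrightarrow> c *\<^sub>C x" "\<And>n. c *\<^sub>C a n \<in> S"
      using assms by (auto intro: scaleC.tendsto cvs.subspace_scale)
    then show ?thesis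
      unfolding closure_sequential by (intro exI[of _ "\<lambda>n. c *\<^sub>C a n"] conjI allI)
  qed
  moreover have "0 \<in> closure S"
    using cvs.subspace_0[OF assms] closure_subset by blast
  ultimately show ?thesis
    by (simp add: closed_csubspace_def cvs.subspace_def)
qed

lemma orth_compl_closure: "orth_compl (closure S) = orth_compl S"
proof
  show "orth_compl (closure S) \<subseteq> orth_compl S"
    using closure_subset by (fastforce simp: orth_compl_def)
  show "orth_compl S \<subseteq> orth_compl (closure S)"
  proof
    fix x assume x: "x \<in> orth_compl S"
    have "closed {y. cinner x y = 0}"
      by (intro closed_Collect_eq continuous_intros cinner.continuous_on)
    then have "closure S \<subseteq> {y. cinner x y = 0}"
      using x by (intro closure_minimal) (auto simp: orth_compl_def)
    then show "x \<in> orth_compl (closure S)"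
      by (auto simp: orth_compl_def)
  qed
qed

lemma orth_compl_disjoint:
  assumes "x \<in> M" "x \<in> orth_compl M"
  shows "x = 0"
  using assms cinner_self[of x] by (auto simp: orth_compl_def)

lemma closest_point_orthogonal:
  fixes x y :: "'a::complex_inner_space"
  assumes M: "cvs.subspace M" and y: "y \<in> M" and min: "\<And>z. z \<in> M \<Longrightarrow> norm (x - y) \<le> norm (x - z)"
  shows "x - y \<in> orth_compl M"
proof -
  have "cinner (x - y) z = 0" if z: "z \<in> M" for z
  proof (cases "z = 0")
    case False
    define u where "u = x - y"
    \<comment> \<open>\<open>a *\<^sub>C z\<close> is the projection of \<open>u\<close> onto the
      line of \<open>z\<close>. Moving \<open>y\<close> by it would shorten the distance by exactly
      \<open>(cmod (cinner u z))\<^sup>2 / (norm z)\<^sup>2\<close>, so minimality makes this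
      quantity vanish.\<close>
    define a where "a = cinner u z / complex_of_real ((norm z)\<^sup>2)"
    have nz: "(norm z)\<^sup>2 > 0"
      using False by simp
    have "y + a *\<^sub>C z \<in> M"
      using M y z by (simp add: cvs.subspace_add cvs.subspace_scale)
    then have "norm u \<le> norm (u - a *\<^sub>C z)"
      using min by (simp add: u_def diff_diff_eq)
    then have le: "(norm u)\<^sup>2 \<le> (norm (u - a *\<^sub>C z))\<^sup>2"
      by (rule power_mono) simp
    have "complex_of_real ((norm (u - a *\<^sub>C z))\<^sup>2)
        = cinner u u - cnj a * cinner u z - a * cinner z u + a * cnj a * cinner z z"
      unfolding cinner_self[symmetric]
      by (simp add: cinner.diff_left cinner.diff_right cinner_scaleC_left cinner_scaleC_right
          algebra_simps)
    also have "a * cnj a * cinner z z = a * cinner z u"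
      using nz cinner_commute[of z u] by (simp add: a_def cinner_self del: of_real_power)
    also have "cnj a * cinner u z = complex_of_real ((cmod (cinner u z))\<^sup>2 / (norm z)\<^sup>2)"
      using complex_norm_square[of "cinner u z"] by (simp add: a_def mult.commute)
    finally have "complex_of_real ((norm (u - a *\<^sub>C z))\<^sup>2)
        = complex_of_real ((norm u)\<^sup>2 - (cmod (cinner u z))\<^sup>2 / (norm z)\<^sup>2)"
      by (simp add: cinner_self)
    then have "(norm (u - a *\<^sub>C z))\<^sup>2 = (norm u)\<^sup>2 - (cmod (cinner u z))\<^sup>2 / (norm z)\<^sup>2"
      using of_real_eq_iff by blast
    with le have "(cmod (cinner u z))\<^sup>2 / (norm z)\<^sup>2 \<le> 0"
      by simp
    then show ?thesis
      using nz by (simp add: divide_le_0_iff u_def)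
  qed (simp add: cinner.zero_right)
  then show ?thesis
    by (simp add: orth_compl_def)
qed

lemma closest_point_exists:
  fixes x :: "'a::complex_hilbert_space"
  assumes M: "closed_csubspace M"
  shows "\<exists>y\<in>M. \<forall>z\<in>M. norm (x - y) \<le> norm (x - z)"
proof -
  define d where "d = (INF z\<in>M. norm (x - z))"
  note Ms = closed_csubspaceD[OF M]
  have bdd: "bdd_below ((\<lambda>z. norm (x - z)) ` M)"
    by (rule bdd_belowI2[of _ 0]) simp
  have d_le: "d \<le> norm (x - z)" if "z \<in> M" for z
    unfolding d_def by (rule cINF_lower[OF bdd that])
  have d0: "d \<ge> 0"
    unfolding d_def by (rule cINF_greatest) (use Ms(3) in auto)
  have "\<exists>z\<in>M. norm (x - z) < d + 1 / Suc n" for n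
  proof (rule ccontr)
    assume "\<not> ?thesis"
    then have "d + 1 / Suc n \<le> d"
      unfolding d_def using Ms(3) by (intro cINF_greatest) (auto simp: not_less d_def)
    then show False
      by (simp add: field_simps)
  qed
  then obtain y where y: "\<And>n. y n \<in> M" "\<And>n. norm (x - y n) < d + 1 / Suc n"
    by metis
  have lim: "(\<lambda>n. norm (x - y n)) \<longlonglongrightarrow> d"
  proof (rule tendsto_sandwich[of "\<lambda>_. d" _ _ "\<lambda>n. d + 1 / Suc n"])
    have "(\<lambda>n. d + inverse (real (Suc n))) \<longlonglongrightarrow> d + 0"
      by (intro tendsto_intros LIMSEQ_inverse_real_of_nat)
    then show "(\<lambda>n. d + 1 / real (Suc n)) \<longlonglongrightarrow> d"
      by (simp add: divide_inverse)
  qed (use y d_le in \<open>auto intro!: always_eventually less_imp_le\<close>)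
  \<comment> \<open>Parallelogram law: the midpoint of \<open>y m\<close> and \<open>y n\<close>
    lies in \<open>M\<close>, hence has distance at least \<open>d\<close> from \<open>x\<close>. So
    a minimizing sequence is Cauchy.\<close>
  have par: "(norm (y m - y n))\<^sup>2 \<le> 2 * (norm (x - y m))\<^sup>2 + 2 * (norm (x - y n))\<^sup>2 - 4 * d\<^sup>2" for m n
  proof -
    have mid: "(1/2) *\<^sub>C (y m + y n) \<in> M"
      using Ms(4,6) y by blast
    have half: "(1/2) *\<^sub>C (y m + y n) = (1/2) *\<^sub>R (y m + y n)"
      using scaleR_eq_scaleC[of "1/2" "y m + y n"] by simp
    have "(x - y m) + (x - y n) = 2 *\<^sub>R (x - (1/2) *\<^sub>C (y m + y n))"
      unfolding half by (simp add: algebra_simps scaleR_2)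
    then have "norm ((x - y m) + (x - y n)) = 2 * norm (x - (1/2) *\<^sub>C (y m + y n))"
      by simp
    then have "2 * d \<le> norm ((x - y m) + (x - y n))"
      using d_le[OF mid] by simp
    then have "(2 * d)\<^sup>2 \<le> (norm ((x - y m) + (x - y n)))\<^sup>2"
      using d0 by (intro power_mono) auto
    moreover have "(norm ((x - y m) + (x - y n)))\<^sup>2 + (norm ((x - y n) - (x - y m)))\<^sup>2
        = 2 * (norm (x - y m))\<^sup>2 + 2 * (norm (x - y n))\<^sup>2"
      unfolding power2_norm_eq_inner
      by (simp add: inner_add_left inner_add_right inner_diff_left inner_diff_right inner_commute)
    ultimately show ?thesis
      by (simp add: power_mult_distrib)
  qed
  have "Cauchy y"
  proof (rule metric_CauchyI)
    fix e :: real assume e: "e > 0"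
    have "(\<lambda>n. (norm (x - y n))\<^sup>2) \<longlonglongrightarrow> d\<^sup>2"
      by (intro tendsto_intros lim)
    then have "eventually (\<lambda>n. (norm (x - y n))\<^sup>2 < d\<^sup>2 + e\<^sup>2 / 4) sequentially"
      using e by (intro order_tendstoD(2)) auto
    then obtain n0 where n0: "\<And>n. n \<ge> n0 \<Longrightarrow> (norm (x - y n))\<^sup>2 < d\<^sup>2 + e\<^sup>2 / 4"
      by (auto simp: eventually_sequentially)
    have "dist (y m) (y n) < e" if "m \<ge> n0" "n \<ge> n0" for m n
    proof -
      have "(norm (y m - y n))\<^sup>2 < e\<^sup>2"
        using par[of m n] n0[OF that(1)] n0[OF that(2)] by (simp add: field_simps)
      then show ?thesis
        using e by (simp add: dist_norm power2_less_imp_less)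
    qed
    then show "\<exists>n0. \<forall>m\<ge>n0. \<forall>n\<ge>n0. dist (y m) (y n) < e"
      by blast
  qed
  then obtain l where l: "y \<longlonglongrightarrow> l"
    by (auto simp: Cauchy_convergent_iff convergent_def)
  have "l \<in> M"
    using Ms(2) y(1) l closed_sequentially by blast
  moreover have "norm (x - l) = d"
  proof (rule LIMSEQ_unique[OF _ lim])
    show "(\<lambda>n. norm (x - y n)) \<longlonglongrightarrow> norm (x - l)"
      by (intro tendsto_intros l)
  qed
  ultimately show ?thesis
    using d_le by blast
qed

lemma orth_proj_works:
  fixes x :: "'a::complex_hilbert_space"
  assumes M: "closed_csubspace M"
  shows "orth_proj M x \<in> M \<and> x - orth_proj M x \<in> orth_compl M"
  unfolding orth_proj_def
proof (rule theI')
  note Ms = closed_csubspaceD[OF M]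
  obtain y where y: "y \<in> M" "\<forall>z\<in>M. norm (x - y) \<le> norm (x - z)"
    using closest_point_exists[OF M] by blast
  show "\<exists>!y. y \<in> M \<and> x - y \<in> orth_compl M"
  proof (rule ex1I[of _ y])
    show "y \<in> M \<and> x - y \<in> orth_compl M"
      using y closest_point_orthogonal[OF Ms(1)] by blast
    fix z assume z: "z \<in> M \<and> x - z \<in> orth_compl M"
    have "(x - y) - (x - z) \<in> orth_compl M"
    proof (rule closed_csubspaceD(5)[OF closed_csubspace_orth_compl])
      show "x - y \<in> orth_compl M"
        using y closest_point_orthogonal[OF Ms(1)] by blast
    qed (use z in blast)
    then have "z - y = 0"
      using z y Ms(5) by (intro orth_compl_disjoint[of _ M]) auto
    then show "z = y"
      by simp
  qed
qed

lemma orth_proj_in: "closed_csubspace M \<Longrightarrow> orth_proj M (x :: 'a::complex_hilbert_space) \<in> M"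
  using orth_proj_works by blast

lemma orth_proj_unique:
  fixes x :: "'a::complex_hilbert_space"
  assumes M: "closed_csubspace M" and "y \<in> M" "x - y \<in> orth_compl M"
  shows "orth_proj M x = y"
proof -
  have "(x - y) - (x - orth_proj M x) \<in> orth_compl M"
    by (rule closed_csubspaceD(5)[OF closed_csubspace_orth_compl assms(3)])
       (use orth_proj_works[OF M] in blast)
  then have "orth_proj M x - y = 0"
    using assms orth_proj_works[OF M, of x] closed_csubspaceD(5)[OF M]
    by (intro orth_compl_disjoint[of _ M]) auto
  then show ?thesis
    by simp
qed

lemma orth_proj_id: "closed_csubspace M \<Longrightarrow> x \<in> M \<Longrightarrow> orth_proj M (x :: 'a::complex_hilbert_space) = x"
  by (rule orth_proj_unique) (auto simp: closed_csubspaceD(3) closed_csubspace_orth_compl)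

lemma cinner_orth_proj_left:
  fixes x :: "'a::complex_hilbert_space"
  assumes "closed_csubspace M" "y \<in> M"
  shows "cinner (orth_proj M x) y = cinner x y"
  using orth_proj_works[OF assms(1), of x] assms(2)
  by (simp add: orth_compl_def cinner.diff_left)

lemma cinner_orth_proj_right:
  fixes x :: "'a::complex_hilbert_space"
  assumes "closed_csubspace M" "y \<in> M"
  shows "cinner y (orth_proj M x) = cinner y x"
  using cinner_orth_proj_left[OF assms] by (metis cinner_commute)

lemma orth_proj_self_adjoint:
  fixes x :: "'a::complex_hilbert_space"
  assumes "closed_csubspace M"
  shows "cinner (orth_proj M x) y = cinner x (orth_proj M y)"
  by (metis assms cinner_orth_proj_left cinner_orth_proj_right orth_proj_in)

lemma orth_proj_add:
  fixes x :: "'a::complex_hilbert_space"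
  assumes "closed_csubspace M"
  shows "orth_proj M (x + y) = orth_proj M x + orth_proj M y"
proof (rule orth_proj_unique[OF assms])
  have "(x - orth_proj M x) + (y - orth_proj M y) \<in> orth_compl M"
    using orth_proj_works[OF assms] by (intro closed_csubspaceD(4)[OF closed_csubspace_orth_compl]) auto
  then show "x + y - (orth_proj M x + orth_proj M y) \<in> orth_compl M"
    by (simp add: algebra_simps)
qed (simp add: assms closed_csubspaceD(4) orth_proj_in)

lemma orth_proj_scaleC:
  fixes x :: "'a::complex_hilbert_space"
  assumes "closed_csubspace M"
  shows "orth_proj M (c *\<^sub>C x) = c *\<^sub>C orth_proj M x"
proof (rule orth_proj_unique[OF assms])
  have "c *\<^sub>C (x - orth_proj M x) \<in> orth_compl M"
    using orth_proj_works[OF assms] by (intro closed_csubspaceD(6)[OF closed_csubspace_orth_compl]) auto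
  then show "c *\<^sub>C x - c *\<^sub>C orth_proj M x \<in> orth_compl M"
    by (simp add: scaleC.diff_right)
qed (simp add: assms closed_csubspaceD(6) orth_proj_in)

lemma orth_proj_pythagoras:
  fixes x :: "'a::complex_hilbert_space"
  assumes "closed_csubspace M"
  shows "(norm (orth_proj M x))\<^sup>2 + (norm (x - orth_proj M x))\<^sup>2 = (norm x)\<^sup>2"
proof -
  have "cinner (x - orth_proj M x) (orth_proj M x) = 0"
    using orth_proj_works[OF assms, of x] by (auto simp: orth_compl_def)
  then have "inner (x - orth_proj M x) (orth_proj M x) = 0"
    by (simp add: inner_eq_Re_cinner)
  then show ?thesis
    unfolding power2_norm_eq_inner by (simp add: inner_diff_left inner_diff_right inner_commute)
qed

lemma norm_orth_proj_le:
  fixes x :: "'a::complex_hilbert_space"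
  assumes "closed_csubspace M"
  shows "norm (orth_proj M x) \<le> norm x"
proof (rule power2_le_imp_le)
  show "(norm (orth_proj M x))\<^sup>2 \<le> (norm x)\<^sup>2"
    unfolding orth_proj_pythagoras[OF assms, of x, symmetric] by simp
qed simp

lemma orth_compl_orth_compl:
  fixes S :: "'a::complex_hilbert_space set"
  assumes "cvs.subspace S"
  shows "orth_compl (orth_compl S) = closure S"
proof
  have cl: "closed_csubspace (closure S)"
    by (rule closed_csubspace_closure[OF assms])
  show "closure S \<subseteq> orth_compl (orth_compl S)"
    unfolding orth_compl_closure[of S, symmetric]
    by (auto simp: orth_compl_def) (metis cinner_eq_0_commute)
  show "orth_compl (orth_compl S) \<subseteq> closure S"
  proof
    fix x assume x: "x \<in> orth_compl (orth_compl S)"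
    define y where "y = orth_proj (closure S) x"
    have y: "y \<in> closure S" "x - y \<in> orth_compl S"
      using orth_proj_works[OF cl, of x] by (auto simp: y_def orth_compl_closure)
    have "y \<in> orth_compl (orth_compl S)"
      using y(1) \<open>closure S \<subseteq> orth_compl (orth_compl S)\<close> by blast
    with x have "x - y \<in> orth_compl (orth_compl S)"
      by (intro closed_csubspaceD(5)[OF closed_csubspace_orth_compl])
    with y(2) have "x - y = 0"
      by (rule orth_compl_disjoint)
    with y(1) show "x \<in> closure S"
      by simp
  qed
qed

lemma riesz_representation:
  fixes f :: "'a::complex_hilbert_space \<Rightarrow> complex"
  assumes H: "closed_csubspace H"
    and add: "\<And>x y. x \<in> H \<Longrightarrow> y \<in> H \<Longrightarrow> f (x + y) = f x + f y"
    and scale: "\<And>c x. x \<in> H \<Longrightarrow> f (c *\<^sub>C x) = c * f x"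
    and bound: "\<And>x. x \<in> H \<Longrightarrow> cmod (f x) \<le> C * norm x"
  shows "\<exists>y\<in>H. \<forall>x\<in>H. f x = cinner x y"
proof (cases "\<forall>x\<in>H. f x = 0")
  case True
  then show ?thesis
    using closed_csubspaceD(3)[OF H] by (intro bexI[of _ 0]) (auto simp: cinner.zero_right)
next
  case False
  then obtain x where x: "x \<in> H" "f x \<noteq> 0"
    by blast
  note Hs = closed_csubspaceD[OF H]
  have diff: "f (x - y) = f x - f y" if "x \<in> H" "y \<in> H" for x y
    unfolding minus_eq_scaleC[of x y]
    using add[OF that(1) Hs(6)[OF that(2), of "-1"]] scale[OF that(2), of "-1"]
    by simp
  define N where "N = {x\<in>H. f x = 0}"
  have N: "closed_csubspace N"
    unfolding closed_csubspace_def
  proof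
    show "cvs.subspace N"
      using Hs add scale scale[of 0 0] by (auto simp: cvs.subspace_def N_def)
    show "closed N"
      unfolding closed_sequential_limits
    proof (intro allI impI, elim conjE)
      fix a l assume a: "\<forall>n. a n \<in> N" "a \<longlonglongrightarrow> l"
      then have l: "l \<in> H"
        using Hs(2) closed_sequentially[of H a l] by (auto simp: N_def)
      have "cmod (f l) \<le> C * norm (l - a n)" for n
      proof -
        have an: "a n \<in> H" "f (a n) = 0"
          using a(1) by (auto simp: N_def)
        then show ?thesis
          using diff[of l "a n"] bound[of "l - a n"] l Hs(5)[of l "a n"] by simp
      qed
      moreover have "(\<lambda>n. C * norm (l - a n)) \<longlonglongrightarrow> C * norm (l - l)"
        by (intro tendsto_intros a)
      ultimately have "cmod (f l) \<le> C * norm (l - l)"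
        by (intro LIMSEQ_le_const) auto
      with l show "l \<in> N"
        by (simp add: N_def)
    qed
  qed
  define u where "u = x - orth_proj N x"
  have pN: "orth_proj N x \<in> N" and uN: "u \<in> orth_compl N"
    using orth_proj_works[OF N] by (auto simp: u_def)
  then have u: "u \<in> H" "f u = f x"
    using x Hs(5) diff by (auto simp: u_def N_def)
  have "u \<noteq> 0"
    using u x scale[of 0 0] Hs(3) by auto
  \<comment> \<open>The kernel \<open>N\<close> has codimension one in \<open>H\<close> with
    orthogonal direction \<open>u\<close>; the scalar is fixed by the requirement that
    \<open>cinner u y = f u\<close>.\<close>
  define y where "y = (cnj (f u) / complex_of_real ((norm u)\<^sup>2)) *\<^sub>C u"
  have "f z = cinner z y" if z: "z \<in> H" for z
  proof -
    have "f u *\<^sub>C z - f z *\<^sub>C u \<in> N"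
      using z u Hs by (simp add: N_def diff scale)
    then have "cinner (f u *\<^sub>C z - f z *\<^sub>C u) u = 0"
      using uN by (simp add: orth_compl_def) (metis cinner_eq_0_commute)
    then have "f u * cinner z u = f z * complex_of_real ((norm u)\<^sup>2)"
      by (simp add: cinner.diff_left cinner_scaleC_left cinner_self)
    then show ?thesis
      using \<open>u \<noteq> 0\<close> by (simp add: y_def cinner_scaleC_right field_simps)
  qed
  moreover have "y \<in> H"
    using u Hs(6) by (simp add: y_def)
  ultimately show ?thesis
    by blast
qed

section \<open>Bounded operators and adjoints\<close>

lemma bounded_opsD:
  assumes "A \<in> bounded_ops H K"
  shows "\<And>x. x \<in> H \<Longrightarrow> A x \<in> K" "A \<in> extensional H"
    "\<And>x y. x \<in> H \<Longrightarrow> y \<in> H \<Longrightarrow> A (x + y) = A x + A y"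
    "\<And>c x. x \<in> H \<Longrightarrow> A (c *\<^sub>C x) = c *\<^sub>C A x"
  using assms by (auto simp: bounded_ops_def PiE_def)

lemma bounded_ops_bound:
  assumes "A \<in> bounded_ops H K"
  obtains C where "C \<ge> 0" "\<And>x. x \<in> H \<Longrightarrow> norm (A x) \<le> C * norm x"
proof -
  obtain C where C: "\<And>x. x \<in> H \<Longrightarrow> norm (A x) \<le> C * norm x"
    using assms unfolding bounded_ops_def by blast
  have "norm (A x) \<le> max C 0 * norm x" if "x \<in> H" for x
    using C[OF that] mult_right_mono[of C "max C 0" "norm x"] by simp
  then show ?thesis
    using that[of "max C 0"] by simp
qed

lemma bounded_ops_diff:
  assumes "A \<in> bounded_ops H K" "cvs.subspace H" "x \<in> H" "y \<in> H"
  shows "A (x - y) = A x - A y"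
proof -
  have "A (x - y) = A x + A ((-1) *\<^sub>C y)"
    unfolding minus_eq_scaleC[of x]
    using assms by (intro bounded_opsD(3)[OF assms(1)]) (auto intro: cvs.subspace_neg)
  also have "A ((-1) *\<^sub>C y) = (-1) *\<^sub>C A y"
    by (rule bounded_opsD(4)[OF assms(1,4)])
  finally show ?thesis
    unfolding minus_eq_scaleC[of "A x"] .
qed

lemma bounded_ops_zero:
  assumes "A \<in> bounded_ops H K" "0 \<in> H"
  shows "A 0 = 0"
  using bounded_opsD(4)[OF assms, of 0] by simp

lemma bounded_ops_UNIV_iff:
  "A \<in> bounded_ops UNIV UNIV \<longleftrightarrow>
     (\<forall>x y. A (x + y) = A x + A y) \<and> (\<forall>c x. A (c *\<^sub>C x) = c *\<^sub>C A x) \<and>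
     (\<exists>C. \<forall>x. norm (A x) \<le> C * norm x)"
  by (simp add: bounded_ops_def)

lemma bounded_linear_bounded_ops:
  assumes "A \<in> bounded_ops UNIV UNIV"
  shows "bounded_linear A"
proof -
  obtain C where C: "\<And>x. norm (A x) \<le> C * norm x"
    using bounded_ops_bound[OF assms] by auto
  show ?thesis
    using C assms by (intro bounded_linear_intro[of _ C])
      (simp_all add: bounded_ops_UNIV_iff scaleR_eq_scaleC mult.commute)
qed

abbreviation adjoint :: "('a::complex_inner_space \<Rightarrow> 'b::complex_inner_space) \<Rightarrow> 'b \<Rightarrow> 'a" where
  "adjoint \<equiv> hadj UNIV UNIV"

lemma adjoint_exists:
  fixes A :: "'a::complex_hilbert_space \<Rightarrow> 'b::complex_inner_space"
  assumes H: "closed_csubspace H" and A: "A \<in> bounded_ops H K" and K: "cvs.subspace K"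
  shows "\<exists>B \<in> bounded_ops K H. \<forall>x\<in>H. \<forall>y\<in>K. cinner (A x) y = cinner x (B y)"
proof -
  note Hs = closed_csubspaceD[OF H]
  obtain C where C: "C \<ge> 0" "\<And>x. x \<in> H \<Longrightarrow> norm (A x) \<le> C * norm x"
    using bounded_ops_bound[OF A] by blast
  have "\<exists>z\<in>H. \<forall>x\<in>H. cinner (A x) y = cinner x z" for y
  proof (rule riesz_representation[OF H, where C = "C * norm y"])
    fix x assume x: "x \<in> H"
    have "cmod (cinner (A x) y) \<le> norm (A x) * norm y"
      by (rule norm_cinner_le)
    also have "\<dots> \<le> C * norm x * norm y"
      using C(2)[OF x] by (rule mult_right_mono) simp
    finally show "cmod (cinner (A x) y) \<le> C * norm y * norm x"
      by (simp add: mult_ac)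
  qed (simp_all add: bounded_opsD(3,4)[OF A] cinner.add_left cinner_scaleC_left)
  then obtain B where B: "\<And>y. B y \<in> H" "\<And>x y. x \<in> H \<Longrightarrow> cinner (A x) y = cinner x (B y)"
    by metis
  \<comment> \<open>The Riesz vector exists for every \<open>y\<close> of the ambient type; the
    restriction to \<open>K\<close> provides the extensionality that \<open>bounded_ops\<close>
    demands.\<close>
  have "restrict B K \<in> bounded_ops K H"
    unfolding bounded_ops_def mem_Collect_eq
  proof (intro conjI ballI allI exI[of _ C])
    fix x y assume xy: "x \<in> K" "y \<in> K"
    have "B (x + y) = B x + B y"
    proof (rule cinner_ext[OF Hs(1)])
      fix z assume "z \<in> H"
      then have "cinner z (B (x + y)) = cinner z (B x + B y)"
        using B(2)[of z, symmetric] by (simp add: cinner.add_right)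
      then show "cinner (B (x + y)) z = cinner (B x + B y) z"
        by (metis cinner_commute)
    qed (simp_all add: B(1) Hs(4))
    then show "restrict B K (x + y) = restrict B K x + restrict B K y"
      using xy K by (simp add: cvs.subspace_add)
  next
    fix c x assume x: "x \<in> K"
    have "B (c *\<^sub>C x) = c *\<^sub>C B x"
    proof (rule cinner_ext[OF Hs(1)])
      fix z assume "z \<in> H"
      then have "cinner z (B (c *\<^sub>C x)) = cinner z (c *\<^sub>C B x)"
        using B(2)[of z, symmetric] by (simp add: cinner_scaleC_right)
      then show "cinner (B (c *\<^sub>C x)) z = cinner (c *\<^sub>C B x) z"
        by (metis cinner_commute)
    qed (simp_all add: B(1) Hs(6))
    then show "restrict B K (c *\<^sub>C x) = c *\<^sub>C restrict B K x"
      using x K by (simp add: cvs.subspace_scale)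
  next
    fix y assume y: "y \<in> K"
    have "complex_of_real ((norm (B y))\<^sup>2) = cinner (A (B y)) y"
      using B by (simp add: cinner_self)
    then have "(norm (B y))\<^sup>2 = cmod (cinner (A (B y)) y)"
      by (metis abs_norm_cancel norm_of_real norm_power power2_abs real_norm_def)
    also have "\<dots> \<le> norm (A (B y)) * norm y"
      by (rule norm_cinner_le)
    also have "\<dots> \<le> C * norm (B y) * norm y"
      using C(2)[OF B(1)] by (rule mult_right_mono) simp
    finally have "norm (B y) * norm (B y) \<le> norm (B y) * (C * norm y)"
      by (simp add: power2_eq_square mult_ac)
    then have "norm (B y) \<le> C * norm y"
      using C(1) by (cases "norm (B y) = 0") (auto simp: mult_le_cancel_left)
    then show "norm (restrict B K y) \<le> C * norm y"
      using y by simp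
  qed (use B(1) in auto)
  moreover have "\<forall>x\<in>H. \<forall>y\<in>K. cinner (A x) y = cinner x (restrict B K y)"
    using B(2) by simp
  ultimately show ?thesis
    by blast
qed

lemma hadj_works:
  fixes A :: "'a::complex_hilbert_space \<Rightarrow> 'b::complex_inner_space"
  assumes H: "closed_csubspace H" and A: "A \<in> bounded_ops H K" and K: "cvs.subspace K"
  shows "hadj H K A \<in> bounded_ops K H \<and> (\<forall>x\<in>H. \<forall>y\<in>K. cinner (A x) y = cinner x (hadj H K A y))"
proof -
  obtain B where B: "B \<in> bounded_ops K H" "\<forall>x\<in>H. \<forall>y\<in>K. cinner (A x) y = cinner x (B y)"
    using adjoint_exists[OF assms] by blast
  have "B' = B" if B': "B' \<in> bounded_ops K H" "\<forall>x\<in>H. \<forall>y\<in>K. cinner (A x) y = cinner x (B' y)" for B'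
  proof (rule extensionalityI[of _ K])
    fix y assume y: "y \<in> K"
    show "B' y = B y"
    proof (rule cinner_ext[OF closed_csubspaceD(1)[OF H]])
      fix z assume "z \<in> H"
      then have "cinner z (B' y) = cinner z (B y)"
        using y B(2) B'(2) by metis
      then show "cinner (B' y) z = cinner (B y) z"
        by (metis cinner_commute)
    qed (use y B B' bounded_opsD(1) in blast)+
  qed (use B B' bounded_opsD(2) in blast)+
  then have "hadj H K A = B"
    unfolding hadj_def using B by (intro the_equality) blast+
  with B show ?thesis
    by simp
qed

lemmas hadj_bounded_ops = hadj_works[THEN conjunct1]

lemma cinner_hadj:
  fixes A :: "'a::complex_hilbert_space \<Rightarrow> 'b::complex_inner_space"
  assumes "closed_csubspace H" "A \<in> bounded_ops H K" "cvs.subspace K" "x \<in> H" "y \<in> K"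
  shows "cinner (A x) y = cinner x (hadj H K A y)"
  using hadj_works[OF assms(1-3)] assms(4,5) by blast

section \<open>Multi-indices\<close>

abbreviation mdeg :: "('d::finite \<Rightarrow> nat) \<Rightarrow> nat" where
  "mdeg \<alpha> \<equiv> \<Sum>k\<in>UNIV. \<alpha> k"

abbreviation bump :: "('d::finite \<Rightarrow> nat) \<Rightarrow> 'd \<Rightarrow> 'd \<Rightarrow> nat" where
  "bump \<alpha> k \<equiv> \<alpha>(k := Suc (\<alpha> k))"

text \<open>Raising one coordinate at a time matches the recursions for monomials and for
  \<open>mpow\<close>, and so takes the place of an induction on the degree.\<close>

lemma multiindex_induct:
  fixes \<alpha> :: "'d::finite \<Rightarrow> nat"
  assumes zero: "P (\<lambda>_. 0)" and bump: "\<And>\<beta> k. P \<beta> \<Longrightarrow> P (bump \<beta> k)"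
  shows "P \<alpha>"
proof (induction "mdeg \<alpha>" arbitrary: \<alpha>)
  case 0
  then have "\<alpha> = (\<lambda>_. 0)"
    by auto
  with zero show ?case
    by simp
next
  case (Suc n)
  then obtain k where k: "\<alpha> k > 0"
    by (metis gr0I nat.distinct(1) sum.neutral)
  define \<beta> where "\<beta> = \<alpha>(k := \<alpha> k - 1)"
  have \<alpha>: "\<alpha> = bump \<beta> k"
    using k by (auto simp: \<beta>_def)
  have "mdeg \<beta> = n"
    using Suc(2) sum_fun_upd_Suc[of \<beta> k] unfolding \<alpha>[symmetric] by simp
  with Suc(1)[of \<beta>] bump show ?case
    unfolding \<alpha> by blast
qed

lemma inj_bump: "inj (\<lambda>\<beta> :: 'd::finite \<Rightarrow> nat. bump \<beta> k)"
proof (rule injI)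
  fix \<beta> \<gamma> :: "'d \<Rightarrow> nat"
  assume eq: "bump \<beta> k = bump \<gamma> k"
  show "\<beta> = \<gamma>"
  proof
    fix i
    show "\<beta> i = \<gamma> i"
      using fun_cong[OF eq, of i] by (auto split: if_splits)
  qed
qed

lemma range_bump: "range (\<lambda>\<beta> :: 'd::finite \<Rightarrow> nat. bump \<beta> k) = {\<gamma>. \<gamma> k \<noteq> 0}"
proof -
  have "\<gamma> = bump (\<gamma>(k := \<gamma> k - 1)) k" if "\<gamma> k \<noteq> 0" for \<gamma> :: "'d \<Rightarrow> nat"
    using that by auto
  then have "\<gamma> \<in> range (\<lambda>\<beta>. bump \<beta> k)" if "\<gamma> k \<noteq> 0" for \<gamma> :: "'d \<Rightarrow> nat"
    using that by blast
  moreover have "(bump \<beta> k) k \<noteq> 0" for \<beta> :: "'d \<Rightarrow> nat"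
    by simp
  ultimately show ?thesis
    by blast
qed

lemma bump_commute: "bump (bump \<beta> j) k = bump (bump \<beta> k) j"
  by auto

lemma da_weight_zero: "da_weight (\<lambda>_. 0) = 1"
  by (simp add: da_weight_def)

lemma da_weight_bump:
  fixes \<beta> :: "'d::finite \<Rightarrow> nat"
  shows "da_weight (bump \<beta> k) = real (Suc (\<beta> k)) / real (Suc (mdeg \<beta>)) * da_weight \<beta>"
proof -
  have "(\<Prod>i\<in>UNIV. fact ((bump \<beta> k) i)) = real (Suc (\<beta> k)) * (\<Prod>i\<in>UNIV. fact (\<beta> i))"
    by (subst prod_fun_upd[of "\<lambda>i m. fact m"]) (simp add: prod.remove[of UNIV k])
  then show ?thesis
    unfolding da_weight_def sum_fun_upd_Suc by simp
qed

lemma da_weight_bump_le: "da_weight (bump \<beta> k) \<le> da_weight (\<beta> :: 'd::finite \<Rightarrow> nat)"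
proof -
  have "\<beta> k \<le> mdeg \<beta>"
    by (rule member_le_sum) auto
  then have "real (Suc (\<beta> k)) / real (Suc (mdeg \<beta>)) \<le> 1"
    by (simp del: of_nat_sum)
  then show ?thesis
    unfolding da_weight_bump
    using da_weight_pos[of \<beta>] mult_right_mono[of _ 1 "da_weight \<beta>"] by (metis less_imp_le mult_1)
qed

text \<open>\<open>1 / da_weight \<gamma>\<close> is the multinomial coefficient, the number of
  words with letter content \<open>\<gamma>\<close>. The rule sorts the words of length
  \<open>Suc n\<close> by one letter.\<close>

lemma multinomial_pascal:
  fixes F :: "('d::finite \<Rightarrow> nat) \<Rightarrow> real"
  shows "(\<Sum>\<gamma> | mdeg \<gamma> = Suc n. F \<gamma> / da_weight \<gamma>) =
    (\<Sum>\<beta> | mdeg \<beta> = n. (\<Sum>k\<in>UNIV. F (bump \<beta> k)) / da_weight \<beta>)"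
proof -
  define D where "D m = {\<alpha> :: 'd \<Rightarrow> nat. mdeg \<alpha> = m}" for m
  have fin: "finite (D m)" for m
    unfolding D_def by (rule finite_degree_eq)
  \<comment> \<open>\<open>\<gamma> k / Suc n\<close> is the share of the words of content
    \<open>\<gamma>\<close> that begin with the letter \<open>k\<close>. The shares add up to one,
    and each cancels against the weight ratio in \<open>da_weight_bump\<close>.\<close>
  have "(\<Sum>\<gamma>\<in>D (Suc n). F \<gamma> / da_weight \<gamma>)
      = (\<Sum>\<gamma>\<in>D (Suc n). \<Sum>k\<in>UNIV. real (\<gamma> k) / real (Suc n) * (F \<gamma> / da_weight \<gamma>))"
  proof (rule sum.cong)
    fix \<gamma> assume "\<gamma> \<in> D (Suc n)"
    then have "(\<Sum>k\<in>UNIV. real (\<gamma> k)) = real (Suc n)"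
      by (simp add: D_def flip: of_nat_sum del: of_nat_Suc)
    then show "F \<gamma> / da_weight \<gamma> = (\<Sum>k\<in>UNIV. real (\<gamma> k) / real (Suc n) * (F \<gamma> / da_weight \<gamma>))"
      by (simp only: sum_distrib_right[symmetric] sum_divide_distrib[symmetric])
         (simp del: of_nat_Suc)
  qed simp
  also have "\<dots> = (\<Sum>k\<in>UNIV. \<Sum>\<gamma>\<in>D (Suc n). real (\<gamma> k) / real (Suc n) * (F \<gamma> / da_weight \<gamma>))"
    by (rule sum.swap)
  also have "\<dots> = (\<Sum>k\<in>UNIV. \<Sum>\<beta>\<in>D n. F (bump \<beta> k) / da_weight \<beta>)"
  proof (rule sum.cong)
    fix k :: 'd
    have im: "(\<lambda>\<beta>. bump \<beta> k) ` D n = {\<gamma>\<in>D (Suc n). \<gamma> k \<noteq> 0}"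
    proof -
      have "\<gamma> \<in> (\<lambda>\<beta>. bump \<beta> k) ` D n" if "\<gamma> \<in> D (Suc n)" "\<gamma> k \<noteq> 0" for \<gamma>
      proof -
        obtain \<beta> where \<gamma>: "\<gamma> = bump \<beta> k"
          using range_bump[of k] \<open>\<gamma> k \<noteq> 0\<close> by blast
        then have "\<beta> \<in> D n"
          using \<open>\<gamma> \<in> D (Suc n)\<close> sum_fun_upd_Suc[of \<beta> k] by (simp add: D_def)
        with \<gamma> show ?thesis
          by blast
      qed
      moreover have "bump \<beta> k \<in> D (Suc n)" if "\<beta> \<in> D n" for \<beta>
        using that sum_fun_upd_Suc[of \<beta> k] by (simp add: D_def)
      ultimately show ?thesis
        by auto
    qed
    have "(\<Sum>\<gamma>\<in>D (Suc n). real (\<gamma> k) / real (Suc n) * (F \<gamma> / da_weight \<gamma>)) =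
          (\<Sum>\<gamma>\<in>(\<lambda>\<beta>. bump \<beta> k) ` D n. real (\<gamma> k) / real (Suc n) * (F \<gamma> / da_weight \<gamma>))"
      unfolding im by (rule sum.mono_neutral_right) (auto simp: fin)
    also have "\<dots> = (\<Sum>\<beta>\<in>D n. real ((bump \<beta> k) k) / real (Suc n) * (F (bump \<beta> k) / da_weight (bump \<beta> k)))"
      by (subst sum.reindex) (auto intro: inj_on_subset[OF inj_bump])
    also have "\<dots> = (\<Sum>\<beta>\<in>D n. F (bump \<beta> k) / da_weight \<beta>)"
    proof (rule sum.cong)
      fix \<beta> assume "\<beta> \<in> D n"
      then have "mdeg \<beta> = n"
        by (simp add: D_def)
      then show "real ((bump \<beta> k) k) / real (Suc n) * (F (bump \<beta> k) / da_weight (bump \<beta> k))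
          = F (bump \<beta> k) / da_weight \<beta>"
        unfolding da_weight_bump using da_weight_pos[of \<beta>] by (simp add: field_simps del: of_nat_Suc)
    qed simp
    finally show "(\<Sum>\<gamma>\<in>D (Suc n). real (\<gamma> k) / real (Suc n) * (F \<gamma> / da_weight \<gamma>))
      = (\<Sum>\<beta>\<in>D n. F (bump \<beta> k) / da_weight \<beta>)" .
  qed simp
  also have "\<dots> = (\<Sum>\<beta>\<in>D n. (\<Sum>k\<in>UNIV. F (bump \<beta> k)) / da_weight \<beta>)"
    by (subst sum.swap) (simp add: sum_divide_distrib)
  finally show ?thesis
    by (simp add: D_def)
qed

lemma finite_degree_less: "finite {\<alpha> :: 'd::finite \<Rightarrow> nat. mdeg \<alpha> < n}"
proof (rule finite_subset)
  show "{\<alpha> :: 'd \<Rightarrow> nat. mdeg \<alpha> < n} \<subseteq> (\<Union>m<n. {\<alpha>. mdeg \<alpha> = m})"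
    by auto
  show "finite (\<Union>m<n. {\<alpha> :: 'd \<Rightarrow> nat. mdeg \<alpha> = m})"
    by (intro finite_UN_I finite_degree_eq) simp
qed

text \<open>The sets of bounded degree are cofinal among the finite sets, so an unordered sum over
  multi-indices is the limit of an ordinary sequence of partial sums.\<close>

lemma filterlim_degree_less:
  "filterlim (\<lambda>n. {\<alpha> :: 'd::finite \<Rightarrow> nat. mdeg \<alpha> < n}) (finite_subsets_at_top UNIV) sequentially"
  unfolding filterlim_finite_subsets_at_top
proof (intro allI impI)
  fix X :: "('d \<Rightarrow> nat) set"
  assume X: "finite X \<and> X \<subseteq> UNIV"
  have "\<forall>n\<ge>Suc (Max (insert 0 (mdeg ` X))). finite {\<alpha> :: 'd \<Rightarrow> nat. mdeg \<alpha> < n} \<and>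
      X \<subseteq> {\<alpha>. mdeg \<alpha> < n} \<and> {\<alpha> :: 'd \<Rightarrow> nat. mdeg \<alpha> < n} \<subseteq> UNIV"
  proof (intro allI impI conjI subsetI)
    fix n \<alpha> assume n: "Suc (Max (insert 0 (mdeg ` X))) \<le> n" and \<alpha>: "\<alpha> \<in> X"
    have "mdeg \<alpha> \<le> Max (insert 0 (mdeg ` X))"
      using X \<alpha> by (intro Max_ge) auto
    with n show "\<alpha> \<in> {\<alpha>. mdeg \<alpha> < n}"
      by simp
  qed (auto simp: finite_degree_less)
  then show "\<forall>\<^sub>F n in sequentially. finite {\<alpha> :: 'd \<Rightarrow> nat. mdeg \<alpha> < n} \<and>
      X \<subseteq> {\<alpha>. mdeg \<alpha> < n} \<and> {\<alpha> :: 'd \<Rightarrow> nat. mdeg \<alpha> < n} \<subseteq> UNIV"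
    unfolding eventually_sequentially by blast
qed

text \<open>Coordinate multipliers shift coefficients; the indices missed by the shift are those
  with \<open>\<gamma> k = 0\<close>, where the terms must vanish.\<close>

lemma has_sum_bump:
  fixes g :: "('d::finite \<Rightarrow> nat) \<Rightarrow> 'b::topological_comm_monoid_add"
  assumes "\<And>\<gamma>. \<gamma> k = 0 \<Longrightarrow> g \<gamma> = 0"
  shows "((\<lambda>\<beta>. g (bump \<beta> k)) has_sum s) UNIV \<longleftrightarrow> (g has_sum s) UNIV"
proof -
  have "(g has_sum s) UNIV \<longleftrightarrow> (g has_sum s) (range (\<lambda>\<beta>. bump \<beta> k))"
    by (rule has_sum_cong_neutral) (use assms in \<open>auto simp: range_bump\<close>)
  also have "\<dots> \<longleftrightarrow> ((\<lambda>\<beta>. g (bump \<beta> k)) has_sum s) UNIV"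
    by (subst has_sum_reindex[OF inj_bump]) (simp add: o_def)
  finally show ?thesis
    by simp
qed

section \<open>Multi-index powers of a commuting tuple of maps\<close>

lemma funpow_commute_funpow:
  assumes "f \<circ> g = g \<circ> f"
  shows "(f ^^ m) \<circ> (g ^^ n) = (g ^^ n) \<circ> (f ^^ m)"
proof -
  have 1: "f \<circ> (g ^^ n) = (g ^^ n) \<circ> f" for n
    by (induction n) (use assms in \<open>auto simp: fun_eq_iff\<close>)
  show ?thesis
    by (induction m) (use 1 in \<open>auto simp: fun_eq_iff\<close>)
qed

text \<open>The index type carries no order, so the product of the powers is a fold over the set
  \<open>UNIV\<close>. It is meaningful when the maps \<open>B k\<close> commute.\<close>

definition mpow :: "('d::finite \<Rightarrow> 'a \<Rightarrow> 'a) \<Rightarrow> ('d \<Rightarrow> nat) \<Rightarrow> 'a \<Rightarrow> 'a" where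
  "mpow B \<alpha> = Finite_Set.fold (\<lambda>k g. (B k ^^ \<alpha> k) \<circ> g) id UNIV"

lemma mpow_zero [simp]: "mpow B (\<lambda>_. 0) = id"
proof -
  have "Finite_Set.fold (\<lambda>(k :: 'd) g. g) id S = (id :: 'a \<Rightarrow> 'a)" if "finite S" for S
  proof -
    interpret comp_fun_commute "\<lambda>(k :: 'd) (g :: 'a \<Rightarrow> 'a). g"
      by standard auto
    show ?thesis
      using that by induction auto
  qed
  from this[OF finite] show ?thesis
    by (simp add: mpow_def)
qed

lemma mpow_bump:
  assumes comm: "\<And>j k x. B j (B k x) = B k (B j x)"
  shows "mpow B (bump \<alpha> k) x = B k (mpow B \<alpha> x)"
proof -
  define F where "F \<alpha> = (\<lambda>k g. (B k ^^ \<alpha> k) \<circ> (g :: 'b \<Rightarrow> 'b))" for \<alpha>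
  have cfc: "comp_fun_commute (F \<alpha>)" for \<alpha>
  proof
    fix i j
    have "(B i ^^ \<alpha> i) \<circ> (B j ^^ \<alpha> j) = (B j ^^ \<alpha> j) \<circ> (B i ^^ \<alpha> i)"
      by (rule funpow_commute_funpow) (simp add: fun_eq_iff comm)
    then show "F \<alpha> j \<circ> F \<alpha> i = F \<alpha> i \<circ> F \<alpha> j"
      by (auto simp: F_def fun_eq_iff)
  qed
  \<comment> \<open>Commutation allows the factor with index \<open>k\<close> to be taken outermost;
    the remaining fold does not see the exponent \<open>\<alpha> k\<close>.\<close>
  have split: "mpow B \<alpha> = F \<alpha> k (Finite_Set.fold (F \<alpha>) id (UNIV - {k}))" for \<alpha>
    unfolding mpow_def F_def[symmetric]
    by (rule comp_fun_commute_on.fold_rec[OF cfc[unfolded comp_fun_commute_def']]) auto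
  have same: "Finite_Set.fold (F (bump \<alpha> k)) id S = Finite_Set.fold (F \<alpha>) id S"
    if "finite S" "k \<notin> S" for S
    using that
  proof induction
    case (insert x S)
    have "Finite_Set.fold (F \<beta>) id (insert x S) = F \<beta> x (Finite_Set.fold (F \<beta>) id S)" for \<beta>
      by (rule comp_fun_commute_on.fold_insert[OF cfc[unfolded comp_fun_commute_def']])
         (use insert in auto)
    moreover have "F (bump \<alpha> k) x = F \<alpha> x"
      using insert by (auto simp: F_def)
    moreover have "Finite_Set.fold (F (bump \<alpha> k)) id S = Finite_Set.fold (F \<alpha>) id S"
      by (rule insert.IH) (use insert in auto)
    ultimately show ?case
      by (simp only:)
  qed simp
  have "mpow B (bump \<alpha> k) = F (bump \<alpha> k) k (Finite_Set.fold (F \<alpha>) id (UNIV - {k}))"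
    unfolding split[of "bump \<alpha> k"] by (subst same) auto
  also have "\<dots> = B k \<circ> mpow B \<alpha>"
    unfolding split[of \<alpha>] by (simp add: F_def comp_assoc)
  finally show ?thesis
    by simp
qed

lemma mpow_bump':
  assumes comm: "\<And>j k x. B j (B k x) = B k (B j x)"
  shows "mpow B (bump \<alpha> k) x = mpow B \<alpha> (B k x)"
proof (induction \<alpha> arbitrary: x rule: multiindex_induct)
  case 1
  show ?case
    using mpow_bump[of B "\<lambda>_. 0" k x, OF comm] by (simp only: mpow_zero id_apply)
next
  case (2 \<beta> j)
  have "mpow B (bump (bump \<beta> j) k) x = B j (mpow B (bump \<beta> k) x)"
    unfolding bump_commute[of \<beta> j k] by (rule mpow_bump[of B, OF comm])
  also have "\<dots> = B j (mpow B \<beta> (B k x))"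
    by (simp only: 2)
  also have "\<dots> = mpow B (bump \<beta> j) (B k x)"
    by (simp only: mpow_bump[of B, OF comm])
  finally show ?case .
qed

section \<open>Monomials, truncations and reproducing kernels\<close>

lemma has_sum_finite_sum:
  fixes g :: "'i \<Rightarrow> 'j \<Rightarrow> 'b::topological_comm_monoid_add"
  assumes "\<And>i. i \<in> I \<Longrightarrow> (g i has_sum s i) A"
  shows "((\<lambda>x. \<Sum>i\<in>I. g i x) has_sum (\<Sum>i\<in>I. s i)) A"
  using assms by (induction I rule: infinite_finite_induct) (auto intro: has_sum_add)

lemma norm_da_has_sum:
  "((\<lambda>\<alpha>. da_weight \<alpha> * (cmod (da_coeff f \<alpha>))\<^sup>2) has_sum (norm f)\<^sup>2) UNIV"
  unfolding norm_da_sq by (rule has_sum_infsum[OF da_coeff_summable])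

lemma cinner_da_has_sum:
  "((\<lambda>\<alpha>. complex_of_real (da_weight \<alpha>) * da_coeff f \<alpha> * cnj (da_coeff g \<alpha>)) has_sum cinner f g) UNIV"
  unfolding cinner_drury_arveson_def by (rule has_sum_infsum[OF cinner_da_summable])

lemma da_coeff_the: "da_coeff g = c \<Longrightarrow> da_coeff (THE g. da_coeff g = c) = c"
  by (rule theI2[of _ g]) (auto simp flip: da_coeff_inject)

text \<open>The orthogonal projection onto the closed span of the monomials with exponent in
  \<open>I\<close>.\<close>

definition da_restrict :: "('d::finite \<Rightarrow> nat) set \<Rightarrow> 'd drury_arveson \<Rightarrow> 'd drury_arveson" where
  "da_restrict I f = (THE g. da_coeff g = (\<lambda>\<alpha>. if \<alpha> \<in> I then da_coeff f \<alpha> else 0))"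

lemma da_coeff_restrict: "da_coeff (da_restrict I f) = (\<lambda>\<alpha>. if \<alpha> \<in> I then da_coeff f \<alpha> else 0)"
proof -
  have "(\<lambda>\<alpha>. da_weight \<alpha> * (cmod (if \<alpha> \<in> I then da_coeff f \<alpha> else 0))\<^sup>2) summable_on UNIV"
    by (rule summable_on_comparison_test[OF da_coeff_summable[of f]])
       (auto simp: less_imp_le[OF da_weight_pos])
  then obtain g where "da_coeff g = (\<lambda>\<alpha>. if \<alpha> \<in> I then da_coeff f \<alpha> else 0)"
    by (rule da_surj)
  then show ?thesis
    unfolding da_restrict_def by (simp add: da_coeff_the)
qed

definition da_mono :: "('d::finite \<Rightarrow> nat) \<Rightarrow> 'd drury_arveson" where
  "da_mono \<beta> = (THE g. da_coeff g = (\<lambda>\<alpha>. if \<alpha> = \<beta> then 1 else 0))"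

lemma da_coeff_mono: "da_coeff (da_mono \<beta>) = (\<lambda>\<alpha>. if \<alpha> = \<beta> then 1 else 0)"
proof -
  have "(\<lambda>\<alpha>. da_weight \<alpha> * (cmod (if \<alpha> = \<beta> then 1 else 0))\<^sup>2) summable_on UNIV"
    unfolding summable_on_def
    by (rule exI, rule has_sum_finite_neutralI[of "{\<beta>}"]) auto
  then obtain g :: "'a drury_arveson" where "da_coeff g = (\<lambda>\<alpha>. if \<alpha> = \<beta> then 1 else 0)"
    by (rule da_surj)
  then show ?thesis
    unfolding da_mono_def by (simp add: da_coeff_the)
qed

lemma cinner_da_mono: "cinner f (da_mono \<beta>) = complex_of_real (da_weight \<beta>) * da_coeff f \<beta>"
proof (rule has_sum_unique[OF cinner_da_has_sum])
  show "((\<lambda>\<alpha>. complex_of_real (da_weight \<alpha>) * da_coeff f \<alpha> * cnj (da_coeff (da_mono \<beta>) \<alpha>))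
      has_sum complex_of_real (da_weight \<beta>) * da_coeff f \<beta>) UNIV"
    by (rule has_sum_finite_neutralI[of "{\<beta>}"]) (auto simp: da_coeff_mono)
qed

lemma da_coeff_sum: "da_coeff (\<Sum>i\<in>I. f i) \<alpha> = (\<Sum>i\<in>I. da_coeff (f i) \<alpha>)"
  by (induction I rule: infinite_finite_induct) (auto simp: da_coeff_simps)

lemma da_restrict_eq_sum:
  assumes "finite I"
  shows "da_restrict I f = (\<Sum>\<beta>\<in>I. da_coeff f \<beta> *\<^sub>C da_mono \<beta>)"
  unfolding da_coeff_inject[symmetric]
proof
  fix \<alpha>
  have "da_coeff f \<beta> * da_coeff (da_mono \<beta>) \<alpha> = (if \<alpha> = \<beta> then da_coeff f \<beta> else 0)" for \<beta>
    by (simp add: da_coeff_mono)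
  then show "da_coeff (da_restrict I f) \<alpha> = da_coeff (\<Sum>\<beta>\<in>I. da_coeff f \<beta> *\<^sub>C da_mono \<beta>) \<alpha>"
    by (simp add: da_coeff_restrict da_coeff_sum da_coeff_scaleC sum.delta[OF assms] sum.delta'[OF assms])
qed

lemma norm_da_restrict_sq:
  assumes "finite I"
  shows "(norm (da_restrict I f))\<^sup>2 = (\<Sum>\<alpha>\<in>I. da_weight \<alpha> * (cmod (da_coeff f \<alpha>))\<^sup>2)"
proof (rule has_sum_unique[OF norm_da_has_sum])
  show "((\<lambda>\<alpha>. da_weight \<alpha> * (cmod (da_coeff (da_restrict I f) \<alpha>))\<^sup>2) has_sum
      (\<Sum>\<alpha>\<in>I. da_weight \<alpha> * (cmod (da_coeff f \<alpha>))\<^sup>2)) UNIV"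
    by (rule has_sum_finite_neutralI[OF assms]) (auto simp: da_coeff_restrict)
qed

abbreviation da_trunc :: "nat \<Rightarrow> 'd::finite drury_arveson \<Rightarrow> 'd drury_arveson" where
  "da_trunc n \<equiv> da_restrict {\<alpha>. mdeg \<alpha> < n}"

text \<open>Monomials are orthogonal, so the squared error is a tail of the norm series.\<close>

lemma da_trunc_tendsto: "(\<lambda>n. da_trunc n f) \<longlonglongrightarrow> (f :: 'd::finite drury_arveson)"
proof -
  define g where "g \<alpha> = da_weight \<alpha> * (cmod (da_coeff f \<alpha>))\<^sup>2" for \<alpha>
  have eq: "(norm (f - da_trunc n f))\<^sup>2 = (norm f)\<^sup>2 - sum g {\<alpha>. mdeg \<alpha> < n}" for n
  proof (rule has_sum_unique[OF norm_da_has_sum])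
    have "((\<lambda>\<alpha>. if mdeg \<alpha> < n then g \<alpha> else 0) has_sum sum g {\<alpha>. mdeg \<alpha> < n}) UNIV"
      by (rule has_sum_finite_neutralI[OF finite_degree_less]) auto
    from has_sum_add[OF norm_da_has_sum has_sum_uminusI[OF this]]
    have "((\<lambda>\<alpha>. g \<alpha> - (if mdeg \<alpha> < n then g \<alpha> else 0)) has_sum (norm f)\<^sup>2 - sum g {\<alpha>. mdeg \<alpha> < n}) UNIV"
      by (simp add: g_def)
    moreover have "g \<alpha> - (if mdeg \<alpha> < n then g \<alpha> else 0)
        = da_weight \<alpha> * (cmod (da_coeff (f - da_trunc n f) \<alpha>))\<^sup>2" for \<alpha>
      by (simp add: g_def da_coeff_simps da_coeff_restrict)
    ultimately show "((\<lambda>\<alpha>. da_weight \<alpha> * (cmod (da_coeff (f - da_trunc n f) \<alpha>))\<^sup>2) has_sum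
        (norm f)\<^sup>2 - sum g {\<alpha>. mdeg \<alpha> < n}) UNIV"
      by simp
  qed
  have "(\<lambda>n. sum g {\<alpha>. mdeg \<alpha> < n}) \<longlonglongrightarrow> (norm f)\<^sup>2"
    using norm_da_has_sum[of f] unfolding has_sum_def g_def[symmetric]
    by (rule filterlim_compose[OF _ filterlim_degree_less])
  then have "(\<lambda>n. (norm f)\<^sup>2 - sum g {\<alpha>. mdeg \<alpha> < n}) \<longlonglongrightarrow> (norm f)\<^sup>2 - (norm f)\<^sup>2"
    by (intro tendsto_intros)
  then have "(\<lambda>n. sqrt ((norm (f - da_trunc n f))\<^sup>2)) \<longlonglongrightarrow> sqrt 0"
    unfolding eq by (intro tendsto_real_sqrt) simp
  then have "(\<lambda>n. norm (da_trunc n f - f)) \<longlonglongrightarrow> 0"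
    by (simp add: norm_minus_commute)
  then show ?thesis
    by (simp add: tendsto_norm_zero_iff LIM_zero_iff)
qed

text \<open>The reproducing kernel at \<open>z\<close>: its coefficients are forced by the weights,
  and \<open>da_kernel_summable\<close> says that its norm is finite. Point evaluations are thereby
  continuous.\<close>

lemma da_kernel_exists:
  assumes z: "z \<in> ball 0 1"
  obtains e :: "'d::finite drury_arveson" where "\<And>f. da_fun f z = cinner f e"
proof -
  have "(\<lambda>\<alpha>. da_weight \<alpha> * (cmod (cnj (zpow z \<alpha>) / complex_of_real (da_weight \<alpha>)))\<^sup>2) summable_on UNIV"
  proof -
    have "da_weight \<alpha> * (cmod (cnj (zpow z \<alpha>) / complex_of_real (da_weight \<alpha>)))\<^sup>2
        = (cmod (zpow z \<alpha>))\<^sup>2 / da_weight \<alpha>" for \<alpha>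
      using da_weight_pos[of \<alpha>] by (simp add: norm_divide power2_eq_square)
    then show ?thesis
      using da_kernel_summable[OF z] by simp
  qed
  then obtain e :: "'d drury_arveson" where e: "da_coeff e = (\<lambda>\<alpha>. cnj (zpow z \<alpha>) / complex_of_real (da_weight \<alpha>))"
    by (rule da_surj)
  have "da_fun f z = cinner f e" for f :: "'d drury_arveson"
  proof (rule has_sum_unique)
    show "((\<lambda>\<alpha>. da_coeff f \<alpha> * zpow z \<alpha>) has_sum da_fun f z) UNIV"
      using da_expansion_coeff[of f] z by (simp add: da_expansion_def)
    have "complex_of_real (da_weight \<alpha>) * da_coeff f \<alpha> * cnj (da_coeff e \<alpha>) = da_coeff f \<alpha> * zpow z \<alpha>" for \<alpha>
      using da_weight_pos[of \<alpha>] by (simp add: e less_imp_neq[symmetric])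
    then show "((\<lambda>\<alpha>. da_coeff f \<alpha> * zpow z \<alpha>) has_sum cinner f e) UNIV"
      using cinner_da_has_sum[of f e] by (simp only:)
  qed
  then show ?thesis
    using that by blast
qed

lemma da_fun_outside: "z \<notin> ball 0 1 \<Longrightarrow> da_fun f z = 0"
  using da_expansion_coeff[of f] by (simp add: da_expansion_def)

section \<open>Coordinate multipliers\<close>

lemma zpow_bump: "zpow z (bump \<beta> k) = z $ k * zpow z \<beta>"
  unfolding zpow_def
  by (subst prod_fun_upd[of "\<lambda>i m. (z $ i) ^ m"]) (simp add: prod.remove[of UNIV k])

lemma da_expansion_coord_mult:
  fixes c :: "('d::finite \<Rightarrow> nat) \<Rightarrow> complex"
  assumes "da_expansion c f"
  shows "da_expansion (\<lambda>\<gamma>. if \<gamma> k = 0 then 0 else c (\<gamma>(k := \<gamma> k - 1))) (\<lambda>z. z $ k * f z)"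
proof -
  define c' where "c' = (\<lambda>\<gamma>. if \<gamma> k = 0 then 0 else c (\<gamma>(k := \<gamma> k - 1)))"
  have c'_bump: "c' (bump \<beta> k) = c \<beta>" for \<beta>
    by (simp add: c'_def)
  have c'_0: "c' \<gamma> = 0" if "\<gamma> k = 0" for \<gamma>
    using that by (simp add: c'_def)
  have "(\<lambda>\<beta>. da_weight (bump \<beta> k) * (cmod (c' (bump \<beta> k)))\<^sup>2) summable_on UNIV"
  proof (rule summable_on_comparison_test)
    show "(\<lambda>\<beta>. da_weight \<beta> * (cmod (c \<beta>))\<^sup>2) summable_on UNIV"
      using assms by (simp add: da_expansion_def)
    fix \<beta> :: "'d \<Rightarrow> nat"
    show "da_weight (bump \<beta> k) * (cmod (c' (bump \<beta> k)))\<^sup>2 \<le> da_weight \<beta> * (cmod (c \<beta>))\<^sup>2"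
      unfolding c'_bump by (rule mult_right_mono[OF da_weight_bump_le]) simp
    show "0 \<le> da_weight (bump \<beta> k) * (cmod (c' (bump \<beta> k)))\<^sup>2"
      using da_weight_pos[of "bump \<beta> k"] by simp
  qed
  then have "(\<lambda>\<gamma>. da_weight \<gamma> * (cmod (c' \<gamma>))\<^sup>2) summable_on UNIV"
    unfolding summable_on_def
    by (subst (asm) has_sum_bump[of k "\<lambda>\<gamma>. da_weight \<gamma> * (cmod (c' \<gamma>))\<^sup>2"]) (auto simp: c'_0)
  moreover have "((\<lambda>\<gamma>. c' \<gamma> * zpow z \<gamma>) has_sum z $ k * f z) UNIV" if z: "z \<in> ball 0 1" for z
  proof -
    have "((\<lambda>\<beta>. z $ k * (c \<beta> * zpow z \<beta>)) has_sum z $ k * f z) UNIV"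
      using assms z by (intro has_sum_cmult_right) (simp add: da_expansion_def)
    then have "((\<lambda>\<beta>. c' (bump \<beta> k) * zpow z (bump \<beta> k)) has_sum z $ k * f z) UNIV"
      by (simp add: c'_bump zpow_bump mult_ac del: fun_upd_apply)
    then show ?thesis
      by (subst (asm) has_sum_bump[of k "\<lambda>\<gamma>. c' \<gamma> * zpow z \<gamma>"]) (auto simp: c'_0)
  qed
  ultimately show ?thesis
    using assms by (simp add: da_expansion_def c'_def)
qed

lemma da_fun_coord_mult: "da_fun (coord_mult k f) = (\<lambda>z. z $ k * da_fun f z)"
  unfolding coord_mult_def mult_op_def
  by (rule da_expansion_Abs[OF da_expansion_coord_mult[OF da_expansion_coeff]])

lemma da_coeff_coord_mult:
  "da_coeff (coord_mult k f) \<gamma> = (if \<gamma> k = 0 then 0 else da_coeff f (\<gamma>(k := \<gamma> k - 1)))"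
  unfolding coord_mult_def mult_op_def
  by (subst da_coeff_Abs[OF da_expansion_coord_mult[OF da_expansion_coeff]]) simp

lemma da_coeff_coord_mult_bump: "da_coeff (coord_mult k f) (bump \<beta> k) = da_coeff f \<beta>"
  by (simp add: da_coeff_coord_mult)

lemma coord_mult_commute: "coord_mult j (coord_mult k f) = coord_mult k (coord_mult j f)"
  unfolding da_fun_inject[symmetric] da_fun_coord_mult by (simp add: fun_eq_iff)

lemma coord_mult_mono: "coord_mult k (da_mono \<beta>) = da_mono (bump \<beta> k)"
  unfolding da_coeff_inject[symmetric] fun_eq_iff
  by (auto simp: da_coeff_coord_mult da_coeff_mono fun_eq_iff)

lemma norm_coord_mult_le: "norm (coord_mult k f) \<le> norm f"
proof (rule power2_le_imp_le)
  have "((\<lambda>\<beta>. da_weight (bump \<beta> k) * (cmod (da_coeff (coord_mult k f) (bump \<beta> k)))\<^sup>2) has_sum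
      (norm (coord_mult k f))\<^sup>2) UNIV"
    by (subst has_sum_bump[of k "\<lambda>\<gamma>. da_weight \<gamma> * (cmod (da_coeff (coord_mult k f) \<gamma>))\<^sup>2"])
       (simp_all only: norm_da_has_sum, simp add: da_coeff_coord_mult)
  then show "(norm (coord_mult k f))\<^sup>2 \<le> (norm f)\<^sup>2"
    by (rule has_sum_mono[OF _ norm_da_has_sum])
       (unfold da_coeff_coord_mult_bump, auto intro: mult_right_mono[OF da_weight_bump_le])
qed simp

lemma coord_mult_bounded_ops: "coord_mult k \<in> bounded_ops UNIV UNIV"
  unfolding bounded_ops_UNIV_iff
proof (intro conjI allI exI[of _ 1])
  show "norm (coord_mult k f) \<le> 1 * norm f" for f
    using norm_coord_mult_le by simp
qed (auto simp: da_coeff_inject[symmetric] fun_eq_iff da_coeff_coord_mult da_coeff_simps)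

definition coord_adj :: "'d::finite \<Rightarrow> 'd drury_arveson \<Rightarrow> 'd drury_arveson" where
  "coord_adj k = adjoint (coord_mult k)"

lemma coord_adj_bounded_ops: "coord_adj k \<in> bounded_ops UNIV UNIV"
  unfolding coord_adj_def
  by (rule hadj_bounded_ops) (auto simp: coord_mult_bounded_ops)

lemma cinner_coord_mult: "cinner (coord_mult k f) g = cinner f (coord_adj k g)"
  unfolding coord_adj_def
  by (rule cinner_hadj) (auto simp: coord_mult_bounded_ops)

lemma cinner_coord_adj: "cinner (coord_adj k f) g = cinner f (coord_mult k g)"
  by (metis cinner_commute cinner_coord_mult)

lemma da_coeff_coord_adj:
  "da_coeff (coord_adj k f) \<beta> = complex_of_real (da_weight (bump \<beta> k) / da_weight \<beta>) * da_coeff f (bump \<beta> k)"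
proof -
  have "complex_of_real (da_weight \<beta>) * da_coeff (coord_adj k f) \<beta> = cinner (coord_adj k f) (da_mono \<beta>)"
    by (simp add: cinner_da_mono)
  also have "\<dots> = complex_of_real (da_weight (bump \<beta> k)) * da_coeff f (bump \<beta> k)"
    unfolding cinner_coord_adj coord_mult_mono by (rule cinner_da_mono)
  finally show ?thesis
    using da_weight_pos[of \<beta>] by (simp add: field_simps)
qed

lemma coord_adj_commute: "coord_adj j (coord_adj k f) = coord_adj k (coord_adj j f)"
proof (rule cinner_ext[of UNIV])
  show "cinner (coord_adj j (coord_adj k f)) g = cinner (coord_adj k (coord_adj j f)) g" for g
    by (simp add: cinner_coord_adj coord_mult_commute)
qed auto

text \<open>The quadratic form of the identity that the sum of M_k M_k^* is the identity minus the
  projection onto the constants. The term of index \<open>\<gamma>\<close> is distributed over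
  \<open>k\<close> with shares \<open>\<gamma> k / mdeg \<gamma>\<close>, whose sum is one unless
  \<open>\<gamma>\<close> is zero.\<close>

lemma sum_norm_coord_adj:
  fixes f :: "'d::finite drury_arveson"
  shows "(\<Sum>k\<in>UNIV. (norm (coord_adj k f))\<^sup>2) = (norm f)\<^sup>2 - (cmod (da_coeff f (\<lambda>_. 0)))\<^sup>2"
proof (rule has_sum_unique)
  define h where "h \<gamma> = da_weight \<gamma> * (cmod (da_coeff f \<gamma>))\<^sup>2" for \<gamma>
  \<comment> \<open>At \<open>\<gamma> = (\<lambda>_. 0)\<close> division by zero gives the value 0,
    as it should: the constant term contributes to none of the \<open>coord_adj k f\<close>.\<close>
  define g where "g k \<gamma> = real (\<gamma> k) / real (mdeg \<gamma>) * h \<gamma>" for k \<gamma>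
  have "(g k has_sum (norm (coord_adj k f))\<^sup>2) UNIV" for k
  proof -
    have "da_weight \<beta> * (cmod (da_coeff (coord_adj k f) \<beta>))\<^sup>2 = g k (bump \<beta> k)" for \<beta>
    proof -
      have "da_weight \<beta> * (cmod (da_coeff (coord_adj k f) \<beta>))\<^sup>2
          = da_weight (bump \<beta> k) / da_weight \<beta> * h (bump \<beta> k)"
        using da_weight_pos[of \<beta>] da_weight_pos[of "bump \<beta> k"]
        unfolding da_coeff_coord_adj h_def norm_mult norm_of_real
        by (simp add: power2_eq_square field_simps)
      also have "da_weight (bump \<beta> k) / da_weight \<beta> = real (Suc (\<beta> k)) / real (Suc (mdeg \<beta>))"
        using da_weight_pos[of \<beta>] by (simp add: da_weight_bump)
      finally show ?thesis
        unfolding g_def sum_fun_upd_Suc by (simp only: fun_upd_same)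
    qed
    then have "((\<lambda>\<beta>. g k (bump \<beta> k)) has_sum (norm (coord_adj k f))\<^sup>2) UNIV"
      using norm_da_has_sum[of "coord_adj k f"] by simp
    then show ?thesis
      by (subst (asm) has_sum_bump) (auto simp: g_def)
  qed
  then show "((\<lambda>\<gamma>. \<Sum>k\<in>UNIV. g k \<gamma>) has_sum (\<Sum>k\<in>UNIV. (norm (coord_adj k f))\<^sup>2)) UNIV"
    by (rule has_sum_finite_sum)
  have "((\<lambda>\<gamma>. if \<gamma> = (\<lambda>_. 0) then h \<gamma> else 0) has_sum h (\<lambda>_. 0)) UNIV"
    by (rule has_sum_finite_neutralI[of "{\<lambda>_. 0}"]) auto
  from has_sum_add[OF norm_da_has_sum[of f] has_sum_uminusI[OF this]]
  have "((\<lambda>\<gamma>. h \<gamma> - (if \<gamma> = (\<lambda>_. 0) then h \<gamma> else 0)) has_sum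
      (norm f)\<^sup>2 - (cmod (da_coeff f (\<lambda>_. 0)))\<^sup>2) UNIV"
    by (simp add: h_def da_weight_zero)
  moreover have "h \<gamma> - (if \<gamma> = (\<lambda>_. 0) then h \<gamma> else 0) = (\<Sum>k\<in>UNIV. g k \<gamma>)" for \<gamma>
  proof (cases "\<gamma> = (\<lambda>_. 0)")
    case False
    then have "mdeg \<gamma> \<noteq> 0"
      by auto
    then have "(\<Sum>k\<in>UNIV. real (\<gamma> k) / real (mdeg \<gamma>)) = 1"
      by (simp only: sum_divide_distrib[symmetric] of_nat_sum[symmetric]) (simp del: of_nat_sum sum_eq_0_iff)
    then have "(\<Sum>k\<in>UNIV. g k \<gamma>) = h \<gamma>"
      by (simp only: g_def sum_distrib_right[symmetric] mult_1)
    with False show ?thesis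
      by simp
  qed (simp add: g_def)
  ultimately show "((\<lambda>\<gamma>. \<Sum>k\<in>UNIV. g k \<gamma>) has_sum (norm f)\<^sup>2 - (cmod (da_coeff f (\<lambda>_. 0)))\<^sup>2) UNIV"
    by simp
qed

section \<open>Multipliers as the commutant of the coordinate multipliers\<close>

lemma multiplier_algebraD:
  assumes "A \<in> multiplier_algebra"
  shows "A \<in> bounded_ops UNIV UNIV" "A (coord_mult k f) = coord_mult k (A f)"
proof -
  obtain \<phi> where A: "A = mult_op \<phi>" "\<And>f. (\<lambda>z. \<phi> z * da_fun f z) \<in> range da_fun"
    and bdd: "mult_op \<phi> \<in> bounded_ops UNIV UNIV"
    using assms unfolding multiplier_algebra_def by blast
  have ev: "da_fun (A f) = (\<lambda>z. \<phi> z * da_fun f z)" for f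
    unfolding A(1) mult_op_def using A(2)[of f] by (auto simp: da_fun_inverse)
  show "A \<in> bounded_ops UNIV UNIV"
    using A bdd by simp
  show "A (coord_mult k f) = coord_mult k (A f)"
    unfolding da_fun_inject[symmetric] da_fun_coord_mult ev by (simp add: fun_eq_iff)
qed

lemma commutant_mono_eval:
  assumes "\<And>k f. A (coord_mult k f) = coord_mult k (A f)"
  shows "da_fun (A (da_mono \<beta>)) z = zpow z \<beta> * da_fun (A (da_mono (\<lambda>_. 0))) z"
proof (induction \<beta> rule: multiindex_induct)
  case 1
  show ?case
    by (simp add: zpow_def)
next
  case (2 \<beta> k)
  then show ?case
    by (simp add: coord_mult_mono[symmetric] assms da_fun_coord_mult zpow_bump del: fun_upd_apply)
qed

lemma bounded_ops_sum:
  assumes "A \<in> bounded_ops UNIV UNIV"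
  shows "A (\<Sum>i\<in>I. f i) = (\<Sum>i\<in>I. A (f i))"
  using linear_sum[OF bounded_linear.linear[OF bounded_linear_bounded_ops[OF assms]]] .

lemma da_fun_mono:
  assumes "z \<in> ball 0 1"
  shows "da_fun (da_mono \<beta>) z = zpow z \<beta>"
proof (rule has_sum_unique)
  show "((\<lambda>\<alpha>. da_coeff (da_mono \<beta>) \<alpha> * zpow z \<alpha>) has_sum da_fun (da_mono \<beta>) z) UNIV"
    using da_expansion_coeff[of "da_mono \<beta>"] assms by (simp add: da_expansion_def)
  show "((\<lambda>\<alpha>. da_coeff (da_mono \<beta>) \<alpha> * zpow z \<alpha>) has_sum zpow z \<beta>) UNIV"
    by (rule has_sum_finite_neutralI[of "{\<beta>}"]) (auto simp: da_coeff_mono)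
qed

text \<open>Commutation with the coordinates determines \<open>A\<close> on monomials as
  multiplication by the function \<open>A 1\<close>. Density of the truncations and continuity of
  point evaluation extend this to every \<open>f\<close>.\<close>

lemma commutant_eval:
  assumes A: "A \<in> bounded_ops UNIV UNIV" and comm: "\<And>k f. A (coord_mult k f) = coord_mult k (A f)"
  shows "da_fun (A f) z = da_fun (A (da_mono (\<lambda>_. 0))) z * da_fun f z"
proof (cases "z \<in> ball 0 1")
  case True
  then obtain e :: "'a drury_arveson" where e: "\<And>f. da_fun f z = cinner f e"
    using da_kernel_exists by blast
  define a where "a = da_fun (A (da_mono (\<lambda>_. 0))) z"
  have mono: "cinner (A (da_mono \<beta>)) e = a * cinner (da_mono \<beta>) e" for \<beta>
    using commutant_mono_eval[of A \<beta> z, OF comm] da_fun_mono[OF True, of \<beta>]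
    by (simp add: a_def flip: e)
  have trunc: "cinner (A (da_trunc n f)) e = a * cinner (da_trunc n f) e" for n
    unfolding da_restrict_eq_sum[OF finite_degree_less] bounded_ops_sum[OF A] bounded_opsD(4)[OF A UNIV_I]
    by (simp add: cinner.sum_left cinner_scaleC_left mono sum_distrib_left mult_ac)
  have "(\<lambda>n. cinner (A (da_trunc n f)) e) \<longlonglongrightarrow> cinner (A f) e"
    by (intro cinner.tendsto tendsto_const bounded_linear.tendsto[OF bounded_linear_bounded_ops[OF A]]
        da_trunc_tendsto)
  moreover have "(\<lambda>n. a * cinner (da_trunc n f) e) \<longlonglongrightarrow> a * cinner f e"
    by (intro tendsto_mult cinner.tendsto tendsto_const da_trunc_tendsto)
  ultimately have "cinner (A f) e = a * cinner f e"
    unfolding trunc by (rule LIMSEQ_unique)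
  then show ?thesis
    by (simp add: e a_def)
next
  case False
  then show ?thesis
    by (simp add: da_fun_outside)
qed

text \<open>Together with \<open>multiplier_algebraD\<close>, this identifies the multiplier algebra
  with the commutant of the coordinate multipliers. Operators obtained abstractly, such as adjoints
  of Poisson maps, can thus be recognized as multipliers without exhibiting a symbol.\<close>

lemma multiplier_algebraI:
  assumes A: "A \<in> bounded_ops UNIV UNIV" and comm: "\<And>k f. A (coord_mult k f) = coord_mult k (A f)"
  shows "A \<in> multiplier_algebra"
proof -
  define \<phi> where "\<phi> = da_fun (A (da_mono (\<lambda>_. 0)))"
  have ev: "(\<lambda>z. \<phi> z * da_fun f z) = da_fun (A f)" for f
    using commutant_eval[OF assms, of f] by (simp add: \<phi>_def fun_eq_iff)
  have "A = mult_op \<phi>"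
    by (rule ext) (simp add: mult_op_def ev da_fun_inverse)
  then show ?thesis
    unfolding multiplier_algebra_def using A ev by auto
qed

section \<open>Algebra operations on multipliers and polynomials\<close>

lemma bounded_ops_comp:
  assumes A: "A \<in> bounded_ops UNIV UNIV" and B: "B \<in> bounded_ops UNIV UNIV"
  shows "(\<lambda>x. A (B x)) \<in> bounded_ops UNIV UNIV"
proof -
  obtain C where C: "C \<ge> 0" "\<And>x. norm (A x) \<le> C * norm x"
    using bounded_ops_bound[OF A] by auto
  obtain D where D: "D \<ge> 0" "\<And>x. norm (B x) \<le> D * norm x"
    using bounded_ops_bound[OF B] by auto
  have "norm (A (B x)) \<le> C * D * norm x" for x
    using C(2)[of "B x"] mult_left_mono[OF D(2)[of x] C(1)] by (simp add: mult_ac)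
  then show ?thesis
    using A B by (auto simp: bounded_ops_UNIV_iff)
qed

lemma bounded_ops_add:
  assumes A: "A \<in> bounded_ops UNIV UNIV" and B: "B \<in> bounded_ops UNIV UNIV"
  shows "(\<lambda>x. A x + B x) \<in> bounded_ops UNIV UNIV"
proof -
  obtain C where C: "\<And>x. norm (A x) \<le> C * norm x"
    using bounded_ops_bound[OF A] by auto
  obtain D where D: "\<And>x. norm (B x) \<le> D * norm x"
    using bounded_ops_bound[OF B] by auto
  have "norm (A x + B x) \<le> (C + D) * norm x" for x
    using norm_triangle_ineq[of "A x" "B x"] C[of x] D[of x] by (simp add: algebra_simps)
  then show ?thesis
    using A B by (auto simp: bounded_ops_UNIV_iff scaleC_add_right)
qed

lemma bounded_ops_scaleC:
  assumes A: "A \<in> bounded_ops UNIV UNIV"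
  shows "(\<lambda>x. c *\<^sub>C A x) \<in> bounded_ops UNIV UNIV"
proof -
  obtain C where C: "\<And>x. norm (A x) \<le> C * norm x"
    using bounded_ops_bound[OF A] by auto
  have "norm (c *\<^sub>C A x) \<le> cmod c * C * norm x" for x
    using mult_left_mono[OF C[of x], of "cmod c"] by (simp add: norm_scaleC mult_ac)
  then have "\<exists>C. \<forall>x. norm (c *\<^sub>C A x) \<le> C * norm x"
    by blast
  then show ?thesis
    using A by (auto simp: bounded_ops_UNIV_iff scaleC_add_right scaleC_scaleC mult.commute)
qed

lemma bounded_ops_id: "(\<lambda>x. x) \<in> bounded_ops UNIV UNIV"
  by (auto simp: bounded_ops_UNIV_iff intro: exI[of _ 1])

lemma multiplier_algebra_comp:
  assumes "A \<in> multiplier_algebra" "B \<in> multiplier_algebra"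
  shows "(\<lambda>f. A (B f)) \<in> multiplier_algebra"
  by (rule multiplier_algebraI)
     (use assms in \<open>auto simp: multiplier_algebraD(2) intro: bounded_ops_comp multiplier_algebraD(1)\<close>)

lemma multiplier_algebra_id: "(\<lambda>f. f) \<in> multiplier_algebra"
  by (rule multiplier_algebraI) (auto simp: bounded_ops_id)

lemma multiplier_algebra_coord: "coord_mult k \<in> multiplier_algebra"
  by (rule multiplier_algebraI[OF coord_mult_bounded_ops coord_mult_commute])

lemma multiplier_algebra_add:
  assumes "A \<in> multiplier_algebra" "B \<in> multiplier_algebra"
  shows "(\<lambda>f. A f + B f) \<in> multiplier_algebra"
  by (rule multiplier_algebraI)
     (use assms in \<open>auto simp: multiplier_algebraD(2) bounded_opsD(3)[OF coord_mult_bounded_ops]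
        intro: bounded_ops_add multiplier_algebraD(1)\<close>)

lemma multiplier_algebra_scaleC:
  assumes "A \<in> multiplier_algebra"
  shows "(\<lambda>f. c *\<^sub>C A f) \<in> multiplier_algebra"
  by (rule multiplier_algebraI)
     (use assms in \<open>auto simp: multiplier_algebraD(2) bounded_opsD(4)[OF coord_mult_bounded_ops]
        intro: bounded_ops_scaleC multiplier_algebraD(1)\<close>)

text \<open>Polynomials in the coordinate multipliers, given inductively so that two calculi can be
  compared by rule induction.\<close>

inductive_set poly_ops :: "('d::finite drury_arveson \<Rightarrow> 'd drury_arveson) set" where
  poly_zero: "(\<lambda>f. 0) \<in> poly_ops"
| poly_id: "(\<lambda>f. f) \<in> poly_ops"
| poly_add: "A \<in> poly_ops \<Longrightarrow> B \<in> poly_ops \<Longrightarrow> (\<lambda>f. A f + B f) \<in> poly_ops"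
| poly_scaleC: "A \<in> poly_ops \<Longrightarrow> (\<lambda>f. c *\<^sub>C A f) \<in> poly_ops"
| poly_coord: "A \<in> poly_ops \<Longrightarrow> (\<lambda>f. coord_mult k (A f)) \<in> poly_ops"

lemma poly_ops_multiplier: "A \<in> poly_ops \<Longrightarrow> A \<in> multiplier_algebra"
proof (induction rule: poly_ops.induct)
  case poly_zero
  show ?case
    using multiplier_algebra_scaleC[OF multiplier_algebra_id, of 0] by simp
qed (auto intro: multiplier_algebra_id multiplier_algebra_add multiplier_algebra_scaleC
      multiplier_algebra_comp[OF multiplier_algebra_coord])

lemma poly_ops_sum:
  "(\<And>i. i \<in> I \<Longrightarrow> A i \<in> poly_ops) \<Longrightarrow> (\<lambda>f. \<Sum>i\<in>I. A i f) \<in> poly_ops"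
  by (induction I rule: infinite_finite_induct) (auto intro: poly_zero poly_add)

lemma poly_ops_mpow: "mpow coord_mult \<alpha> \<in> poly_ops"
proof (induction \<alpha> rule: multiindex_induct)
  case 1
  then show ?case
    using poly_id by (simp add: id_def)
next
  case (2 \<beta> k)
  have "mpow coord_mult (bump \<beta> k) = (\<lambda>f. coord_mult k (mpow coord_mult \<beta> f))"
    by (rule ext) (rule mpow_bump[of coord_mult, OF coord_mult_commute])
  then show ?case
    using poly_coord[OF 2] by (simp only:)
qed

section \<open>Fejer means\<close>

text \<open>The Cesaro means of the homogeneous expansion of the symbol \<open>A 1\<close>: the part
  of degree \<open>j\<close> is weighted by \<open>(m - j) / m\<close>.\<close>

definition fejer :: "nat \<Rightarrow> ('d::finite drury_arveson \<Rightarrow> 'd drury_arveson) \<Rightarrow>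
    'd drury_arveson \<Rightarrow> 'd drury_arveson" where
  "fejer m A = (\<lambda>f. \<Sum>\<alpha> | mdeg \<alpha> < m.
     (of_real (real (m - mdeg \<alpha>) / real m) * da_coeff (A (da_mono (\<lambda>_. 0))) \<alpha>) *\<^sub>C mpow coord_mult \<alpha> f)"

lemma fejer_poly_ops: "fejer m A \<in> poly_ops"
  unfolding fejer_def by (intro poly_ops_sum poly_scaleC) (rule poly_ops_mpow)

lemmas fejer_multiplier = poly_ops_multiplier[OF fejer_poly_ops]

lemma mpow_coord_mono_zero: "mpow coord_mult \<alpha> (da_mono (\<lambda>_. 0)) = da_mono \<alpha>"
proof (induction \<alpha> rule: multiindex_induct)
  case (2 \<beta> k)
  then show ?case
    by (simp only: mpow_bump[of coord_mult, OF coord_mult_commute] coord_mult_mono)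
qed simp

lemma da_coeff_fejer_one:
  "da_coeff (fejer m A (da_mono (\<lambda>_. 0))) \<gamma>
    = of_real (real (m - mdeg \<gamma>) / real m) * da_coeff (A (da_mono (\<lambda>_. 0))) \<gamma>"
proof -
  define c where "c \<alpha> = of_real (real (m - mdeg \<alpha>) / real m) * da_coeff (A (da_mono (\<lambda>_. 0))) \<alpha>" for \<alpha>
  have "da_coeff (fejer m A (da_mono (\<lambda>_. 0))) \<gamma> = (\<Sum>\<alpha> | mdeg \<alpha> < m. if \<gamma> = \<alpha> then c \<alpha> else 0)"
    unfolding fejer_def da_coeff_sum da_coeff_scaleC mpow_coord_mono_zero da_coeff_mono c_def
    by (rule sum.cong) auto
  also have "\<dots> = (if mdeg \<gamma> < m then c \<gamma> else 0)"
    by (simp add: sum.delta'[OF finite_degree_less])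
  finally show ?thesis
    by (auto simp: c_def)
qed

text \<open>The matrix of a multiplier in the monomials is of Toeplitz type: an entry depends only
  on the difference of the multi-indices, and vanishes unless that difference is
  nonnegative.\<close>

lemma da_coeff_multiplier_mono:
  assumes "\<And>k f. A (coord_mult k f) = coord_mult k (A f)"
  shows "da_coeff (A (da_mono \<beta>)) \<gamma> =
    (if \<forall>i. \<beta> i \<le> \<gamma> i then da_coeff (A (da_mono (\<lambda>_. 0))) (\<lambda>i. \<gamma> i - \<beta> i) else 0)"
proof (induction \<beta> arbitrary: \<gamma> rule: multiindex_induct)
  case (2 \<beta> k)
  have eq: "da_coeff (A (da_mono (bump \<beta> k))) \<gamma>
      = (if \<gamma> k = 0 then 0 else da_coeff (A (da_mono \<beta>)) (\<gamma>(k := \<gamma> k - 1)))"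
    by (simp only: coord_mult_mono[symmetric] assms da_coeff_coord_mult)
  show ?case
  proof (cases "\<gamma> k = 0")
    case True
    then have "\<not> (\<forall>i. (bump \<beta> k) i \<le> \<gamma> i)"
      by (metis fun_upd_same not_less_eq_eq zero_le)
    with True show ?thesis
      unfolding eq by (simp only: refl if_True if_False)
  next
    case False
    have "(\<forall>i. \<beta> i \<le> (\<gamma>(k := \<gamma> k - 1)) i) \<longleftrightarrow> (\<forall>i. (bump \<beta> k) i \<le> \<gamma> i)"
      using False by (auto split: if_splits)
    moreover have "(\<lambda>i. (\<gamma>(k := \<gamma> k - 1)) i - \<beta> i) = (\<lambda>i. \<gamma> i - (bump \<beta> k) i)"
      by auto
    ultimately show ?thesis
      unfolding eq 2 using False by (simp only: if_False)
  qed
qed simp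

text \<open>Passing to a Fejer mean is a Schur multiplication of the matrix of \<open>A\<close> by a
  factor that depends only on the two degrees. Truncated subtraction is harmless, since the entry
  vanishes unless \<open>\<beta>\<close> is below \<open>\<gamma>\<close>.\<close>

lemma da_coeff_fejer_mono:
  assumes A: "A \<in> multiplier_algebra"
  shows "da_coeff (fejer m A (da_mono \<beta>)) \<gamma>
    = of_real (real (m - (mdeg \<gamma> - mdeg \<beta>)) / real m) * da_coeff (A (da_mono \<beta>)) \<gamma>"
proof (cases "\<forall>i. \<beta> i \<le> \<gamma> i")
  case True
  then have "mdeg (\<lambda>i. \<gamma> i - \<beta> i) = mdeg \<gamma> - mdeg \<beta>"
    by (intro sum_subtractf_nat) auto
  with True show ?thesis
    using da_coeff_multiplier_mono[of A \<beta> \<gamma>, OF multiplier_algebraD(2)[OF A]]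
      da_coeff_multiplier_mono[of "fejer m A" \<beta> \<gamma>, OF multiplier_algebraD(2)[OF fejer_multiplier]]
    by (simp only: da_coeff_fejer_one simp_thms if_True)
next
  case False
  then show ?thesis
    using da_coeff_multiplier_mono[of A \<beta> \<gamma>, OF multiplier_algebraD(2)[OF A]]
      da_coeff_multiplier_mono[of "fejer m A" \<beta> \<gamma>, OF multiplier_algebraD(2)[OF fejer_multiplier]]
    by (simp only: if_False mult_zero_right)
qed

lemma cinner_restrict_restrict:
  assumes A: "A \<in> bounded_ops UNIV UNIV" and "finite I" "finite I'"
  shows "cinner (A (da_restrict I f)) (da_restrict I' g)
    = (\<Sum>\<beta>\<in>I. \<Sum>\<gamma>\<in>I'. da_coeff f \<beta> * cnj (da_coeff g \<gamma>) * of_real (da_weight \<gamma>) * da_coeff (A (da_mono \<beta>)) \<gamma>)"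
  unfolding da_restrict_eq_sum[OF assms(2)] da_restrict_eq_sum[OF assms(3)] bounded_ops_sum[OF A]
    bounded_opsD(4)[OF A UNIV_I]
  unfolding cinner.sum_left[of _ I]
  by (intro sum.cong refl)
     (simp add: cinner.sum_right[of _ _ I'] cinner_scaleC_left cinner_scaleC_right cinner_da_mono da_coeff_scaleC
        sum_distrib_left mult_ac)

text \<open>The Schur multiplier \<open>(m - |i - j|)\<^sub>+ / m\<close> is the average over \<open>s\<close> of the compressions to the
  degrees in the window \<open>s - m < deg \<le> s\<close>, so Fejer means do not increase the norm.\<close>

lemma fejer_windows:
  fixes n m :: nat
  assumes A: "A \<in> multiplier_algebra" and m: "m > 0"
  defines "W \<equiv> \<lambda>s. {\<alpha> :: 'd::finite \<Rightarrow> nat. mdeg \<alpha> < n \<and> mdeg \<alpha> \<le> s \<and> s < mdeg \<alpha> + m}"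
  shows "of_nat m * cinner (fejer m A (da_trunc n f)) (da_trunc n g)
    = (\<Sum>s<n + m. cinner (A (da_restrict (W s) f)) (da_restrict (W s) g))"
proof -
  define D where "D = {\<alpha> :: 'd \<Rightarrow> nat. mdeg \<alpha> < n}"
  define h where "h \<beta> \<gamma> = da_coeff f \<beta> * cnj (da_coeff g \<gamma>) * of_real (da_weight \<gamma>) *
    da_coeff (A (da_mono \<beta>)) \<gamma>" for \<beta> \<gamma>
  have fin: "finite D" "\<And>s. finite (W s)"
    unfolding D_def W_def by (auto intro: finite_subset[OF _ finite_degree_less[of n]])
  have count: "of_nat (m - (mdeg \<gamma> - mdeg \<beta>)) * h \<beta> \<gamma>
      = (\<Sum>s<n + m. if \<beta> \<in> W s \<and> \<gamma> \<in> W s then h \<beta> \<gamma> else 0)" if \<beta>: "\<beta> \<in> D" and \<gamma>: "\<gamma> \<in> D" for \<beta> \<gamma>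
  proof (cases "\<forall>i. \<beta> i \<le> \<gamma> i")
    case True
    then have le: "mdeg \<beta> \<le> mdeg \<gamma>"
      by (intro sum_mono) auto
    \<comment> \<open>The windows that meet both degrees form an interval whose length is the Schur
      factor, and which is empty once the degrees differ by \<open>m\<close> or more. The range
      \<open>s < n + m\<close> reaches all of them because degrees in \<open>D\<close> stay below
      \<open>n\<close>.\<close>
    have "{s \<in> {..<n + m}. \<beta> \<in> W s \<and> \<gamma> \<in> W s} = {mdeg \<gamma>..<mdeg \<beta> + m}"
      using \<beta> \<gamma> le by (auto simp: W_def D_def)
    then have "card {s \<in> {..<n + m}. \<beta> \<in> W s \<and> \<gamma> \<in> W s} = m - (mdeg \<gamma> - mdeg \<beta>)"
      using le by simp
    then show ?thesis
      by (simp add: sum.If_cases Int_def)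
  next
    case False
    then have "h \<beta> \<gamma> = 0"
      using da_coeff_multiplier_mono[of A \<beta> \<gamma>, OF multiplier_algebraD(2)[OF A]]
      by (simp only: h_def if_False mult_zero_right)
    then show ?thesis
      by (simp cong: if_cong)
  qed
  have "of_nat m * cinner (fejer m A (da_trunc n f)) (da_trunc n g)
      = (\<Sum>\<beta>\<in>D. \<Sum>\<gamma>\<in>D. of_nat (m - (mdeg \<gamma> - mdeg \<beta>)) * h \<beta> \<gamma>)"
    unfolding D_def[symmetric]
      cinner_restrict_restrict[OF multiplier_algebraD(1)[OF fejer_multiplier] fin(1) fin(1)]
      sum_distrib_left da_coeff_fejer_mono[OF A] h_def
    by (intro sum.cong refl) (use m in \<open>simp del: of_nat_diff\<close>)
  also have "\<dots> = (\<Sum>\<beta>\<in>D. \<Sum>\<gamma>\<in>D. \<Sum>s<n + m. if \<beta> \<in> W s \<and> \<gamma> \<in> W s then h \<beta> \<gamma> else 0)"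
    by (intro sum.cong refl count)
  also have "\<dots> = (\<Sum>\<beta>\<in>D. \<Sum>s<n + m. \<Sum>\<gamma>\<in>D. if \<beta> \<in> W s \<and> \<gamma> \<in> W s then h \<beta> \<gamma> else 0)"
    by (intro sum.cong refl sum.swap)
  also have "\<dots> = (\<Sum>s<n + m. \<Sum>\<beta>\<in>D. \<Sum>\<gamma>\<in>D. if \<beta> \<in> W s \<and> \<gamma> \<in> W s then h \<beta> \<gamma> else 0)"
    by (rule sum.swap)
  also have "\<dots> = (\<Sum>s<n + m. \<Sum>\<beta>\<in>W s. \<Sum>\<gamma>\<in>W s. h \<beta> \<gamma>)"
  proof (rule sum.cong[OF refl])
    fix s
    have DW: "D \<inter> W s = W s"
      by (auto simp: D_def W_def)
    have "(\<Sum>\<gamma>\<in>D. if \<beta> \<in> W s \<and> \<gamma> \<in> W s then h \<beta> \<gamma> else 0)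
        = (if \<beta> \<in> W s then \<Sum>\<gamma>\<in>W s. h \<beta> \<gamma> else 0)" for \<beta>
      using sum.inter_restrict[OF fin(1), of "h \<beta>" "W s"] by (simp add: DW)
    then show "(\<Sum>\<beta>\<in>D. \<Sum>\<gamma>\<in>D. if \<beta> \<in> W s \<and> \<gamma> \<in> W s then h \<beta> \<gamma> else 0) = (\<Sum>\<beta>\<in>W s. \<Sum>\<gamma>\<in>W s. h \<beta> \<gamma>)"
      using sum.inter_restrict[OF fin(1), of "\<lambda>\<beta>. \<Sum>\<gamma>\<in>W s. h \<beta> \<gamma>" "W s"] by (simp add: DW)
  qed
  also have "\<dots> = (\<Sum>s<n + m. cinner (A (da_restrict (W s) f)) (da_restrict (W s) g))"
    unfolding cinner_restrict_restrict[OF multiplier_algebraD(1)[OF A] fin(2) fin(2)] h_def ..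
  finally show ?thesis .
qed

text \<open>Each degree below \<open>n\<close> lies in exactly \<open>m\<close> of the
  windows.\<close>

lemma sum_windows_le:
  fixes f :: "'d::finite drury_arveson" and n m :: nat
  defines "W \<equiv> \<lambda>s. {\<alpha> :: 'd \<Rightarrow> nat. mdeg \<alpha> < n \<and> mdeg \<alpha> \<le> s \<and> s < mdeg \<alpha> + m}"
  shows "(\<Sum>s<n + m. (norm (da_restrict (W s) f))\<^sup>2) \<le> real m * (norm f)\<^sup>2"
proof -
  define D where "D = {\<alpha> :: 'd \<Rightarrow> nat. mdeg \<alpha> < n}"
  define h where "h \<alpha> = da_weight \<alpha> * (cmod (da_coeff f \<alpha>))\<^sup>2" for \<alpha>
  have fin: "finite D" "\<And>s. finite (W s)"
    unfolding D_def W_def by (auto intro: finite_subset[OF _ finite_degree_less[of n]])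
  have "(\<Sum>s<n + m. (norm (da_restrict (W s) f))\<^sup>2) = (\<Sum>s<n + m. \<Sum>\<alpha>\<in>D. if \<alpha> \<in> W s then h \<alpha> else 0)"
  proof (rule sum.cong[OF refl])
    fix s
    have "D \<inter> W s = W s"
      by (auto simp: D_def W_def)
    then show "(norm (da_restrict (W s) f))\<^sup>2 = (\<Sum>\<alpha>\<in>D. if \<alpha> \<in> W s then h \<alpha> else 0)"
      using sum.inter_restrict[OF fin(1), of h "W s"] by (simp add: norm_da_restrict_sq[OF fin(2)] h_def)
  qed
  also have "\<dots> = (\<Sum>\<alpha>\<in>D. \<Sum>s<n + m. if \<alpha> \<in> W s then h \<alpha> else 0)"
    by (rule sum.swap)
  also have "\<dots> = (\<Sum>\<alpha>\<in>D. real m * h \<alpha>)"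
  proof (rule sum.cong[OF refl])
    fix \<alpha> assume "\<alpha> \<in> D"
    then have "{s \<in> {..<n + m}. \<alpha> \<in> W s} = {mdeg \<alpha>..<mdeg \<alpha> + m}"
      by (auto simp: W_def D_def)
    then have "card {s \<in> {..<n + m}. \<alpha> \<in> W s} = m"
      by simp
    then show "(\<Sum>s<n + m. if \<alpha> \<in> W s then h \<alpha> else 0) = real m * h \<alpha>"
      by (simp add: sum.If_cases Int_def)
  qed
  also have "\<dots> \<le> real m * (norm f)\<^sup>2"
    unfolding sum_distrib_left[symmetric] h_def
    by (intro mult_left_mono finite_sum_le_norm_da fin) simp
  finally show ?thesis .
qed

text \<open>Every window compression obeys the bound of \<open>A\<close>. Cauchy-Schwarz over the
  windows costs a factor \<open>sqrt m\<close> for each of \<open>f\<close> and \<open>g\<close>,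
  and their product cancels the averaging factor.\<close>

lemma fejer_bound:
  assumes A: "A \<in> multiplier_algebra" and C: "\<And>f. norm (A f) \<le> C * norm f" and m: "m > 0"
  shows "cmod (cinner (fejer m A f) g) \<le> C * norm f * norm g"
proof (rule LIMSEQ_le_const2)
  show "(\<lambda>n. cmod (cinner (fejer m A (da_trunc n f)) (da_trunc n g))) \<longlonglongrightarrow> cmod (cinner (fejer m A f) g)"
    by (intro tendsto_norm cinner.tendsto da_trunc_tendsto
        bounded_linear.tendsto[OF bounded_linear_bounded_ops[OF multiplier_algebraD(1)[OF fejer_multiplier]]])
  \<comment> \<open>Testing the bound on the nonzero constant function shows the sign of
    \<open>C\<close>.\<close>
  have C0: "C \<ge> 0"
  proof -
    have "da_coeff (da_mono (\<lambda>_. 0)) (\<lambda>_. 0) \<noteq> da_coeff (0 :: 'a drury_arveson) (\<lambda>_. 0)"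
      by (simp add: da_coeff_mono da_coeff_zero)
    then have "norm (da_mono (\<lambda>_. 0) :: 'a drury_arveson) > 0"
      by (metis zero_less_norm_iff)
    moreover have "0 \<le> C * norm (da_mono (\<lambda>_. 0) :: 'a drury_arveson)"
      using C norm_ge_zero order_trans by blast
    ultimately show ?thesis
      by (simp add: zero_le_mult_iff)
  qed
  have "cmod (cinner (fejer m A (da_trunc n f)) (da_trunc n g)) \<le> C * norm f * norm g" for n
  proof -
    define W where "W s = {\<alpha> :: 'a \<Rightarrow> nat. mdeg \<alpha> < n \<and> mdeg \<alpha> \<le> s \<and> s < mdeg \<alpha> + m}" for s
    define F where "F s = norm (da_restrict (W s) f)" for s
    define G where "G s = norm (da_restrict (W s) g)" for s
    have L2: "L2_set F {..<n + m} \<le> sqrt m * norm f" "L2_set G {..<n + m} \<le> sqrt m * norm g"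
      unfolding L2_set_def F_def G_def W_def
      using real_sqrt_le_mono[OF sum_windows_le[of n m f]] real_sqrt_le_mono[OF sum_windows_le[of n m g]]
      by (simp_all add: real_sqrt_mult)
    have "real m * cmod (cinner (fejer m A (da_trunc n f)) (da_trunc n g))
        = cmod (of_nat m * cinner (fejer m A (da_trunc n f)) (da_trunc n g))"
      by (simp add: norm_mult)
    also have "\<dots> \<le> (\<Sum>s<n + m. cmod (cinner (A (da_restrict (W s) f)) (da_restrict (W s) g)))"
      unfolding fejer_windows[OF A m] W_def by (rule norm_sum)
    also have "\<dots> \<le> (\<Sum>s<n + m. C * (\<bar>F s\<bar> * \<bar>G s\<bar>))"
    proof (rule sum_mono)
      fix s
      have "cmod (cinner (A (da_restrict (W s) f)) (da_restrict (W s) g))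
          \<le> norm (A (da_restrict (W s) f)) * norm (da_restrict (W s) g)"
        by (rule norm_cinner_le)
      also have "\<dots> \<le> C * norm (da_restrict (W s) f) * norm (da_restrict (W s) g)"
        by (intro mult_right_mono C) simp
      finally show "cmod (cinner (A (da_restrict (W s) f)) (da_restrict (W s) g)) \<le> C * (\<bar>F s\<bar> * \<bar>G s\<bar>)"
        by (simp add: F_def G_def mult_ac)
    qed
    also have "\<dots> = C * (\<Sum>s<n + m. \<bar>F s\<bar> * \<bar>G s\<bar>)"
      by (simp add: sum_distrib_left)
    also have "\<dots> \<le> C * (L2_set F {..<n + m} * L2_set G {..<n + m})"
      by (intro mult_left_mono L2_set_mult_ineq C0)
    also have "\<dots> \<le> C * ((sqrt m * norm f) * (sqrt m * norm g))"
      by (intro mult_left_mono mult_mono L2 C0) (auto simp: L2_set_nonneg)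
    also have "\<dots> = real m * (C * norm f * norm g)"
      by (simp add: mult_ac flip: real_sqrt_mult)
    finally show ?thesis
      using m by simp
  qed
  then show "\<exists>N. \<forall>n\<ge>N. cmod (cinner (fejer m A (da_trunc n f)) (da_trunc n g)) \<le> C * norm f * norm g"
    by blast
qed

lemma fejer_weight_tendsto: "(\<lambda>m. real (Suc m - k) / real (Suc m)) \<longlonglongrightarrow> 1"
proof (rule Lim_transform_eventually)
  show "(\<lambda>m. 1 - real k * inverse (real (Suc m))) \<longlonglongrightarrow> 1"
    using tendsto_diff[OF tendsto_const tendsto_mult[OF tendsto_const LIMSEQ_inverse_real_of_nat], of 1 "real k"]
    by simp
  show "\<forall>\<^sub>F m in sequentially. 1 - real k * inverse (real (Suc m)) = real (Suc m - k) / real (Suc m)"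
    unfolding eventually_sequentially
    by (rule exI[of _ k]) (simp add: of_nat_diff field_simps del: of_nat_Suc)
qed

lemma fejer_tendsto_trunc:
  assumes A: "A \<in> multiplier_algebra"
  shows "(\<lambda>m. cinner (fejer (Suc m) A (da_trunc n f)) (da_trunc n g)) \<longlonglongrightarrow> cinner (A (da_trunc n f)) (da_trunc n g)"
proof -
  have "(\<lambda>m. of_real (real (Suc m - k) / real (Suc m)) * c) \<longlonglongrightarrow> of_real 1 * c" for k and c :: complex
    by (intro tendsto_mult tendsto_of_real fejer_weight_tendsto tendsto_const)
  then show ?thesis
    unfolding cinner_restrict_restrict[OF multiplier_algebraD(1)[OF A] finite_degree_less finite_degree_less]
      cinner_restrict_restrict[OF multiplier_algebraD(1)[OF fejer_multiplier] finite_degree_less finite_degree_less]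
      da_coeff_fejer_mono[OF A]
    by (intro tendsto_sum tendsto_mult_left) simp
qed

text \<open>On truncations only finitely many matrix entries matter and each of them converges; the
  bound of \<open>fejer_bound\<close>, uniform in \<open>m\<close>, carries the convergence to
  arbitrary vectors.\<close>

lemma fejer_tendsto:
  fixes f g :: "'d::finite drury_arveson"
  assumes A: "A \<in> multiplier_algebra"
  shows "(\<lambda>m. cinner (fejer (Suc m) A f) g) \<longlonglongrightarrow> cinner (A f) g"
proof (rule LIMSEQ_I)
  fix e :: real assume e: "e > 0"
  obtain C where C: "C \<ge> 0" "\<And>f. norm (A f) \<le> C * norm f"
    using bounded_ops_bound[OF multiplier_algebraD(1)[OF A]] by auto
  define E where "E m f = fejer (Suc m) A f - A f" for m f
  have E_le: "cmod (cinner (E m f) g) \<le> 2 * C * norm f * norm g" for m f g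
  proof -
    have "cmod (cinner (A f) g) \<le> C * norm f * norm g"
      using norm_cinner_le[of "A f" g] mult_right_mono[OF C(2)[of f], of "norm g"] by simp
    moreover have "cmod (cinner (fejer (Suc m) A f) g) \<le> C * norm f * norm g"
      by (rule fejer_bound[OF A C(2)]) simp
    moreover have "cmod (cinner (E m f) g) \<le> cmod (cinner (fejer (Suc m) A f) g) + cmod (cinner (A f) g)"
      unfolding E_def cinner.diff_left by (rule norm_triangle_ineq4)
    ultimately show ?thesis
      by simp
  qed
  have E_diff: "E m (f - h) = E m f - E m h" for m f h
    unfolding E_def
    using bounded_ops_diff[OF multiplier_algebraD(1)[OF A]]
      bounded_ops_diff[OF multiplier_algebraD(1)[OF fejer_multiplier]]
    by simp
  have "(\<lambda>n. 2 * C * norm (f - da_trunc n f) * norm g + 2 * C * norm (da_trunc n f) * norm (g - da_trunc n g))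
      \<longlonglongrightarrow> 2 * C * norm (f - f) * norm g + 2 * C * norm f * norm (g - g)"
    by (intro tendsto_intros da_trunc_tendsto)
  then have "\<forall>\<^sub>F n in sequentially. 2 * C * norm (f - da_trunc n f) * norm g
      + 2 * C * norm (da_trunc n f) * norm (g - da_trunc n g) < e / 2"
    using e by (intro order_tendstoD(2)) auto
  then obtain n where n: "2 * C * norm (f - da_trunc n f) * norm g
      + 2 * C * norm (da_trunc n f) * norm (g - da_trunc n g) < e / 2"
    by (auto simp: eventually_sequentially)
  obtain m0 where m0: "\<And>m. m \<ge> m0 \<Longrightarrow> cmod (cinner (E m (da_trunc n f)) (da_trunc n g)) < e / 2"
    using LIMSEQ_D[OF fejer_tendsto_trunc[OF A, of n f g], of "e / 2"] e
    unfolding E_def cinner.diff_left by auto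
  have "cmod (cinner (fejer (Suc m) A f) g - cinner (A f) g) < e" if "m \<ge> m0" for m
  proof -
    have split: "cinner (fejer (Suc m) A f) g - cinner (A f) g
        = cinner (E m (f - da_trunc n f)) g + cinner (E m (da_trunc n f)) (g - da_trunc n g)
          + cinner (E m (da_trunc n f)) (da_trunc n g)"
      by (simp add: E_diff cinner.diff_left cinner.diff_right) (simp add: E_def cinner.diff_left)
    have "cmod (cinner (fejer (Suc m) A f) g - cinner (A f) g) \<le> cmod (cinner (E m (f - da_trunc n f)) g)
        + cmod (cinner (E m (da_trunc n f)) (g - da_trunc n g))
        + cmod (cinner (E m (da_trunc n f)) (da_trunc n g))"
      unfolding split
      by (rule order_trans[OF norm_triangle_ineq]) (rule add_right_mono[OF norm_triangle_ineq])
    also have "\<dots> < e"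
      using E_le[of m "f - da_trunc n f" g] E_le[of m "da_trunc n f" "g - da_trunc n g"] m0[OF that] n
      by linarith
    finally show ?thesis .
  qed
  then show "\<exists>m0. \<forall>m\<ge>m0. norm (cinner (fejer (Suc m) A f) g - cinner (A f) g) < e"
    by auto
qed

section \<open>Functional calculi are determined by polynomials\<close>

lemma summable_norm_mult:
  fixes \<xi> :: "nat \<Rightarrow> 'a::real_normed_vector" and \<eta> :: "nat \<Rightarrow> 'b::real_normed_vector"
  assumes "summable (\<lambda>n. (norm (\<xi> n))\<^sup>2)" "summable (\<lambda>n. (norm (\<eta> n))\<^sup>2)"
  shows "summable (\<lambda>n. norm (\<xi> n) * norm (\<eta> n))"
proof (rule summable_comparison_test'[of _ 0])
  show "summable (\<lambda>n. (norm (\<xi> n))\<^sup>2 + (norm (\<eta> n))\<^sup>2)"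
    by (intro summable_add assms)
  fix n
  have "2 * (norm (\<xi> n) * norm (\<eta> n)) \<le> (norm (\<xi> n))\<^sup>2 + (norm (\<eta> n))\<^sup>2"
    using sum_squares_bound[of "norm (\<xi> n)" "norm (\<eta> n)"] by simp
  then have "norm (\<xi> n) * norm (\<eta> n) \<le> (norm (\<xi> n))\<^sup>2 + (norm (\<eta> n))\<^sup>2"
    using mult_nonneg_nonneg[OF norm_ge_zero[of "\<xi> n"] norm_ge_zero[of "\<eta> n"]] by linarith
  then show "norm (norm (\<xi> n) * norm (\<eta> n)) \<le> (norm (\<xi> n))\<^sup>2 + (norm (\<eta> n))\<^sup>2"
    by simp
qed

text \<open>Dominated convergence for series: the uniform bound gives the summable majorant
  \<open>C * (norm (\<xi> n) * norm (\<eta> n))\<close>. The series are the pairings with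
  trace-class operators, so this is weak-star convergence.\<close>

lemma fejer_tendsto_suminf:
  assumes A: "A \<in> multiplier_algebra"
    and \<xi>: "summable (\<lambda>n. (norm (\<xi> n))\<^sup>2)" and \<eta>: "summable (\<lambda>n. (norm (\<eta> n))\<^sup>2)"
  shows "(\<lambda>m. \<Sum>n. cinner (fejer (Suc m) A (\<xi> n)) (\<eta> n)) \<longlonglongrightarrow> (\<Sum>n. cinner (A (\<xi> n)) (\<eta> n))"
proof -
  obtain C where C: "\<And>f. norm (A f) \<le> C * norm f"
    using bounded_ops_bound[OF multiplier_algebraD(1)[OF A]] by auto
  have "eventually (\<lambda>(n, m). norm (cinner (fejer (Suc m) A (\<xi> n)) (\<eta> n)) \<le> C * (norm (\<xi> n) * norm (\<eta> n)))
      (at_top \<times>\<^sub>F sequentially)"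
    using fejer_bound[OF A C] by (intro always_eventually) (simp add: mult.assoc)
  from tannerys_theorem[OF fejer_tendsto[OF A] this summable_mult[OF summable_norm_mult[OF \<xi> \<eta>]]]
  show ?thesis
    by simp
qed

section \<open>Sequences in the weak-star topology\<close>

abbreviation weak_star_subbasis :: "'a::complex_inner_space set \<Rightarrow> ('a \<Rightarrow> 'a) set set" where
  "weak_star_subbasis H \<equiv> {{A \<in> bounded_ops H H. (\<Sum>n. cinner (A (\<xi> n)) (\<eta> n)) \<in> U} | \<xi> \<eta> U.
        range \<xi> \<subseteq> H \<and> range \<eta> \<subseteq> H \<and> summable (\<lambda>n. (norm (\<xi> n))\<^sup>2) \<and> summable (\<lambda>n. (norm (\<eta> n))\<^sup>2) \<and> open U}"

lemma topspace_weak_star: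
  assumes "0 \<in> H"
  shows "topspace (weak_star H) = bounded_ops H H"
proof -
  have "bounded_ops H H \<in> weak_star_subbasis H"
    unfolding mem_Collect_eq
    by (rule exI[of _ "\<lambda>_. 0"], rule exI[of _ "\<lambda>_. 0"], rule exI[of _ UNIV]) (use assms in auto)
  then have "\<Union> (weak_star_subbasis H) = bounded_ops H H"
    by blast
  then show ?thesis
    unfolding weak_star_def topology_generated_by_topspace .
qed

lemma openin_weak_star:
  assumes "range \<xi> \<subseteq> H" "range \<eta> \<subseteq> H" "summable (\<lambda>n. (norm (\<xi> n))\<^sup>2)" "summable (\<lambda>n. (norm (\<eta> n))\<^sup>2)" "open U"
  shows "openin (weak_star H) {A \<in> bounded_ops H H. (\<Sum>n. cinner (A (\<xi> n)) (\<eta> n)) \<in> U}"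
  unfolding weak_star_def by (rule topology_generated_by_Basis) (use assms in blast)

lemma limitin_weak_star_fejer:
  assumes A: "A \<in> multiplier_algebra"
  shows "limitin (weak_star UNIV) (\<lambda>m. fejer (Suc m) A) A sequentially"
  unfolding limitin_def
proof (intro conjI allI impI)
  show "A \<in> topspace (weak_star UNIV)"
    by (simp add: topspace_weak_star multiplier_algebraD(1)[OF A])
  fix U assume "openin (weak_star UNIV) U \<and> A \<in> U"
  then have "generate_topology_on (weak_star_subbasis UNIV) U" and "A \<in> U"
    unfolding weak_star_def openin_topology_generated_by_iff by auto
  then show "\<forall>\<^sub>F m in sequentially. fejer (Suc m) A \<in> U"
  \<comment> \<open>Induction over the generation of open sets from the subbasis; convergence of the
    pairings enters only in the subbasic case.\<close>
  proof induction
    case (Int a b)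
    then show ?case
      by (auto intro: eventually_conj)
  next
    case (UN K)
    then obtain k where k: "k \<in> K" "A \<in> k"
      by blast
    show ?case
      by (rule eventually_mono[OF UN(2)[OF k]]) (use k in blast)
  next
    case (Basis s)
    then obtain \<xi> \<eta> U where s: "s = {A \<in> bounded_ops UNIV UNIV. (\<Sum>n. cinner (A (\<xi> n)) (\<eta> n)) \<in> U}"
      "summable (\<lambda>n. (norm (\<xi> n))\<^sup>2)" "summable (\<lambda>n. (norm (\<eta> n))\<^sup>2)" "open U"
      by blast
    have "\<forall>\<^sub>F m in sequentially. (\<Sum>n. cinner (fejer (Suc m) A (\<xi> n)) (\<eta> n)) \<in> U"
      using topological_tendstoD[OF fejer_tendsto_suminf[OF A s(2,3)] s(4)] Basis(2) s(1) by blast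
    then show ?case
      unfolding s(1) by (simp add: multiplier_algebraD(1)[OF fejer_multiplier])
  qed simp
qed

lemma weak_star_tendsto:
  assumes lim: "limitin (weak_star H) P A sequentially" and xy: "x \<in> H" "y \<in> H" and H: "0 \<in> H"
  shows "(\<lambda>m. cinner (P m x) y) \<longlonglongrightarrow> cinner (A x) y"
proof (rule topological_tendstoI)
  fix U :: "complex set" assume U: "open U" "cinner (A x) y \<in> U"
  \<comment> \<open>Sequences supported at index 0 reduce the trace-class pairing to a single matrix
    coefficient.\<close>
  define \<xi> where "\<xi> n = (if n = 0 then x else 0)" for n :: nat
  define \<eta> where "\<eta> n = (if n = 0 then y else 0)" for n :: nat
  have sum: "(\<Sum>n. cinner (B (\<xi> n)) (\<eta> n)) = cinner (B x) y" for B :: "'a \<Rightarrow> 'a"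
    by (subst suminf_finite[of "{0}"]) (auto simp: \<xi>_def \<eta>_def cinner.zero_right)
  have "summable (\<lambda>n. (norm (\<xi> n))\<^sup>2)" "summable (\<lambda>n. (norm (\<eta> n))\<^sup>2)"
    by (rule summable_finite[of "{0}"]; simp add: \<xi>_def \<eta>_def)+
  moreover have "range \<xi> \<subseteq> H" "range \<eta> \<subseteq> H"
    using xy H by (auto simp: \<xi>_def \<eta>_def)
  ultimately have op: "openin (weak_star H) {B \<in> bounded_ops H H. cinner (B x) y \<in> U}"
    using openin_weak_star[of \<xi> H \<eta> U] U by (simp add: sum)
  have "A \<in> bounded_ops H H"
    using lim by (simp add: limitin_def topspace_weak_star[OF H])
  with op lim U(2) have "\<forall>\<^sub>F m in sequentially. P m \<in> {B \<in> bounded_ops H H. cinner (B x) y \<in> U}"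
    unfolding limitin_def by blast
  then show "\<forall>\<^sub>F m in sequentially. cinner (P m x) y \<in> U"
    by (rule eventually_mono) simp
qed

lemma functional_calculusD:
  assumes "is_functional_calculus H S \<Phi>"
  shows "\<And>A. A \<in> multiplier_algebra \<Longrightarrow> \<Phi> A \<in> bounded_ops H H"
    "\<Phi> \<in> extensional multiplier_algebra"
    "\<And>x. x \<in> H \<Longrightarrow> \<Phi> (\<lambda>f. f) x = x"
    "\<And>A B x. A \<in> multiplier_algebra \<Longrightarrow> B \<in> multiplier_algebra \<Longrightarrow> x \<in> H \<Longrightarrow> \<Phi> (\<lambda>f. A f + B f) x = \<Phi> A x + \<Phi> B x"
    "\<And>A B x. A \<in> multiplier_algebra \<Longrightarrow> B \<in> multiplier_algebra \<Longrightarrow> x \<in> H \<Longrightarrow> \<Phi> (\<lambda>f. A (B f)) x = \<Phi> A (\<Phi> B x)"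
    "\<And>c A x. A \<in> multiplier_algebra \<Longrightarrow> x \<in> H \<Longrightarrow> \<Phi> (\<lambda>f. c *\<^sub>C A f) x = c *\<^sub>C \<Phi> A x"
    "continuous_map (subtopology (weak_star UNIV) multiplier_algebra) (weak_star H) \<Phi>"
    "\<And>k. \<Phi> (coord_mult k) = S k"
  using assms unfolding is_functional_calculus_def by (auto simp: PiE_def)

lemma functional_calculus_tendsto:
  assumes \<Phi>: "is_functional_calculus H S \<Phi>" and A: "A \<in> multiplier_algebra"
    and "x \<in> H" "y \<in> H" "0 \<in> H"
  shows "(\<lambda>m. cinner (\<Phi> (fejer (Suc m) A) x) y) \<longlonglongrightarrow> cinner (\<Phi> A x) y"
proof -
  have "limitin (subtopology (weak_star UNIV) multiplier_algebra) (\<lambda>m. fejer (Suc m) A) A sequentially"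
    by (simp add: limitin_subtopology limitin_weak_star_fejer[OF A] A fejer_multiplier)
  from continuous_map_limit[OF functional_calculusD(7)[OF \<Phi>] this]
  have "limitin (weak_star H) (\<lambda>m. \<Phi> (fejer (Suc m) A)) (\<Phi> A) sequentially"
    by (simp add: o_def)
  then show ?thesis
    using assms(3-5) by (rule weak_star_tendsto)
qed

lemma functional_calculus_zero:
  assumes \<Phi>: "is_functional_calculus H S \<Phi>" and "x \<in> H"
  shows "\<Phi> (\<lambda>f. 0) x = 0"
  using functional_calculusD(6)[OF \<Phi> multiplier_algebra_id assms(2), of 0] by simp

lemma functional_calculus_unique:
  assumes H: "closed_csubspace H" and \<Phi>: "is_functional_calculus H S \<Phi>" and \<Psi>: "is_functional_calculus H S \<Psi>"
  shows "\<Phi> = \<Psi>"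
proof (rule extensionalityI[of _ multiplier_algebra])
  note H0 = closed_csubspaceD(3)[OF H]
  have poly: "\<forall>x\<in>H. \<Phi> p x = \<Psi> p x" if "p \<in> poly_ops" for p
    using that
  proof induction
    case poly_zero
    then show ?case
      using functional_calculus_zero[OF \<Phi>] functional_calculus_zero[OF \<Psi>] by simp
  next
    case poly_id
    then show ?case
      using functional_calculusD(3)[OF \<Phi>] functional_calculusD(3)[OF \<Psi>] by simp
  next
    case (poly_add A B)
    then have "A \<in> multiplier_algebra" "B \<in> multiplier_algebra"
      by (auto intro: poly_ops_multiplier)
    from functional_calculusD(4)[OF \<Phi> this] functional_calculusD(4)[OF \<Psi> this] poly_add.IH
    show ?case
      by simp
  next
    case (poly_scaleC A c)
    then have "A \<in> multiplier_algebra"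
      by (auto intro: poly_ops_multiplier)
    from functional_calculusD(6)[OF \<Phi> this] functional_calculusD(6)[OF \<Psi> this] poly_scaleC.IH
    show ?case
      by simp
  next
    case (poly_coord A k)
    then have A: "A \<in> multiplier_algebra"
      by (auto intro: poly_ops_multiplier)
    show ?case
      using functional_calculusD(5)[OF \<Phi> multiplier_algebra_coord[of k] A] functional_calculusD(8)[OF \<Phi>]
        functional_calculusD(5)[OF \<Psi> multiplier_algebra_coord[of k] A] functional_calculusD(8)[OF \<Psi>]
        poly_coord.IH by simp
  qed
  fix A :: "'b drury_arveson \<Rightarrow> 'b drury_arveson"
  assume A: "A \<in> multiplier_algebra"
  note \<Phi>A = functional_calculusD(1)[OF \<Phi> A] and \<Psi>A = functional_calculusD(1)[OF \<Psi> A]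
  show "\<Phi> A = \<Psi> A"
  proof (rule extensionalityI[of _ H])
    fix x assume x: "x \<in> H"
    show "\<Phi> A x = \<Psi> A x"
    proof (rule cinner_ext[OF closed_csubspaceD(1)[OF H] bounded_opsD(1)[OF \<Phi>A x] bounded_opsD(1)[OF \<Psi>A x]])
      fix y assume y: "y \<in> H"
      have "(\<lambda>m. cinner (\<Psi> (fejer (Suc m) A) x) y) \<longlonglongrightarrow> cinner (\<Phi> A x) y"
        using functional_calculus_tendsto[OF \<Phi> A x y H0] poly[OF fejer_poly_ops] x by simp
      then show "cinner (\<Phi> A x) y = cinner (\<Psi> A x) y"
        using functional_calculus_tendsto[OF \<Psi> A x y H0] by (rule LIMSEQ_unique)
    qed
  qed (use bounded_opsD(2) \<Phi>A \<Psi>A in blast)+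
qed (use functional_calculusD(2) \<Phi> \<Psi> in blast)+

text \<open>Intertwining the coordinates gives intertwining of polynomials, and Fejer means pass to
  the limit. The formal adjoint \<open>Z\<close> stands in for continuity of \<open>Y\<close>: it
  moves the test vector to the Drury-Arveson side, where \<open>fejer_tendsto\<close>
  applies.\<close>

lemma functional_calculus_intertwine:
  assumes H: "closed_csubspace H" and \<Phi>: "is_functional_calculus H S \<Phi>" and A: "A \<in> multiplier_algebra"
    and Y: "\<And>f. Y f \<in> H" "\<And>f g. Y (f + g) = Y f + Y g" "\<And>c f. Y (c *\<^sub>C f) = c *\<^sub>C Y f"
    and Y_coord: "\<And>k f. Y (coord_mult k f) = S k (Y f)"
    and Y_adj: "\<And>f y. y \<in> H \<Longrightarrow> cinner (Y f) y = cinner f (Z y)"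
  shows "\<Phi> A (Y f) = Y (A f)"
proof -
  note H0 = closed_csubspaceD(3)[OF H]
  have poly: "\<forall>f. \<Phi> p (Y f) = Y (p f)" if "p \<in> poly_ops" for p
    using that
  proof induction
    case poly_zero
    then show ?case
      using functional_calculus_zero[OF \<Phi> Y(1)] Y(3)[of 0 0] by simp
  next
    case poly_id
    then show ?case
      using functional_calculusD(3)[OF \<Phi> Y(1)] by simp
  next
    case (poly_add A B)
    then have "A \<in> multiplier_algebra" "B \<in> multiplier_algebra"
      by (auto intro: poly_ops_multiplier)
    from functional_calculusD(4)[OF \<Phi> this Y(1)] poly_add.IH
    show ?case
      by (simp add: Y(2))
  next
    case (poly_scaleC A c)
    then have "A \<in> multiplier_algebra"
      by (auto intro: poly_ops_multiplier)
    from functional_calculusD(6)[OF \<Phi> this Y(1)] poly_scaleC.IH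
    show ?case
      by (simp add: Y(3))
  next
    case (poly_coord A k)
    then have A: "A \<in> multiplier_algebra"
      by (auto intro: poly_ops_multiplier)
    show ?case
      using functional_calculusD(5)[OF \<Phi> multiplier_algebra_coord[of k] A Y(1)]
        functional_calculusD(8)[OF \<Phi>] poly_coord.IH by (simp add: Y_coord)
  qed
  show ?thesis
  proof (rule cinner_ext[OF closed_csubspaceD(1)[OF H] bounded_opsD(1)[OF functional_calculusD(1)[OF \<Phi> A] Y(1)] Y(1)])
    fix y assume y: "y \<in> H"
    have "(\<lambda>m. cinner (fejer (Suc m) A f) (Z y)) \<longlonglongrightarrow> cinner (\<Phi> A (Y f)) y"
      using functional_calculus_tendsto[OF \<Phi> A Y(1) y H0, of f]
      by (simp add: poly[OF fejer_poly_ops, rule_format] Y_adj[OF y])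
    then have "cinner (\<Phi> A (Y f)) y = cinner (A f) (Z y)"
      using fejer_tendsto[OF A] by (rule LIMSEQ_unique)
    then show "cinner (\<Phi> A (Y f)) y = cinner (Y (A f)) y"
      by (simp add: Y_adj[OF y])
  qed
qed

section \<open>Positive operators\<close>

lemma positive_cauchy_schwarz:
  fixes A :: "'a::complex_inner_space \<Rightarrow> 'a"
  assumes add: "\<And>x y. A (x + y) = A x + A y" and scale: "\<And>c x. A (c *\<^sub>C x) = c *\<^sub>C A x"
    and sa: "\<And>x y. cinner (A x) y = cinner x (A y)" and pos: "\<And>x. 0 \<le> Re (cinner (A x) x)"
  shows "(cmod (cinner (A x) y))\<^sup>2 \<le> Re (cinner (A x) x) * Re (cinner (A y) y)"
proof -
  define b where "b = cinner (A x) y"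
  define p where "p = Re (cinner (A y) y)"
  define r where "r = Re (cinner (A x) x)"
  have diff: "A (x - z) = A x - A z" for x z
    using add[of x "(-1) *\<^sub>C z"] scale[of "-1" z] by simp
  \<comment> \<open>Positivity at \<open>x - t *\<^sub>C y\<close> with \<open>t\<close> a real
    multiple of \<open>b\<close>: the cross terms become real, and a real quadratic polynomial in
    \<open>s\<close> remains.\<close>
  have nonneg: "0 \<le> r - 2 * s * (cmod b)\<^sup>2 + s\<^sup>2 * (cmod b)\<^sup>2 * p" for s :: real
  proof -
    define t where "t = complex_of_real s * b"
    have yx: "cinner (A y) x = cnj b"
      unfolding b_def sa[of y x] by (rule cinner_commute)
    have "cinner (A (x - t *\<^sub>C y)) (x - t *\<^sub>C y)
        = cinner (A x) x - cnj t * b - t * cnj b + t * cnj t * cinner (A y) y"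
      unfolding diff scale
      by (simp add: cinner.diff_left cinner.diff_right cinner_scaleC_left cinner_scaleC_right
          algebra_simps yx b_def)
    also have "cnj t * b = complex_of_real (s * (cmod b)\<^sup>2)"
      using complex_norm_square[of b] by (simp add: t_def mult_ac)
    also have "t * cnj b = complex_of_real (s * (cmod b)\<^sup>2)"
      using complex_norm_square[of b] by (simp add: t_def mult_ac)
    also have "t * cnj t = complex_of_real (s\<^sup>2 * (cmod b)\<^sup>2)"
      using complex_norm_square[of b] by (simp add: t_def power2_eq_square mult_ac)
    finally have "Re (cinner (A (x - t *\<^sub>C y)) (x - t *\<^sub>C y)) = r - 2 * s * (cmod b)\<^sup>2 + s\<^sup>2 * (cmod b)\<^sup>2 * p"
      by (simp add: r_def p_def)
    then show ?thesis
      using pos[of "x - t *\<^sub>C y"] by simp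
  qed
  have "(cmod b)\<^sup>2 \<le> r * p"
  proof (cases "p = 0")
    case True
    have "b = 0"
    proof (rule ccontr)
      assume "b \<noteq> 0"
      \<comment> \<open>For \<open>p = 0\<close> the polynomial is linear in \<open>s\<close>, and
        this value of \<open>s\<close> makes it equal to -1.\<close>
      then show False
        using nonneg[of "(r + 1) / (2 * (cmod b)\<^sup>2)"] True by (simp add: field_simps)
    qed
    then show ?thesis
      using True by simp
  next
    case False
    then have "p > 0"
      using pos[of y] by (simp add: p_def)
    then show ?thesis
      using nonneg[of "1 / p"] by (simp add: field_simps power2_eq_square)
  qed
  then show ?thesis
    by (simp add: b_def r_def p_def)
qed

text \<open>A Cholesky-type elimination: subtracting the rank-one operator \<open>v \<otimes> v\<^sup>*\<close>, where
  \<open>v = A u / sqrt \<langle>A u, u\<rangle>\<close>, keeps \<open>A\<close> positive and kills the vector \<open>u\<close>.\<close>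

lemma cholesky_step:
  fixes A :: "'a::complex_inner_space \<Rightarrow> 'a" and u :: 'a
  assumes add: "\<And>x y. A (x + y) = A x + A y" and scale: "\<And>c x. A (c *\<^sub>C x) = c *\<^sub>C A x"
    and sa: "\<And>x y. cinner (A x) y = cinner x (A y)" and pos: "\<And>x. 0 \<le> Re (cinner (A x) x)"
  defines "v \<equiv> complex_of_real (1 / sqrt (Re (cinner (A u) u))) *\<^sub>C A u"
  defines "A' \<equiv> \<lambda>x. A x - cinner x v *\<^sub>C v"
  shows "A' (x + y) = A' x + A' y" "A' (c *\<^sub>C x) = c *\<^sub>C A' x" "cinner (A' x) y = cinner x (A' y)"
    "Re (cinner (A' x) x) = Re (cinner (A x) x) - (cmod (cinner x v))\<^sup>2"
    "0 \<le> Re (cinner (A' x) x)" "A' u = 0" "A x = 0 \<Longrightarrow> A' x = 0"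
proof -
  show "A' (x + y) = A' x + A' y"
    by (simp add: A'_def add cinner.add_left scaleC_add_left)
  show "A' (c *\<^sub>C x) = c *\<^sub>C A' x"
    by (simp add: A'_def scale cinner_scaleC_left scaleC.diff_right scaleC_scaleC)
  show "cinner (A' x) y = cinner x (A' y)"
    using cinner_commute[of y v]
    by (simp add: A'_def sa cinner.diff_left cinner.diff_right cinner_scaleC_left cinner_scaleC_right mult.commute)
  show eq: "Re (cinner (A' x) x) = Re (cinner (A x) x) - (cmod (cinner x v))\<^sup>2" for x
  proof -
    have "cinner (A' x) x = cinner (A x) x - cinner x v * cnj (cinner x v)"
      using cinner_commute[of v x] by (simp add: A'_def cinner.diff_left cinner_scaleC_left)
    then have "cinner (A' x) x = cinner (A x) x - complex_of_real ((cmod (cinner x v))\<^sup>2)"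
      by (simp only: complex_norm_square)
    then show ?thesis
      by simp
  qed
  define r where "r = Re (cinner (A u) u)"
  have r0: "r \<ge> 0"
    using pos by (simp add: r_def)
  have xv: "cinner x v = cinner (A x) u / complex_of_real (sqrt r)" for x
    by (simp add: v_def r_def cinner_scaleC_right sa)
  have cs: "(cmod (cinner (A x) u))\<^sup>2 \<le> Re (cinner (A x) x) * r" for x
    unfolding r_def by (rule positive_cauchy_schwarz[OF add scale sa pos])
  have "(cmod (cinner x v))\<^sup>2 \<le> Re (cinner (A x) x)"
  proof (cases "r = 0")
    case True
    then show ?thesis
      using pos by (simp add: xv)
  next
    case False
    then show ?thesis
      using cs[of x] r0 by (simp add: xv norm_divide power_divide field_simps)
  qed
  then show "0 \<le> Re (cinner (A' x) x)"
    by (simp add: eq)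
  show "A x = 0 \<Longrightarrow> A' x = 0"
    by (simp add: A'_def xv cinner.zero_left)
  show "A' u = 0"
  proof (cases "r = 0")
    case True
    \<comment> \<open>If the pivot vanishes, Cauchy-Schwarz already forces \<open>A u = 0\<close>.
      The division by zero in \<open>v\<close> then does no harm, and nothing has to be
      subtracted.\<close>
    have "(cmod (cinner (A (A u)) u))\<^sup>2 \<le> 0"
      using cs[of "A u"] True by simp
    then have "cinner (A u) (A u) = 0"
      by (simp add: sa)
    then show ?thesis
      by (simp add: A'_def cinner_self v_def)
  next
    case False
    have "cinner (A u) u = complex_of_real r"
    proof (rule complex_eqI)
      have "cinner (A u) u = cnj (cinner (A u) u)"
        using cinner_commute[of "A u" u] by (simp add: sa)
      then have "Im (cinner (A u) u) = Im (cnj (cinner (A u) u))"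
        by (rule arg_cong)
      then show "Im (cinner (A u) u) = Im (complex_of_real r)"
        by simp
    qed (simp add: r_def)
    then have "cinner u v * complex_of_real (1 / sqrt r) = complex_of_real (r / sqrt r * (1 / sqrt r))"
      using \<open>cinner (A u) u = complex_of_real r\<close> by (simp only: xv of_real_mult of_real_divide)
    also have "r / sqrt r * (1 / sqrt r) = 1"
      using False r0 by simp
    finally have "cinner u v *\<^sub>C v = A u"
      by (simp only: v_def r_def[symmetric] scaleC_scaleC of_real_1 cvs.scale_one)
    then show ?thesis
      by (simp add: A'_def)
  qed
qed

text \<open>The remainder \<open>E n\<close> stays positive, decreases, and annihilates the first
  \<open>n\<close> vectors of \<open>u\<close>. Its quadratic form therefore tends to zero on the
  span, and by boundedness everywhere, so the subtracted squares exhaust \<open>A\<close>. This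
  avoids taking a square root of \<open>A\<close>.\<close>

lemma cholesky:
  fixes A :: "'a::complex_inner_space \<Rightarrow> 'a" and u :: "nat \<Rightarrow> 'a"
  assumes add: "\<And>x y. A (x + y) = A x + A y" and scale: "\<And>c x. A (c *\<^sub>C x) = c *\<^sub>C A x"
    and sa: "\<And>x y. cinner (A x) y = cinner x (A y)" and pos: "\<And>x. 0 \<le> Re (cinner (A x) x)"
    and bound: "\<And>x. Re (cinner (A x) x) \<le> (norm x)\<^sup>2"
    and dense: "closure (cvs.span (range u)) = UNIV"
  shows "\<exists>v :: nat \<Rightarrow> 'a. \<forall>x. (\<lambda>i. (cmod (cinner x (v i)))\<^sup>2) sums Re (cinner (A x) x)"
proof -
  define piv where "piv P z = complex_of_real (1 / sqrt (Re (cinner (P z) z))) *\<^sub>C P z" for P :: "'a \<Rightarrow> 'a" and z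
  define E where "E = rec_nat A (\<lambda>n P x. P x - cinner x (piv P (u n)) *\<^sub>C piv P (u n))"
  define v where "v n = piv (E n) (u n)" for n
  have E0: "E 0 = A" and ES: "\<And>n. E (Suc n) = (\<lambda>x. E n x - cinner x (v n) *\<^sub>C v n)"
    by (simp_all add: E_def v_def)
  have inv: "(\<forall>x y. E n (x + y) = E n x + E n y) \<and> (\<forall>c x. E n (c *\<^sub>C x) = c *\<^sub>C E n x) \<and>
      (\<forall>x y. cinner (E n x) y = cinner x (E n y)) \<and> (\<forall>x. 0 \<le> Re (cinner (E n x) x))" for n
  proof (induction n)
    case 0
    then show ?case
      by (simp add: E0 add scale sa pos) (simp flip: sa add: pos)
  next
    case (Suc n)
    then have "E n (x + y) = E n x + E n y" "E n (c *\<^sub>C x) = c *\<^sub>C E n x" "cinner (E n x) y = cinner x (E n y)"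
      "0 \<le> Re (cinner (E n x) x)" for x y c
      by blast+
    from cholesky_step[of "E n", OF this, where u = "u n"] show ?case
      unfolding ES v_def piv_def by blast
  qed
  then have I: "E n (x + y) = E n x + E n y" "E n (c *\<^sub>C x) = c *\<^sub>C E n x" "cinner (E n x) y = cinner x (E n y)"
    "0 \<le> Re (cinner (E n x) x)" for n x y c
    by blast+
  have step: "Re (cinner (E (Suc n) x) x) = Re (cinner (E n x) x) - (cmod (cinner x (v n)))\<^sup>2"
    "E (Suc n) (u n) = 0" "E n x = 0 \<Longrightarrow> E (Suc n) x = 0" for n x
    unfolding ES v_def piv_def
    by (rule cholesky_step[of "E n", OF I])+
  have partial: "(\<Sum>i<n. (cmod (cinner x (v i)))\<^sup>2) = Re (cinner (A x) x) - Re (cinner (E n x) x)" for n x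
    by (induction n) (simp_all add: E0 step(1))
  have mono: "E m x = 0" if "E n x = 0" "n \<le> m" for m n x
    using that(2,1) by (induction m rule: dec_induct) (auto intro: step(3))
  have span: "\<exists>n. \<forall>m\<ge>n. E m x = 0" if "x \<in> cvs.span (range u)" for x
    using that
  proof (rule cvs.span_induct_alt)
    show "\<exists>n. \<forall>m\<ge>n. E m 0 = 0"
      using I(2)[of _ 0 0] by auto
  next
    fix c z y
    assume "z \<in> range u" "\<exists>n. \<forall>m\<ge>n. E m y = 0"
    then obtain j n where "z = u j" "\<forall>m\<ge>n. E m y = 0"
      by blast
    moreover have "E m (u j) = 0" if "m \<ge> Suc j" for m
      using mono[OF step(2) that] .
    ultimately show "\<exists>n. \<forall>m\<ge>n. E m (c *\<^sub>C z + y) = 0"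
      by (intro exI[of _ "max n (Suc j)"]) (auto simp: I(1,2))
  qed
  have lim: "(\<lambda>n. Re (cinner (E n x) x)) \<longlonglongrightarrow> 0" for x
  proof (rule LIMSEQ_I)
    fix e :: real assume e: "e > 0"
    have "x \<in> closure (cvs.span (range u))"
      using dense by simp
    then obtain y where y: "y \<in> cvs.span (range u)" "dist y x < sqrt e"
      using e by (meson closure_approachable real_sqrt_gt_zero)
    obtain n where n: "\<And>m. m \<ge> n \<Longrightarrow> E m y = 0"
      using span[OF y(1)] by blast
    have "norm (Re (cinner (E m x) x) - 0) < e" if "m \<ge> n" for m
    proof -
      \<comment> \<open>Since \<open>E m y = 0\<close> and \<open>E m\<close> is self-adjoint,
        \<open>y\<close> can be subtracted in both slots. Domination of \<open>E m\<close> by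
        \<open>A\<close> then bounds the form by \<open>(norm (x - y))\<^sup>2\<close>, uniformly in
        \<open>m\<close>.\<close>
      have "E m x = E m (x - y)"
        using I(1)[of m "x - y" y] n[OF that] by simp
      then have "cinner (E m x) x = cinner (x - y) (E m x)"
        by (simp add: I(3))
      also have "\<dots> = cinner (E m (x - y)) (x - y)"
        using \<open>E m x = E m (x - y)\<close> by (simp add: I(3))
      finally have "Re (cinner (E m x) x) = Re (cinner (E m (x - y)) (x - y))"
        by simp
      also have "\<dots> \<le> Re (cinner (A (x - y)) (x - y))"
        using partial[of "x - y" m] sum_nonneg[of "{..<m}" "\<lambda>i. (cmod (cinner (x - y) (v i)))\<^sup>2"] by simp
      also have "\<dots> \<le> (norm (x - y))\<^sup>2"
        by (rule bound)
      also have "\<dots> < e"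
        using y(2) e real_less_rsqrt real_sqrt_less_iff
        by (metis abs_norm_cancel dist_commute dist_norm real_sqrt_abs)
      finally show ?thesis
        using I(4)[of m x] by simp
    qed
    then show "\<exists>n. \<forall>m\<ge>n. norm (Re (cinner (E m x) x) - 0) < e"
      by blast
  qed
  have "(\<lambda>i. (cmod (cinner x (v i)))\<^sup>2) sums Re (cinner (A x) x)" for x
  proof -
    have "(\<lambda>n. Re (cinner (A x) x) - Re (cinner (E n x) x)) \<longlonglongrightarrow> Re (cinner (A x) x) - 0"
      by (intro tendsto_diff tendsto_const lim)
    then show ?thesis
      unfolding sums_def partial by simp
  qed
  then show ?thesis
    by blast
qed

section \<open>Poisson maps of a row contraction\<close>

text \<open>The locale describes the adjoints \<open>B k = T\<^sub>k\<^sup>*\<close> of a commuting row contraction.\<close>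

locale adjoint_row_contraction =
  fixes B :: "'d::finite \<Rightarrow> 'a::complex_hilbert_space \<Rightarrow> 'a"
  assumes B_op: "B k \<in> bounded_ops UNIV UNIV"
    and B_commute: "B j (B k x) = B k (B j x)"
    and B_row: "(\<Sum>k\<in>UNIV. (norm (B k x))\<^sup>2) \<le> (norm x)\<^sup>2"
begin

definition defect :: "'a \<Rightarrow> real" where
  "defect x = (norm x)\<^sup>2 - (\<Sum>k\<in>UNIV. (norm (B k x))\<^sup>2)"

text \<open>The sum of the squared norms over all words of length \<open>n\<close>, collected by
  letter content; \<open>1 / da_weight \<alpha>\<close> counts the words of content
  \<open>\<alpha>\<close>. Purity says that it tends to zero.\<close>

definition level :: "nat \<Rightarrow> 'a \<Rightarrow> real" where
  "level n x = (\<Sum>\<alpha> | mdeg \<alpha> = n. (norm (mpow B \<alpha> x))\<^sup>2 / da_weight \<alpha>)"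

lemma defect_nonneg: "defect x \<ge> 0"
  using B_row by (simp add: defect_def)

lemmas mpow_B_bump = mpow_bump[of B, OF B_commute] and mpow_B_bump' = mpow_bump'[of B, OF B_commute]

lemma mpow_B_linear:
  "mpow B \<alpha> (x + y) = mpow B \<alpha> x + mpow B \<alpha> y \<and> mpow B \<alpha> (c *\<^sub>C x) = c *\<^sub>C mpow B \<alpha> x"
proof (induction \<alpha> arbitrary: x y rule: multiindex_induct)
  case (2 \<beta> k)
  then show ?case
    by (simp only: mpow_B_bump bounded_opsD(3,4)[OF B_op] UNIV_I)
qed simp

lemma level_0: "level 0 x = (norm x)\<^sup>2"
proof -
  have "{\<alpha> :: 'd \<Rightarrow> nat. mdeg \<alpha> = 0} = {\<lambda>_. 0}"
    by auto
  then show ?thesis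
    by (simp add: level_def da_weight_zero)
qed

lemma level_Suc: "level (Suc n) x = (\<Sum>k\<in>UNIV. level n (B k x))"
proof -
  have "level (Suc n) x = (\<Sum>\<beta> | mdeg \<beta> = n. (\<Sum>k\<in>UNIV. (norm (mpow B \<beta> (B k x)))\<^sup>2) / da_weight \<beta>)"
    unfolding level_def by (simp only: multinomial_pascal mpow_B_bump')
  also have "\<dots> = (\<Sum>k\<in>UNIV. level n (B k x))"
    unfolding level_def sum_divide_distrib by (rule sum.swap)
  finally show ?thesis .
qed

text \<open>\<open>level_Suc\<close> splits off the operator that acts first. Here the one that acts
  last is split off, which makes the defect of \<open>mpow B \<alpha> x\<close> appear and the sum
  over degrees telescope.\<close>

lemma level_diff: "(\<Sum>\<alpha> | mdeg \<alpha> = n. defect (mpow B \<alpha> x) / da_weight \<alpha>) = level n x - level (Suc n) x"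
proof -
  have "level (Suc n) x = (\<Sum>\<beta> | mdeg \<beta> = n. (\<Sum>k\<in>UNIV. (norm (B k (mpow B \<beta> x)))\<^sup>2) / da_weight \<beta>)"
    unfolding level_def by (simp only: multinomial_pascal mpow_B_bump)
  then show ?thesis
    by (simp add: level_def defect_def diff_divide_distrib sum_subtractf)
qed

lemma sum_defect: "(\<Sum>\<alpha> | mdeg \<alpha> < n. defect (mpow B \<alpha> x) / da_weight \<alpha>) = (norm x)\<^sup>2 - level n x"
proof (induction n)
  case 0
  then show ?case
    by (simp add: level_0)
next
  case (Suc n)
  have "{\<alpha> :: 'd \<Rightarrow> nat. mdeg \<alpha> < Suc n} = {\<alpha>. mdeg \<alpha> < n} \<union> {\<alpha>. mdeg \<alpha> = n}"
    by auto
  moreover have "{\<alpha> :: 'd \<Rightarrow> nat. mdeg \<alpha> < n} \<inter> {\<alpha>. mdeg \<alpha> = n} = {}"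
    by auto
  ultimately show ?case
    using Suc level_diff[of x n]
    by (simp only: sum.union_disjoint[OF finite_degree_less finite_degree_eq])
qed

lemma level_nonneg: "level n x \<ge> 0"
  unfolding level_def by (intro sum_nonneg divide_nonneg_pos da_weight_pos) simp

lemma finite_sum_defect_le:
  assumes F: "finite F"
  shows "(\<Sum>\<alpha>\<in>F. defect (mpow B \<alpha> x) / da_weight \<alpha>) \<le> (norm x)\<^sup>2"
proof -
  define n where "n = Suc (Max (insert 0 (mdeg ` F)))"
  have "F \<subseteq> {\<alpha>. mdeg \<alpha> < n}"
    using F by (auto simp: n_def less_Suc_eq_le intro!: Max_ge)
  then have "(\<Sum>\<alpha>\<in>F. defect (mpow B \<alpha> x) / da_weight \<alpha>)
      \<le> (\<Sum>\<alpha> | mdeg \<alpha> < n. defect (mpow B \<alpha> x) / da_weight \<alpha>)"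
    by (intro sum_mono2 finite_degree_less divide_nonneg_pos da_weight_pos defect_nonneg)
  also have "\<dots> \<le> (norm x)\<^sup>2"
    unfolding sum_defect using level_nonneg by simp
  finally show ?thesis .
qed

lemma defect_summable: "(\<lambda>\<alpha>. defect (mpow B \<alpha> x) / da_weight \<alpha>) summable_on UNIV"
proof (rule nonneg_bdd_above_summable_on)
  show "bdd_above (sum (\<lambda>\<alpha>. defect (mpow B \<alpha> x) / da_weight \<alpha>) ` {F. F \<subseteq> UNIV \<and> finite F})"
    by (rule bdd_aboveI2[where M = "(norm x)\<^sup>2"]) (use finite_sum_defect_le in auto)
qed (intro divide_nonneg_pos da_weight_pos defect_nonneg)

lemma defect_has_sum:
  assumes "(\<lambda>n. level n x) \<longlonglongrightarrow> 0"
  shows "((\<lambda>\<alpha>. defect (mpow B \<alpha> x) / da_weight \<alpha>) has_sum (norm x)\<^sup>2) UNIV"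
proof -
  define S where "S = (\<Sum>\<^sub>\<infinity>\<alpha>. defect (mpow B \<alpha> x) / da_weight \<alpha>)"
  have S: "((\<lambda>\<alpha>. defect (mpow B \<alpha> x) / da_weight \<alpha>) has_sum S) UNIV"
    unfolding S_def by (rule has_sum_infsum[OF defect_summable])
  then have "(\<lambda>n. \<Sum>\<alpha> | mdeg \<alpha> < n. defect (mpow B \<alpha> x) / da_weight \<alpha>) \<longlonglongrightarrow> S"
    unfolding has_sum_def by (rule filterlim_compose[OF _ filterlim_degree_less])
  moreover have "(\<lambda>n. (norm x)\<^sup>2 - level n x) \<longlonglongrightarrow> (norm x)\<^sup>2 - 0"
    by (intro tendsto_intros assms)
  ultimately have "S = (norm x)\<^sup>2"
    unfolding sum_defect using LIMSEQ_unique by fastforce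
  with S show ?thesis
    by simp
qed

definition poisson :: "'a \<Rightarrow> 'a \<Rightarrow> 'd drury_arveson" where
  "poisson v h = (THE g. da_coeff g = (\<lambda>\<alpha>. cinner (mpow B \<alpha> h) v / complex_of_real (da_weight \<alpha>)))"

text \<open>The bound says that \<open>v\<close> lies in the range of the square root of the defect
  operator, and it is what makes the Poisson series converge. It will hold with \<open>C = 1\<close>
  for the Cholesky vectors and with \<open>C = defect g\<close> for
  \<open>v = defect_op g\<close>.\<close>

context
  fixes v :: 'a and C :: real
  assumes v: "\<And>x. (cmod (cinner x v))\<^sup>2 \<le> C * defect x"
begin

lemma poisson_term:
  "da_weight \<alpha> * (cmod (cinner (mpow B \<alpha> h) v / complex_of_real (da_weight \<alpha>)))\<^sup>2
    = (cmod (cinner (mpow B \<alpha> h) v))\<^sup>2 / da_weight \<alpha>"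
  using da_weight_pos[of \<alpha>] by (simp add: norm_divide power2_eq_square)

lemma poisson_term_le:
  "(cmod (cinner (mpow B \<alpha> h) v))\<^sup>2 / da_weight \<alpha> \<le> C * (defect (mpow B \<alpha> h) / da_weight \<alpha>)"
  using divide_right_mono[OF v[of "mpow B \<alpha> h"] less_imp_le[OF da_weight_pos[of \<alpha>]]] by simp

lemma da_coeff_poisson:
  "da_coeff (poisson v h) \<alpha> = cinner (mpow B \<alpha> h) v / complex_of_real (da_weight \<alpha>)"
proof -
  have "(\<lambda>\<alpha>. da_weight \<alpha> * (cmod (cinner (mpow B \<alpha> h) v / complex_of_real (da_weight \<alpha>)))\<^sup>2) summable_on UNIV"
    unfolding poisson_term
    by (rule summable_on_comparison_test[OF summable_on_cmult_right[OF defect_summable] poisson_term_le])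
       (auto intro!: divide_nonneg_pos da_weight_pos)
  then obtain g :: "'d drury_arveson"
    where "da_coeff g = (\<lambda>\<alpha>. cinner (mpow B \<alpha> h) v / complex_of_real (da_weight \<alpha>))"
    by (rule da_surj)
  from da_coeff_the[OF this] show ?thesis
    unfolding poisson_def by simp
qed

lemma poisson_norm_has_sum:
  "((\<lambda>\<alpha>. (cmod (cinner (mpow B \<alpha> h) v))\<^sup>2 / da_weight \<alpha>) has_sum (norm (poisson v h))\<^sup>2) UNIV"
  using norm_da_has_sum[of "poisson v h"] unfolding da_coeff_poisson poisson_term .

lemma poisson_add: "poisson v (h + h') = poisson v h + poisson v h'"
  unfolding da_coeff_inject[symmetric]
  by (rule ext) (simp add: da_coeff_poisson da_coeff_add mpow_B_linear[THEN conjunct1] cinner.add_left add_divide_distrib)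

lemma poisson_scaleC: "poisson v (c *\<^sub>C h) = c *\<^sub>C poisson v h"
  unfolding da_coeff_inject[symmetric]
  by (rule ext) (simp add: da_coeff_poisson da_coeff_scaleC mpow_B_linear[THEN conjunct2] cinner_scaleC_left)

lemma poisson_bounded_ops: "poisson v \<in> bounded_ops UNIV UNIV"
  unfolding bounded_ops_UNIV_iff
proof (intro conjI allI exI)
  fix h
  define S where "S = (\<Sum>\<^sub>\<infinity>\<alpha>. defect (mpow B \<alpha> h) / da_weight \<alpha>)"
  have "(norm (poisson v h))\<^sup>2 \<le> C * S"
    unfolding S_def
    by (rule has_sum_mono[OF poisson_norm_has_sum has_sum_cmult_right[OF has_sum_infsum[OF defect_summable]] poisson_term_le])
  also have "\<dots> \<le> \<bar>C\<bar> * S"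
    unfolding S_def
    by (intro mult_right_mono infsum_nonneg divide_nonneg_pos da_weight_pos defect_nonneg) simp
  also have "\<dots> \<le> \<bar>C\<bar> * (norm h)\<^sup>2"
    unfolding S_def
    by (intro mult_left_mono infsum_le_finite_sums[OF defect_summable] finite_sum_defect_le) auto
  finally have "(norm (poisson v h))\<^sup>2 \<le> (sqrt \<bar>C\<bar> * norm h)\<^sup>2"
    by (simp add: power_mult_distrib)
  then show "norm (poisson v h) \<le> sqrt \<bar>C\<bar> * norm h"
    by (rule power2_le_imp_le) simp
qed (simp_all add: poisson_add poisson_scaleC)

text \<open>The weights in the Poisson coefficients cancel exactly against the weight ratio in
  \<open>da_coeff_coord_adj\<close>.\<close>

lemma poisson_intertwine: "poisson v (B k h) = coord_adj k (poisson v h)"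
  unfolding da_coeff_inject[symmetric]
proof (rule ext)
  fix \<alpha>
  show "da_coeff (poisson v (B k h)) \<alpha> = da_coeff (coord_adj k (poisson v h)) \<alpha>"
    unfolding da_coeff_coord_adj da_coeff_poisson mpow_B_bump'
    using da_weight_pos[of "bump \<alpha> k"] by (simp del: fun_upd_apply)
qed

end

lemma cinner_mpow_poisson_zero:
  assumes "\<And>x. (cmod (cinner x v))\<^sup>2 \<le> C * defect x" and "poisson v h = 0"
  shows "cinner (mpow B \<alpha> h) v = 0"
  using da_coeff_poisson[of v C h \<alpha>, OF assms(1)] assms(2) da_weight_pos[of \<alpha>] by (simp add: da_coeff_zero)

section \<open>The defect operator and its rank-one decomposition\<close>

definition B_adj :: "'d \<Rightarrow> 'a \<Rightarrow> 'a" where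
  "B_adj k = adjoint (B k)"

lemma B_adj_op: "B_adj k \<in> bounded_ops UNIV UNIV"
  unfolding B_adj_def by (rule hadj_bounded_ops) (auto simp: B_op)

lemma cinner_B: "cinner (B k x) y = cinner x (B_adj k y)"
  unfolding B_adj_def by (rule cinner_hadj) (auto simp: B_op)

definition defect_op :: "'a \<Rightarrow> 'a" where
  "defect_op x = x - (\<Sum>k\<in>UNIV. B_adj k (B k x))"

lemma cinner_defect_op: "cinner x (defect_op y) = cinner x y - (\<Sum>k\<in>UNIV. cinner (B k x) (B k y))"
  by (simp add: defect_op_def cinner.diff_right cinner.sum_right cinner_B)

lemma defect_op_self_adjoint: "cinner (defect_op x) y = cinner x (defect_op y)"
proof -
  have "cinner (defect_op x) y = cnj (cinner y (defect_op x))"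
    by (rule cinner_commute)
  also have "\<dots> = cnj (cinner y x) - (\<Sum>k\<in>UNIV. cnj (cinner (B k y) (B k x)))"
    by (simp add: cinner_defect_op)
  also have "\<dots> = cinner x (defect_op y)"
    by (simp add: cinner_defect_op flip: cinner_commute)
  finally show ?thesis .
qed

lemma cinner_defect_op_self: "cinner (defect_op x) x = complex_of_real (defect x)"
  unfolding defect_op_self_adjoint cinner_defect_op defect_def by (simp add: cinner_self)

lemma defect_op_add: "defect_op (x + y) = defect_op x + defect_op y"
  by (simp add: defect_op_def bounded_opsD(3)[OF B_op] bounded_opsD(3)[OF B_adj_op] sum.distrib)

lemma defect_op_scaleC: "defect_op (c *\<^sub>C x) = c *\<^sub>C defect_op x"
  by (simp add: defect_op_def bounded_opsD(4)[OF B_op] bounded_opsD(4)[OF B_adj_op] scaleC.diff_right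
      scaleC.sum_right)

text \<open>Cauchy-Schwarz for the semi-inner product of the defect operator. It makes every vector
  of the form \<open>defect_op g\<close> admissible for a Poisson map.\<close>

lemma cinner_defect_op_sq_le: "(cmod (cinner x (defect_op g)))\<^sup>2 \<le> defect g * defect x"
  using positive_cauchy_schwarz[of defect_op x g, OF defect_op_add defect_op_scaleC defect_op_self_adjoint]
  by (simp add: cinner_defect_op_self defect_nonneg defect_op_self_adjoint mult.commute)

lemma defect_rank_one_decomposition:
  assumes "closure (cvs.span (range (u :: nat \<Rightarrow> 'a))) = UNIV"
  shows "\<exists>v :: nat \<Rightarrow> 'a. \<forall>x. (\<lambda>i. (cmod (cinner x (v i)))\<^sup>2) sums defect x"
  using cholesky[of defect_op u, OF defect_op_add defect_op_scaleC defect_op_self_adjoint _ _ assms]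
  by (simp add: cinner_defect_op_self defect_nonneg) (simp add: defect_def sum_nonneg)

text \<open>The double family \<open>F\<close> is nonnegative and can be summed in either order:
  over \<open>i\<close> first it gives the defects, whose weighted sum is
  \<open>(norm h)\<^sup>2\<close> by purity; over \<open>\<alpha>\<close> first it gives the norms
  of the Poisson images.\<close>

lemma poisson_isometry:
  assumes v: "\<And>x. (\<lambda>i :: nat. (cmod (cinner x (v i)))\<^sup>2) sums defect x"
    and pure: "(\<lambda>n. level n h) \<longlonglongrightarrow> 0"
  shows "(\<lambda>i. (norm (poisson (v i) h))\<^sup>2) sums (norm h)\<^sup>2"
proof -
  have vi: "(cmod (cinner x (v i)))\<^sup>2 \<le> 1 * defect x" for x i
    using sum_le_suminf[OF sums_summable[OF v], of "{i}" x] v by (simp add: sums_iff)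
  define F where "F = (\<lambda>(\<alpha>, i). (cmod (cinner (mpow B \<alpha> h) (v i)))\<^sup>2 / da_weight \<alpha>)"
  have row: "((\<lambda>i. F (\<alpha>, i)) has_sum defect (mpow B \<alpha> h) / da_weight \<alpha>) UNIV" for \<alpha>
    unfolding F_def prod.case
    by (intro sums_nonneg_imp_has_sum sums_divide v divide_nonneg_pos da_weight_pos) simp
  have "F summable_on (Sigma UNIV (\<lambda>_. UNIV))"
    by (rule summable_on_SigmaI[OF row defect_summable])
       (auto simp: F_def intro!: divide_nonneg_pos da_weight_pos)
  then have "(F has_sum (norm h)\<^sup>2) (UNIV \<times> UNIV)"
    by (intro has_sum_SigmaI[OF row defect_has_sum[OF pure]]) auto
  then have "((\<lambda>(i, \<alpha>). F (\<alpha>, i)) has_sum (norm h)\<^sup>2) (UNIV \<times> UNIV)"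
    by (subst (asm) has_sum_swap)
  then have "((\<lambda>i. (norm (poisson (v i) h))\<^sup>2) has_sum (norm h)\<^sup>2) UNIV"
  proof (rule has_sum_SigmaD)
    fix i
    show "((\<lambda>\<alpha>. case (i, \<alpha>) of (i, \<alpha>) \<Rightarrow> F (\<alpha>, i)) has_sum (norm (poisson (v i) h))\<^sup>2) UNIV"
      using poisson_norm_has_sum[of "v i" 1 h, OF vi] by (simp add: F_def)
  qed
  then show ?thesis
    by (rule has_sum_imp_sums)
qed

end

section \<open>Existence of the functional calculus\<close>

lemma suminf_cauchy_schwarz:
  fixes a b :: "nat \<Rightarrow> real"
  assumes a: "\<And>n. a n \<ge> 0" "(\<lambda>n. (a n)\<^sup>2) sums s" and b: "\<And>n. b n \<ge> 0" "(\<lambda>n. (b n)\<^sup>2) sums t"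
  shows "summable (\<lambda>n. a n * b n)" "(\<Sum>n. a n * b n) \<le> sqrt s * sqrt t"
proof -
  have "summable (\<lambda>n. (norm (a n))\<^sup>2)" "summable (\<lambda>n. (norm (b n))\<^sup>2)"
    using a b by (auto dest: sums_summable)
  then have "summable (\<lambda>n. norm (a n) * norm (b n))"
    by (rule summable_norm_mult)
  then show sm: "summable (\<lambda>n. a n * b n)"
    using a(1) b(1) by simp
  show "(\<Sum>n. a n * b n) \<le> sqrt s * sqrt t"
  proof (rule suminf_le_const[OF sm])
    fix n
    have "(\<Sum>i<n. a i * b i) \<le> L2_set a {..<n} * L2_set b {..<n}"
      using L2_set_mult_ineq[of a b "{..<n}"] a(1) b(1) by simp
    also have "\<dots> \<le> sqrt s * sqrt t"
      unfolding L2_set_def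
      by (intro mult_mono real_sqrt_le_mono real_sqrt_ge_zero sum_nonneg)
         (use sum_le_suminf[OF sums_summable[OF a(2)], of "{..<n}"]
            sum_le_suminf[OF sums_summable[OF b(2)], of "{..<n}"] a(2) b(2)
            sums_le[OF _ sums_zero a(2)] in \<open>auto simp: sums_iff\<close>)
    finally show "(\<Sum>i<n. a i * b i) \<le> sqrt s * sqrt t" .
  qed
qed

text \<open>Under the isometry \<open>h \<mapsto> (poisson (v i) h)\<^sub>i\<close> the calculus is the compression of the diagonal
  action of the multipliers on a direct sum of copies of the Drury--Arveson space.\<close>

locale poisson_calculus = adjoint_row_contraction B
  for B :: "'d::finite \<Rightarrow> 'a::complex_hilbert_space \<Rightarrow> 'a" +
  fixes v :: "nat \<Rightarrow> 'a" and H :: "'a set" and S :: "'d \<Rightarrow> 'a \<Rightarrow> 'a"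
  assumes v: "\<And>x. (\<lambda>i. (cmod (cinner x (v i)))\<^sup>2) sums defect x"
    and pure: "\<And>x. (\<lambda>n. level n x) \<longlonglongrightarrow> 0"
    and H: "closed_csubspace H"
    and B_H: "\<And>k x. x \<in> H \<Longrightarrow> B k x \<in> H"
    and S: "\<And>k. S k \<in> bounded_ops H H"
    and cinner_S: "\<And>k x y. x \<in> H \<Longrightarrow> y \<in> H \<Longrightarrow> cinner (S k x) y = cinner x (B k y)"
begin

definition K :: "nat \<Rightarrow> 'a \<Rightarrow> 'd drury_arveson" where
  "K i = poisson (v i)"

lemma v_le: "(cmod (cinner x (v i)))\<^sup>2 \<le> 1 * defect x"
  using sum_le_suminf[OF sums_summable[OF v], of "{i}" x] v by (simp add: sums_iff)

lemma K_op: "K i \<in> bounded_ops UNIV UNIV"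
  unfolding K_def by (rule poisson_bounded_ops[OF v_le])

lemma K_B: "K i (B k h) = coord_adj k (K i h)"
  unfolding K_def by (rule poisson_intertwine[OF v_le])

lemma K_norm: "(\<lambda>i. (norm (K i h))\<^sup>2) sums (norm h)\<^sup>2"
  unfolding K_def by (rule poisson_isometry[OF v pure])

lemma K_add: "K i (x + y) = K i x + K i y" and K_scaleC: "K i (c *\<^sub>C x) = c *\<^sub>C K i x"
  using bounded_opsD(3,4)[OF K_op] by auto

lemma K_diff: "K i (x - y) = K i x - K i y"
  by (rule bounded_ops_diff[OF K_op]) auto

lemma K_cinner: "(\<lambda>i. cinner (K i x) (K i y)) sums cinner x y"
proof -
  have n: "(\<lambda>i. complex_of_real ((norm (K i z))\<^sup>2)) sums complex_of_real ((norm z)\<^sup>2)" for z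
    by (rule sums_of_real[OF K_norm])
  have "(\<lambda>i. 4 * cinner (K i x) (K i y)) sums (4 * cinner x y)"
    unfolding polarization
    unfolding K_add[symmetric] K_scaleC[symmetric] K_diff[symmetric]
    by (intro sums_add sums_diff sums_mult n)
  from sums_mult[OF this, of "1/4"] show ?thesis
    by simp
qed

text \<open>The sesquilinear form of the diagonal action of \<open>A\<close> on the sequence
  \<open>(K i x)\<close>. Working with this form, no Hilbert space of sequences has to be
  built.\<close>

definition form :: "('d drury_arveson \<Rightarrow> 'd drury_arveson) \<Rightarrow> 'a \<Rightarrow> 'a \<Rightarrow> complex" where
  "form A x y = (\<Sum>i. cinner (A (K i x)) (K i y))"

lemma K_op_norm_summable:
  assumes A: "A \<in> bounded_ops UNIV UNIV"
  shows "summable (\<lambda>i. (norm (A (K i x)))\<^sup>2)"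
proof -
  obtain C where C: "C \<ge> 0" "\<And>f. norm (A f) \<le> C * norm f"
    using bounded_ops_bound[OF A] by auto
  have le: "(norm (A (K i x)))\<^sup>2 \<le> C\<^sup>2 * (norm (K i x))\<^sup>2" for i
    using power_mono[OF C(2)[of "K i x"] norm_ge_zero, of 2] by (simp add: power_mult_distrib)
  have "summable (\<lambda>i. C\<^sup>2 * (norm (K i x))\<^sup>2)"
    by (intro summable_mult sums_summable[OF K_norm])
  then show ?thesis
    by (rule summable_comparison_test'[of _ 0]) (simp add: le)
qed

lemma form_sums:
  assumes A: "A \<in> bounded_ops UNIV UNIV"
  shows "(\<lambda>i. cinner (A (K i x)) (K i y)) sums form A x y"
proof -
  have "summable (\<lambda>i. norm (A (K i x)) * norm (K i y))"
    by (rule summable_norm_mult[OF K_op_norm_summable[OF A] sums_summable[OF K_norm]])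
  then have "summable (\<lambda>i. cinner (A (K i x)) (K i y))"
    by (rule summable_comparison_test'[of _ 0]) (rule norm_cinner_le)
  then show ?thesis
    unfolding form_def by (rule summable_sums)
qed

lemma norm_form_le:
  assumes A: "A \<in> bounded_ops UNIV UNIV" and C: "C \<ge> 0" "\<And>f. norm (A f) \<le> C * norm f"
  shows "cmod (form A x y) \<le> C * norm x * norm y"
proof -
  note cs = suminf_cauchy_schwarz[OF norm_ge_zero K_norm[of x] norm_ge_zero K_norm[of y]]
  have le: "cmod (cinner (A (K i x)) (K i y)) \<le> C * (norm (K i x) * norm (K i y))" for i
    using order_trans[OF norm_cinner_le mult_right_mono[OF C(2)[of "K i x"], of "norm (K i y)"]]
    by (simp add: mult.assoc)
  have "cmod (form A x y) \<le> (\<Sum>i. C * (norm (K i x) * norm (K i y)))"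
    unfolding form_def by (rule norm_suminf_le[OF le summable_mult[OF cs(1)]])
  also have "\<dots> = C * (\<Sum>i. norm (K i x) * norm (K i y))"
    by (rule suminf_mult[OF cs(1)])
  also have "\<dots> \<le> C * (norm x * norm y)"
    using cs(2) C(1) by (intro mult_left_mono) auto
  finally show ?thesis
    by (simp add: mult.assoc)
qed

lemma form_representation:
  assumes A: "A \<in> bounded_ops UNIV UNIV"
  shows "\<exists>z\<in>H. \<forall>y\<in>H. cinner z y = form A x y"
proof -
  obtain C where C: "C \<ge> 0" "\<And>f. norm (A f) \<le> C * norm f"
    using bounded_ops_bound[OF A] by auto
  \<comment> \<open>The form is conjugate linear in \<open>y\<close>, whereas
    \<open>riesz_representation\<close> expects a linear functional; hence the conjugate.\<close>
  have sums: "(\<lambda>i. cinner (K i y) (A (K i x))) sums cnj (form A x y)" for y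
    using sums_cnj[THEN iffD2, OF form_sums[OF A, of x y]] by (simp flip: cinner_commute)
  have "\<exists>z\<in>H. \<forall>y\<in>H. cnj (form A x y) = cinner y z"
  proof (rule riesz_representation[OF H, where C = "C * norm x"])
    fix y z
    show "cnj (form A x (y + z)) = cnj (form A x y) + cnj (form A x z)"
      using sums_unique2[OF sums[of "y + z"]] sums_add[OF sums[of y] sums[of z]]
      by (simp add: K_add cinner.add_left)
    show "cnj (form A x (c *\<^sub>C y)) = c * cnj (form A x y)" for c
      using sums_unique2[OF sums[of "c *\<^sub>C y"]] sums_mult[OF sums[of y], of c]
      by (simp add: K_scaleC cinner_scaleC_left)
    show "cmod (cnj (form A x y)) \<le> C * norm x * norm y"
      using norm_form_le[OF A C] by simp
  qed
  then obtain z where z: "z \<in> H" "\<And>y. y \<in> H \<Longrightarrow> cinner y z = cnj (form A x y)"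
    by metis
  have "cinner z y = form A x y" if "y \<in> H" for y
    using z(2)[OF that] cinner_commute[of z y] by simp
  with z(1) show ?thesis
    by blast
qed

definition calc :: "('d drury_arveson \<Rightarrow> 'd drury_arveson) \<Rightarrow> 'a \<Rightarrow> 'a" where
  "calc = (\<lambda>A\<in>multiplier_algebra. \<lambda>x\<in>H. SOME z. z \<in> H \<and> (\<forall>y\<in>H. cinner z y = form A x y))"

lemma calc:
  assumes A: "A \<in> multiplier_algebra" and x: "x \<in> H"
  shows "calc A x \<in> H" and cinner_calc: "y \<in> H \<Longrightarrow> cinner (calc A x) y = form A x y"
proof -
  have "calc A x \<in> H \<and> (\<forall>y\<in>H. cinner (calc A x) y = form A x y)"
    unfolding calc_def using A x someI_ex[OF form_representation[OF multiplier_algebraD(1)[OF A], of x, unfolded Bex_def]]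
    by simp
  then show "calc A x \<in> H" "y \<in> H \<Longrightarrow> cinner (calc A x) y = form A x y"
    by auto
qed

lemma calc_eqI:
  assumes "A \<in> multiplier_algebra" "x \<in> H" "z \<in> H" "\<And>y. y \<in> H \<Longrightarrow> form A x y = cinner z y"
  shows "calc A x = z"
  by (rule cinner_ext[OF closed_csubspaceD(1)[OF H]]) (use assms calc cinner_calc in auto)

lemma form_add_left: "A \<in> bounded_ops UNIV UNIV \<Longrightarrow> form A (x + x') y = form A x y + form A x' y"
  using sums_unique2[OF form_sums[of A "x + x'" y]] sums_add[OF form_sums[of A x y] form_sums[of A x' y]]
  by (simp add: K_add bounded_opsD(3) cinner.add_left)

lemma form_scaleC_left: "A \<in> bounded_ops UNIV UNIV \<Longrightarrow> form A (c *\<^sub>C x) y = c * form A x y"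
  using sums_unique2[OF form_sums[of A "c *\<^sub>C x" y]] sums_mult[OF form_sums[of A x y], of c]
  by (simp add: K_scaleC bounded_opsD(4) cinner_scaleC_left)

lemma calc_bounded_ops:
  assumes A: "A \<in> multiplier_algebra"
  shows "calc A \<in> bounded_ops H H"
proof -
  note A' = multiplier_algebraD(1)[OF A]
  note Hs = closed_csubspaceD[OF H]
  obtain C where C: "C \<ge> 0" "\<And>f. norm (A f) \<le> C * norm f"
    using bounded_ops_bound[OF A'] by auto
  show ?thesis
    unfolding bounded_ops_def mem_Collect_eq
  proof (intro conjI ballI allI exI[of _ C])
    show "calc A \<in> H \<rightarrow>\<^sub>E H"
      using A calc(1)[OF A] by (auto simp: calc_def)
    show "calc A (x + y) = calc A x + calc A y" if "x \<in> H" "y \<in> H" for x y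
      by (rule calc_eqI[OF A]) (use that Hs in \<open>auto simp: form_add_left[OF A'] cinner_calc[OF A] cinner.add_left calc(1)[OF A]\<close>)
    show "calc A (c *\<^sub>C x) = c *\<^sub>C calc A x" if "x \<in> H" for x c
      by (rule calc_eqI[OF A]) (use that Hs in \<open>auto simp: form_scaleC_left[OF A'] cinner_calc[OF A] cinner_scaleC_left calc(1)[OF A]\<close>)
    fix x assume x: "x \<in> H"
    have "complex_of_real ((norm (calc A x))\<^sup>2) = form A x (calc A x)"
      using cinner_calc[OF A x calc(1)[OF A x]] by (simp add: cinner_self)
    then have "(norm (calc A x))\<^sup>2 = cmod (form A x (calc A x))"
      by (metis abs_norm_cancel norm_of_real norm_power power2_abs real_norm_def)
    also have "\<dots> \<le> C * norm x * norm (calc A x)"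
      by (rule norm_form_le[OF A' C])
    finally have "norm (calc A x) * norm (calc A x) \<le> norm (calc A x) * (C * norm x)"
      by (simp add: power2_eq_square mult_ac)
    then show "norm (calc A x) \<le> C * norm x"
      using C(1) by (cases "norm (calc A x) = 0") (auto simp: mult_le_cancel_left)
  qed
qed

lemma calc_id: "calc (\<lambda>f. f) = (\<lambda>x\<in>H. x)"
proof (rule extensionalityI[of _ H])
  show "calc (\<lambda>f. f) \<in> extensional H"
    by (rule bounded_opsD(2)[OF calc_bounded_ops[OF multiplier_algebra_id]])
  show "calc (\<lambda>f. f) x = (\<lambda>x\<in>H. x) x" if "x \<in> H" for x
    using that K_cinner by (auto intro!: calc_eqI multiplier_algebra_id simp: form_def sums_iff)
qed simp

lemma calc_add:
  assumes A: "A \<in> multiplier_algebra" and A': "A' \<in> multiplier_algebra" and x: "x \<in> H"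
  shows "calc (\<lambda>f. A f + A' f) x = calc A x + calc A' x"
proof (rule calc_eqI[OF multiplier_algebra_add[OF A A'] x])
  show "calc A x + calc A' x \<in> H"
    using calc(1)[OF A x] calc(1)[OF A' x] by (rule closed_csubspaceD(4)[OF H])
  fix y assume y: "y \<in> H"
  have "form (\<lambda>f. A f + A' f) x y = form A x y + form A' x y"
    using sums_add[OF form_sums[OF multiplier_algebraD(1)[OF A], of x y] form_sums[OF multiplier_algebraD(1)[OF A'], of x y]]
    by (simp add: form_def[of "\<lambda>f. A f + A' f"] cinner.add_left sums_iff)
  then show "form (\<lambda>f. A f + A' f) x y = cinner (calc A x + calc A' x) y"
    by (simp add: cinner.add_left cinner_calc[OF A x y] cinner_calc[OF A' x y])
qed

lemma calc_scaleC:
  assumes A: "A \<in> multiplier_algebra" and x: "x \<in> H"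
  shows "calc (\<lambda>f. c *\<^sub>C A f) x = c *\<^sub>C calc A x"
proof (rule calc_eqI[OF multiplier_algebra_scaleC[OF A] x])
  show "c *\<^sub>C calc A x \<in> H"
    using calc(1)[OF A x] by (rule closed_csubspaceD(6)[OF H])
  fix y assume y: "y \<in> H"
  have "form (\<lambda>f. c *\<^sub>C A f) x y = c * form A x y"
    using sums_mult[OF form_sums[OF multiplier_algebraD(1)[OF A], of x y], of c]
    by (simp add: form_def[of "\<lambda>f. c *\<^sub>C A f"] cinner_scaleC_left sums_iff)
  then show "form (\<lambda>f. c *\<^sub>C A f) x y = cinner (c *\<^sub>C calc A x) y"
    by (simp add: cinner_scaleC_left cinner_calc[OF A x y])
qed

text \<open>The maps \<open>K i\<close> intertwine adjoints, so a coordinate factor can be moved to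
  the second slot only when it stands to the left of \<open>A\<close>. Multiplicativity is
  accordingly built up from left factors.\<close>

lemma calc_coord_comp:
  assumes A: "A \<in> multiplier_algebra" and x: "x \<in> H"
  shows "calc (\<lambda>f. coord_mult k (A f)) x = S k (calc A x)"
proof (rule calc_eqI[OF multiplier_algebra_comp[OF multiplier_algebra_coord A] x])
  show "S k (calc A x) \<in> H"
    by (rule bounded_opsD(1)[OF S calc(1)[OF A x]])
  fix y assume y: "y \<in> H"
  have "form (\<lambda>f. coord_mult k (A f)) x y = form A x (B k y)"
    by (simp add: form_def cinner_coord_mult K_B)
  then show "form (\<lambda>f. coord_mult k (A f)) x y = cinner (S k (calc A x)) y"
    by (simp add: cinner_S calc(1)[OF A x] y cinner_calc[OF A x B_H])
qed

lemma calc_coord: "calc (coord_mult k) = S k"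
proof (rule extensionalityI[of _ H])
  show "calc (coord_mult k) \<in> extensional H"
    by (rule bounded_opsD(2)[OF calc_bounded_ops[OF multiplier_algebra_coord]])
  show "S k \<in> extensional H"
    by (rule bounded_opsD(2)[OF S])
  show "calc (coord_mult k) x = S k x" if "x \<in> H" for x
    using calc_coord_comp[OF multiplier_algebra_id that, of k] that by (simp add: calc_id)
qed

lemma calc_poly_comp:
  assumes A: "A \<in> multiplier_algebra" and p: "p \<in> poly_ops"
  shows "\<forall>x\<in>H. calc (\<lambda>f. p (A f)) x = calc p (calc A x)"
  using p
proof induction
  case poly_zero
  have "calc (\<lambda>f. 0) x = 0" if "x \<in> H" for x
    using calc_scaleC[OF multiplier_algebra_id that, of 0] by simp
  then show ?case
    using calc(1)[OF A] by simp
next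
  case poly_id
  then show ?case
    using calc(1)[OF A] by (simp add: calc_id)
next
  case (poly_add p q)
  then have p: "p \<in> multiplier_algebra" and q: "q \<in> multiplier_algebra"
    by (auto intro: poly_ops_multiplier)
  show ?case
    using calc_add[OF multiplier_algebra_comp[OF p A] multiplier_algebra_comp[OF q A]] calc_add[OF p q]
      calc(1)[OF A] poly_add.IH by simp
next
  case (poly_scaleC p c)
  then have p: "p \<in> multiplier_algebra"
    by (auto intro: poly_ops_multiplier)
  show ?case
    using calc_scaleC[OF multiplier_algebra_comp[OF p A], of _ c] calc_scaleC[OF p, of _ c]
      calc(1)[OF A] poly_scaleC.IH by simp
next
  case (poly_coord p k)
  then have p: "p \<in> multiplier_algebra"
    by (auto intro: poly_ops_multiplier)
  show ?case
    using calc_coord_comp[OF multiplier_algebra_comp[OF p A], of _ k] calc_coord_comp[OF p, of _ k]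
      calc(1)[OF A] poly_coord.IH by simp
qed

text \<open>The left factor is approximated by its Fejer means, for which
  \<open>calc_poly_comp\<close> applies. The sequence \<open>A' (K i x)\<close> is square summable,
  so both sides converge as trace-class pairings.\<close>

lemma calc_comp:
  assumes A: "A \<in> multiplier_algebra" and A': "A' \<in> multiplier_algebra" and x: "x \<in> H"
  shows "calc (\<lambda>f. A (A' f)) x = calc A (calc A' x)"
proof (rule calc_eqI[OF multiplier_algebra_comp[OF A A'] x])
  note z = calc(1)[OF A' x]
  show "calc A (calc A' x) \<in> H"
    by (rule calc(1)[OF A z])
  fix y assume y: "y \<in> H"
  have "(\<lambda>m. form (\<lambda>f. fejer (Suc m) A (A' f)) x y) \<longlonglongrightarrow> form (\<lambda>f. A (A' f)) x y"
    unfolding form_def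
    by (rule fejer_tendsto_suminf[OF A K_op_norm_summable[OF multiplier_algebraD(1)[OF A']] sums_summable[OF K_norm]])
  moreover have "form (\<lambda>f. fejer (Suc m) A (A' f)) x y = form (fejer (Suc m) A) (calc A' x) y" for m
    using cinner_calc[OF multiplier_algebra_comp[OF fejer_multiplier A'] x y]
      cinner_calc[OF fejer_multiplier z y] calc_poly_comp[OF A' fejer_poly_ops] x by metis
  moreover have "(\<lambda>m. form (fejer (Suc m) A) (calc A' x) y) \<longlonglongrightarrow> form A (calc A' x) y"
    unfolding form_def
    by (rule fejer_tendsto_suminf[OF A sums_summable[OF K_norm] sums_summable[OF K_norm]])
  ultimately have "form (\<lambda>f. A (A' f)) x y = form A (calc A' x) y"
    using LIMSEQ_unique by force
  then show "form (\<lambda>f. A (A' f)) x y = cinner (calc A (calc A' x)) y"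
    by (simp add: cinner_calc[OF A z y])
qed

section \<open>Complete contractivity and weak-star continuity\<close>

lemma K_family_norm:
  "(\<lambda>l. (L2_set (\<lambda>i. norm (K l (x i))) I)\<^sup>2) sums (L2_set (\<lambda>i. norm (x i)) I)\<^sup>2"
  unfolding L2_set_def by (simp add: sum_nonneg) (intro sums_sum K_norm)

text \<open>The image vector \<open>y\<close> is paired with itself. Its squared norm becomes a
  series over the copies \<open>l\<close> of the Drury-Arveson space, on each of which the matrix
  bound applies; Cauchy-Schwarz in \<open>l\<close> then gives
  \<open>Y\<^sup>2 \<le> C * X * Y\<close>.\<close>

lemma calc_matrix_bound:
  assumes A: "\<And>i j. i < n \<Longrightarrow> j < n \<Longrightarrow> A i j \<in> multiplier_algebra" and C: "C \<ge> 0"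
    and bound: "\<And>f. sqrt (\<Sum>i<n. (norm (\<Sum>j<n. A i j (f j)))\<^sup>2) \<le> C * sqrt (\<Sum>j<n. (norm (f j))\<^sup>2)"
    and x: "\<And>j. j < n \<Longrightarrow> x j \<in> H"
  shows "sqrt (\<Sum>i<n. (norm (\<Sum>j<n. calc (A i j) (x j)))\<^sup>2) \<le> C * sqrt (\<Sum>j<n. (norm (x j))\<^sup>2)"
proof -
  define y where "y i = (\<Sum>j<n. calc (A i j) (x j))" for i
  have yH: "y i \<in> H" if "i < n" for i
    unfolding y_def using that x calc(1) A by (intro cvs.subspace_sum closed_csubspaceD(1)[OF H]) auto
  define X where "X = L2_set (\<lambda>j. norm (x j)) {..<n}"
  define Y where "Y = L2_set (\<lambda>i. norm (y i)) {..<n}"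
  define a where "a l = L2_set (\<lambda>j. norm (K l (x j))) {..<n}" for l
  define b where "b l = L2_set (\<lambda>i. norm (K l (y i))) {..<n}" for l
  define t where "t l = (\<Sum>i<n. \<Sum>j<n. cinner (A i j (K l (x j))) (K l (y i)))" for l
  have t_le: "cmod (t l) \<le> C * (a l * b l)" for l
  proof -
    have "t l = (\<Sum>i<n. cinner (\<Sum>j<n. A i j (K l (x j))) (K l (y i)))"
      by (simp add: t_def cinner.sum_left)
    also have "cmod \<dots> \<le> (\<Sum>i<n. \<bar>norm (\<Sum>j<n. A i j (K l (x j)))\<bar> * \<bar>norm (K l (y i))\<bar>)"
      by (rule sum_norm_le) (simp add: norm_cinner_le)
    also have "\<dots> \<le> L2_set (\<lambda>i. norm (\<Sum>j<n. A i j (K l (x j)))) {..<n} * b l"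
      unfolding b_def by (rule L2_set_mult_ineq)
    also have "\<dots> \<le> (C * a l) * b l"
      unfolding a_def b_def L2_set_def by (intro mult_right_mono bound) (simp add: sum_nonneg)
    finally show ?thesis
      by (simp add: mult.assoc)
  qed
  have "t sums (\<Sum>i<n. \<Sum>j<n. form (A i j) (x j) (y i))"
    unfolding t_def by (intro sums_sum form_sums multiplier_algebraD(1) A) auto
  also have "(\<Sum>i<n. \<Sum>j<n. form (A i j) (x j) (y i)) = (\<Sum>i<n. cinner (y i) (y i))"
    by (rule sum.cong[OF refl])
       (simp add: y_def[of i for i] cinner.sum_left cinner_calc A x yH[unfolded y_def])
  also have "\<dots> = complex_of_real (Y\<^sup>2)"
    by (simp add: Y_def L2_set_def cinner_self sum_nonneg)
  finally have t: "t sums complex_of_real (Y\<^sup>2)" .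
  have ab: "summable (\<lambda>l. a l * b l)" "(\<Sum>l. a l * b l) \<le> sqrt (X\<^sup>2) * sqrt (Y\<^sup>2)"
    unfolding a_def b_def X_def Y_def
    by (rule suminf_cauchy_schwarz[OF L2_set_nonneg K_family_norm L2_set_nonneg K_family_norm])+
  have XY: "X \<ge> 0" "Y \<ge> 0"
    by (simp_all add: X_def Y_def L2_set_nonneg)
  have "Y\<^sup>2 = cmod (\<Sum>l. t l)"
    using t by (simp add: sums_iff flip: of_real_power)
  also have "\<dots> \<le> (\<Sum>l. C * (a l * b l))"
    by (rule norm_suminf_le[OF t_le summable_mult[OF ab(1)]])
  also have "\<dots> = C * (\<Sum>l. a l * b l)"
    by (rule suminf_mult[OF ab(1)])
  also have "\<dots> \<le> C * (X * Y)"
    using ab(2) C XY by (intro mult_left_mono) auto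
  finally have "Y * Y \<le> Y * (C * X)"
    by (simp add: power2_eq_square mult_ac)
  then have "Y \<le> C * X"
    using XY C by (cases "Y = 0") (auto simp: mult_le_cancel_left)
  then show ?thesis
    by (simp add: X_def Y_def y_def L2_set_def)
qed

lemma calc_completely_contractive:
  assumes A: "\<forall>i<n. \<forall>j<n. A i j \<in> multiplier_algebra"
  shows "matrix_norm H n (\<lambda>i j. calc (A i j)) \<le> matrix_norm UNIV n A"
  unfolding matrix_norm_def
proof (rule cInf_superset_mono)
  \<comment> \<open>Monotonicity of the infimum needs a nonempty set of bounds on the Drury-Arveson
    side; the sum of bounds for the single entries will be a member.\<close>
  have "\<exists>c\<ge>0. \<forall>f. norm (A i j f) \<le> c * norm f" if "i < n" "j < n" for i j
  proof -
    have "A i j \<in> bounded_ops UNIV UNIV"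
      using A that multiplier_algebraD(1) by blast
    then obtain C where "C \<ge> 0" "\<And>f. norm (A i j f) \<le> C * norm f"
      using bounded_ops_bound by (metis UNIV_I)
    then show ?thesis
      by blast
  qed
  then obtain c where c: "\<And>i j. i < n \<Longrightarrow> j < n \<Longrightarrow> c i j \<ge> 0"
    "\<And>i j f. i < n \<Longrightarrow> j < n \<Longrightarrow> norm (A i j f) \<le> c i j * norm f"
    by metis
  have "sqrt (\<Sum>i<n. (norm (\<Sum>j<n. A i j (f j)))\<^sup>2) \<le> (\<Sum>i<n. \<Sum>j<n. c i j) * sqrt (\<Sum>j<n. (norm (f j))\<^sup>2)" for f
  proof -
    define R where "R = sqrt (\<Sum>j<n. (norm (f j))\<^sup>2)"
    have R: "norm (f j) \<le> R" if "j < n" for j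
      using member_le_L2_set[of "{..<n}" j "\<lambda>j. norm (f j)"] that by (simp add: R_def L2_set_def)
    have "sqrt (\<Sum>i<n. (norm (\<Sum>j<n. A i j (f j)))\<^sup>2) \<le> (\<Sum>i<n. norm (\<Sum>j<n. A i j (f j)))"
      using L2_set_le_sum[of "{..<n}" "\<lambda>i. norm (\<Sum>j<n. A i j (f j))"] by (simp add: L2_set_def)
    also have "\<dots> \<le> (\<Sum>i<n. \<Sum>j<n. c i j * R)"
    proof (intro sum_mono sum_norm_le)
      fix i j assume ij: "i \<in> {..<n}" "j \<in> {..<n}"
      then show "norm (A i j (f j)) \<le> c i j * R"
        using c(2)[of i j "f j"] mult_left_mono[OF R[of j] c(1)[of i j]] by simp
    qed
    finally show ?thesis
      by (simp add: R_def sum_distrib_right)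
  qed
  then show "{C. 0 \<le> C \<and> (\<forall>x. (\<forall>j<n. x j \<in> UNIV) \<longrightarrow>
      sqrt (\<Sum>i<n. (norm (\<Sum>j<n. A i j (x j)))\<^sup>2) \<le> C * sqrt (\<Sum>j<n. (norm (x j))\<^sup>2))} \<noteq> {}"
    using c(1) by (auto intro!: exI[of _ "\<Sum>i<n. \<Sum>j<n. c i j"] sum_nonneg)
  show "{C. 0 \<le> C \<and> (\<forall>x. (\<forall>j<n. x j \<in> UNIV) \<longrightarrow>
      sqrt (\<Sum>i<n. (norm (\<Sum>j<n. A i j (x j)))\<^sup>2) \<le> C * sqrt (\<Sum>j<n. (norm (x j))\<^sup>2))}
    \<subseteq> {C. 0 \<le> C \<and> (\<forall>x. (\<forall>j<n. x j \<in> H) \<longrightarrow>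
      sqrt (\<Sum>i<n. (norm (\<Sum>j<n. calc (A i j) (x j)))\<^sup>2) \<le> C * sqrt (\<Sum>j<n. (norm (x j))\<^sup>2))}"
    using calc_matrix_bound[of n A] A by auto
qed (rule bdd_belowI[of _ 0], simp)

text \<open>The pre-adjoint of the calculus: a trace-class pairing on \<open>H\<close> pulls back to
  one on the Drury-Arveson space. The double family \<open>K i (\<xi> n)\<close> is square summable,
  and \<open>prod_decode\<close> lists it as a single sequence.\<close>

lemma calc_weak_star_pairing:
  fixes \<xi> \<eta> :: "nat \<Rightarrow> 'a"
  assumes \<xi>: "range \<xi> \<subseteq> H" "summable (\<lambda>n. (norm (\<xi> n))\<^sup>2)" and \<eta>: "range \<eta> \<subseteq> H" "summable (\<lambda>n. (norm (\<eta> n))\<^sup>2)"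
  shows "\<exists>\<xi>' \<eta>'. summable (\<lambda>n. (norm (\<xi>' n))\<^sup>2) \<and> summable (\<lambda>n. (norm (\<eta>' n))\<^sup>2) \<and>
    (\<forall>A\<in>multiplier_algebra. (\<Sum>n. cinner (calc A (\<xi> n)) (\<eta> n)) = (\<Sum>n. cinner (A (\<xi>' n)) (\<eta>' n)))"
proof -
  have pairs: "(\<lambda>(n, i). (norm (K i (\<zeta> n)))\<^sup>2) summable_on (UNIV \<times> UNIV)"
    if "summable (\<lambda>n. (norm (\<zeta> n))\<^sup>2)" for \<zeta> :: "nat \<Rightarrow> 'a"
  proof (rule summable_on_SigmaI)
    show "(\<lambda>n. (norm (\<zeta> n))\<^sup>2) summable_on UNIV"
      using that by (simp add: summable_on_UNIV_nonneg_real_iff)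
    show "((\<lambda>i. case (n, i) of (n, i) \<Rightarrow> (norm (K i (\<zeta> n)))\<^sup>2) has_sum (norm (\<zeta> n))\<^sup>2) UNIV" for n
      using K_norm by (simp add: sums_nonneg_imp_has_sum)
  qed auto
  have bij: "bij_betw prod_decode (UNIV :: nat set) (UNIV \<times> UNIV)"
    using bij_prod_decode by simp
  define enum where "enum \<zeta> m = (case prod_decode m of (n, i) \<Rightarrow> K i (\<zeta> n))" for \<zeta> :: "nat \<Rightarrow> 'a" and m
  have enum_summable: "summable (\<lambda>m. (norm (enum \<zeta> m))\<^sup>2)" if "summable (\<lambda>n. (norm (\<zeta> n))\<^sup>2)" for \<zeta>
  proof -
    have "(\<lambda>m. case prod_decode m of (n, i) \<Rightarrow> (norm (K i (\<zeta> n)))\<^sup>2) summable_on UNIV"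
      using pairs[OF that] summable_on_reindex_bij_betw[OF bij, of "\<lambda>(n, i). (norm (K i (\<zeta> n)))\<^sup>2"] by simp
    then show ?thesis
      by (intro summable_on_imp_summable) (simp add: enum_def case_prod_unfold)
  qed
  have "(\<Sum>n. cinner (calc A (\<xi> n)) (\<eta> n)) = (\<Sum>m. cinner (A (enum \<xi> m)) (enum \<eta> m))"
    if A: "A \<in> multiplier_algebra" for A
  proof -
    note A' = multiplier_algebraD(1)[OF A]
    obtain C where C: "C \<ge> 0" "\<And>f. norm (A f) \<le> C * norm f"
      using bounded_ops_bound[OF A'] by auto
    define F where "F = (\<lambda>(n, i). cinner (A (K i (\<xi> n))) (K i (\<eta> n)))"
    have "F summable_on (UNIV \<times> UNIV)"
    proof (rule abs_summable_summable, rule summable_on_comparison_test)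
      show "(\<lambda>p. C * ((case p of (n, i) \<Rightarrow> (norm (K i (\<xi> n)))\<^sup>2) + (case p of (n, i) \<Rightarrow> (norm (K i (\<eta> n)))\<^sup>2)))
          summable_on (UNIV \<times> UNIV)"
        by (intro summable_on_cmult_right summable_on_add pairs \<xi> \<eta>)
      fix p :: "nat \<times> nat"
      obtain n i where p: "p = (n, i)"
        by (cases p)
      define s where "s = norm (K i (\<xi> n))"
      define t where "t = norm (K i (\<eta> n))"
      have st: "s \<ge> 0" "t \<ge> 0"
        by (simp_all add: s_def t_def)
      have "norm (F p) \<le> C * s * t"
        using order_trans[OF norm_cinner_le mult_right_mono[OF C(2)[of "K i (\<xi> n)"], of "norm (K i (\<eta> n))"]]
        by (simp add: F_def p s_def t_def)
      also have "\<dots> \<le> C * (s\<^sup>2 + t\<^sup>2)"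
        using sum_squares_bound[of s t] mult_nonneg_nonneg[OF st] C(1)
        unfolding mult.assoc by (intro mult_left_mono) auto
      finally show "norm (F p) \<le> C * ((case p of (n, i) \<Rightarrow> (norm (K i (\<xi> n)))\<^sup>2) + (case p of (n, i) \<Rightarrow> (norm (K i (\<eta> n)))\<^sup>2))"
        by (simp add: p s_def t_def)
    qed auto
    then have F: "(F has_sum infsum F UNIV) (UNIV \<times> UNIV)"
      by (simp add: has_sum_infsum)
    have "((\<lambda>n. cinner (calc A (\<xi> n)) (\<eta> n)) has_sum infsum F UNIV) UNIV"
    proof (rule has_sum_SigmaD[OF F])
      fix n
      have "summable (\<lambda>i. norm (A (K i (\<xi> n))) * norm (K i (\<eta> n)))"
        by (rule summable_norm_mult[OF K_op_norm_summable[OF A'] sums_summable[OF K_norm]])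
      then have "summable (\<lambda>i. norm (cinner (A (K i (\<xi> n))) (K i (\<eta> n))))"
        by (rule summable_comparison_test'[of _ 0]) (simp add: norm_cinner_le)
      moreover have "cinner (calc A (\<xi> n)) (\<eta> n) = form A (\<xi> n) (\<eta> n)"
        using \<xi>(1) \<eta>(1) by (intro cinner_calc[OF A]) auto
      ultimately show "((\<lambda>i. F (n, i)) has_sum cinner (calc A (\<xi> n)) (\<eta> n)) UNIV"
        unfolding F_def prod.case using form_sums[OF A'] by (intro norm_summable_imp_has_sum) auto
    qed
    then have 1: "(\<lambda>n. cinner (calc A (\<xi> n)) (\<eta> n)) sums infsum F UNIV"
      by (rule has_sum_imp_sums)
    have "((\<lambda>m. F (prod_decode m)) has_sum infsum F UNIV) UNIV"
      using F has_sum_reindex_bij_betw[OF bij, of F] by simp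
    then have 2: "(\<lambda>m. cinner (A (enum \<xi> m)) (enum \<eta> m)) sums infsum F UNIV"
      by (intro has_sum_imp_sums) (simp add: F_def enum_def case_prod_unfold)
    show ?thesis
      using 1 2 by (simp add: sums_iff)
  qed
  then show ?thesis
    using enum_summable[OF \<xi>(2)] enum_summable[OF \<eta>(2)] by blast
qed

lemma calc_weak_star_continuous:
  "continuous_map (subtopology (weak_star UNIV) multiplier_algebra) (weak_star H) calc"
proof -
  note H0 = closed_csubspaceD(3)[OF H]
  have top: "topspace (subtopology (weak_star UNIV) multiplier_algebra)
      = (multiplier_algebra :: ('d drury_arveson \<Rightarrow> 'd drury_arveson) set)"
    using multiplier_algebraD(1) by (auto simp: topspace_weak_star)
  show ?thesis
    unfolding weak_star_def[of H]
  proof (rule continuous_on_generated_topo)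
    show "calc ` topspace (subtopology (weak_star UNIV) multiplier_algebra) \<subseteq> \<Union> (weak_star_subbasis H)"
      using topspace_weak_star[OF H0] unfolding weak_star_def topology_generated_by_topspace
      by (auto simp: top[unfolded weak_star_def topology_generated_by_topspace] calc_bounded_ops)
    fix W
    assume "W \<in> weak_star_subbasis H"
    then obtain \<xi> \<eta> U where W: "W = {A \<in> bounded_ops H H. (\<Sum>n. cinner (A (\<xi> n)) (\<eta> n)) \<in> U}"
      and \<xi>: "range \<xi> \<subseteq> H" "summable (\<lambda>n. (norm (\<xi> n))\<^sup>2)"
      and \<eta>: "range \<eta> \<subseteq> H" "summable (\<lambda>n. (norm (\<eta> n))\<^sup>2)" and U: "open U"
      by blast
    obtain \<xi>' \<eta>' :: "nat \<Rightarrow> 'd drury_arveson"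
      where sm: "summable (\<lambda>n. (norm (\<xi>' n))\<^sup>2)" "summable (\<lambda>n. (norm (\<eta>' n))\<^sup>2)"
        and eq: "\<And>A. A \<in> multiplier_algebra \<Longrightarrow>
          (\<Sum>n. cinner (calc A (\<xi> n)) (\<eta> n)) = (\<Sum>n. cinner (A (\<xi>' n)) (\<eta>' n))"
      using calc_weak_star_pairing[OF \<xi> \<eta>] by blast
    have "calc -` W \<inter> topspace (subtopology (weak_star UNIV) multiplier_algebra)
        = multiplier_algebra \<inter> {A \<in> bounded_ops UNIV UNIV. (\<Sum>n. cinner (A (\<xi>' n)) (\<eta>' n)) \<in> U}"
      unfolding top W using eq calc_bounded_ops multiplier_algebraD(1) by auto
    then show "openin (subtopology (weak_star UNIV) multiplier_algebra)
        (calc -` W \<inter> topspace (subtopology (weak_star UNIV) multiplier_algebra))"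
      using openin_subtopology_Int2[OF openin_weak_star[of \<xi>' UNIV \<eta>' U]] sm U by simp
  qed
qed

lemma is_functional_calculus_calc: "is_functional_calculus H S calc"
  unfolding is_functional_calculus_def
proof (intro conjI allI impI ballI)
  show "calc \<in> multiplier_algebra \<rightarrow>\<^sub>E bounded_ops H H"
    using calc_bounded_ops by (auto simp: calc_def)
qed (auto simp: calc_id calc_add calc_comp calc_scaleC calc_coord calc_weak_star_continuous
      intro: calc_completely_contractive)

end

section \<open>Compressions of cyclic pure row contractions\<close>

lemma word_op_bounded_ops:
  assumes "\<And>k. T k \<in> bounded_ops UNIV UNIV"
  shows "word_op UNIV T w \<in> bounded_ops UNIV UNIV"
proof (induction w)
  case Nil
  then show ?case
    using bounded_ops_id by simp
next
  case (Cons i w)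
  then show ?case
    using bounded_ops_comp[OF assms Cons, of i] by (simp add: compose_def)
qed

lemma adjoint_row_contraction_hadj:
  fixes T :: "'d::finite \<Rightarrow> 'a::complex_hilbert_space \<Rightarrow> 'a"
  assumes row: "row_contraction UNIV T" and comm: "commuting_tuple UNIV T"
  shows "adjoint_row_contraction (\<lambda>k. adjoint (T k))"
proof
  have T: "T k \<in> bounded_ops UNIV UNIV" for k
    using row by (simp add: row_contraction_def)
  have adj: "cinner (T k x) y = cinner x (adjoint (T k) y)" for k x y
    by (rule cinner_hadj) (auto simp: T)
  show "adjoint (T k) \<in> bounded_ops UNIV UNIV" for k
    by (rule hadj_bounded_ops) (auto simp: T)
  show "adjoint (T j) (adjoint (T k) x) = adjoint (T k) (adjoint (T j) x)" for j k x
  proof (rule cinner_ext[of UNIV])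
    fix z
    have "cinner z (adjoint (T j) (adjoint (T k) x)) = cinner z (adjoint (T k) (adjoint (T j) x))"
      using comm by (simp add: adj[symmetric] commuting_tuple_def)
    then show "cinner (adjoint (T j) (adjoint (T k) x)) z = cinner (adjoint (T k) (adjoint (T j) x)) z"
      by (metis cinner_commute)
  qed auto
  fix x
  have "cinner (\<Sum>k\<in>UNIV. T k (adjoint (T k) x)) x \<le> cinner x x"
    using row by (simp add: row_contraction_def)
  then have "Re (cinner (\<Sum>k\<in>UNIV. T k (adjoint (T k) x)) x) \<le> Re (cinner x x)"
    by (simp add: less_eq_complex_def)
  then show "(\<Sum>k\<in>UNIV. (norm (adjoint (T k) x))\<^sup>2) \<le> (norm x)\<^sup>2"
    by (simp add: cinner.sum_left adj cinner_self)
qed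

text \<open>Taking adjoints reverses a word, so the adjoint of its first letter acts first. Sorting
  words by their first letter is thus the recursion \<open>level_Suc\<close>.\<close>

lemma level_words:
  fixes T :: "'d::finite \<Rightarrow> 'a::complex_hilbert_space \<Rightarrow> 'a"
  assumes row: "row_contraction UNIV T" and comm: "commuting_tuple UNIV T"
  shows "(\<Sum>w | length w = n. (norm (adjoint (word_op UNIV T w) x))\<^sup>2)
    = adjoint_row_contraction.level (\<lambda>k. adjoint (T k)) n x"
proof -
  interpret adjoint_row_contraction "\<lambda>k. adjoint (T k)"
    by (rule adjoint_row_contraction_hadj[OF assms])
  have T: "T k \<in> bounded_ops UNIV UNIV" for k
    using row by (simp add: row_contraction_def)
  note W = word_op_bounded_ops[of T, OF T]
  have adj: "cinner (A x) y = cinner x (adjoint A y)" if "A \<in> bounded_ops UNIV UNIV" for A and x y :: 'a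
    by (rule cinner_hadj) (auto simp: that)
  have Nil: "adjoint (word_op UNIV T []) y = y" for y
  proof (rule cinner_ext[of UNIV])
    fix z
    have "cinner z (adjoint (word_op UNIV T []) y) = cinner z y"
      using adj[OF W[of "[]"], of z y] by simp
    then show "cinner (adjoint (word_op UNIV T []) y) z = cinner y z"
      by (metis cinner_commute)
  qed auto
  have Cons: "adjoint (word_op UNIV T (i # w)) y = adjoint (word_op UNIV T w) (adjoint (T i) y)" for i w y
  proof (rule cinner_ext[of UNIV])
    fix z
    have "cinner z (adjoint (word_op UNIV T (i # w)) y) = cinner (T i (word_op UNIV T w z)) y"
      using adj[OF W[of "i # w"], of z y] by (simp add: compose_def)
    also have "\<dots> = cinner z (adjoint (word_op UNIV T w) (adjoint (T i) y))"
      by (simp add: adj[OF T] adj[OF W])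
    finally show "cinner (adjoint (word_op UNIV T (i # w)) y) z
        = cinner (adjoint (word_op UNIV T w) (adjoint (T i) y)) z"
      by (metis cinner_commute)
  qed auto
  show ?thesis
  proof (induction n arbitrary: x)
    case 0
    have "{w :: 'd list. length w = 0} = {[]}"
      by auto
    then show ?case
      by (simp add: Nil level_0 del: word_op.simps)
  next
    case (Suc n)
    have words: "{w :: 'd list. length w = Suc n} = (\<lambda>(i, w). i # w) ` (UNIV \<times> {w. length w = n})"
      by (auto simp: length_Suc_conv)
    have inj: "inj_on (\<lambda>(i, w). i # w) (UNIV \<times> {w :: 'd list. length w = n})"
      by (auto simp: inj_on_def)
    have "(\<Sum>w | length w = Suc n. (norm (adjoint (word_op UNIV T w) x))\<^sup>2)
        = (\<Sum>(i, w)\<in>UNIV \<times> {w. length w = n}. (norm (adjoint (word_op UNIV T (i # w)) x))\<^sup>2)"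
      unfolding words sum.reindex[OF inj] by (simp add: o_def case_prod_unfold)
    also have "\<dots> = (\<Sum>i\<in>UNIV. \<Sum>w | length w = n. (norm (adjoint (word_op UNIV T (i # w)) x))\<^sup>2)"
      by (rule sum.cartesian_product[symmetric])
    also have "\<dots> = level (Suc n) x"
      unfolding Cons Suc level_Suc ..
    finally show ?case .
  qed
qed

lemma compression_bounded_ops:
  fixes M :: "'a::complex_hilbert_space set"
  assumes M: "closed_csubspace M" and T: "T k \<in> bounded_ops UNIV UNIV"
  shows "compression M T k \<in> bounded_ops M M"
proof -
  note Ms = closed_csubspaceD[OF M]
  obtain C where C: "\<And>x. norm (T k x) \<le> C * norm x"
    using bounded_ops_bound[OF T] by auto
  show ?thesis
    unfolding bounded_ops_def mem_Collect_eq
  proof (intro conjI ballI allI exI[of _ C])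
    show "norm (compression M T k x) \<le> C * norm x" if "x \<in> M" for x
      using that order_trans[OF norm_orth_proj_le[OF M] C[of x]] by (simp add: compression_def)
  qed (use Ms in \<open>auto simp: compression_def orth_proj_in[OF M] orth_proj_add[OF M] orth_proj_scaleC[OF M]
        bounded_opsD(3,4)[OF T]\<close>)
qed

lemma functional_calculus_compression:
  fixes T :: "'d::finite \<Rightarrow> 'a::complex_hilbert_space \<Rightarrow> 'a"
  assumes row: "row_contraction UNIV T" and comm: "commuting_tuple UNIV T"
    and pure: "pure_tuple UNIV T" and cyc: "cyclic_tuple UNIV T"
    and M: "closed_csubspace M" and coinv: "coinvariant UNIV T M"
  shows "is_functional_calculus M (compression M T) (functional_calculus M (compression M T))"
proof -
  define B where "B k = adjoint (T k)" for k
  have T: "T k \<in> bounded_ops UNIV UNIV" for k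
    using row by (simp add: row_contraction_def)
  interpret adjoint_row_contraction B
    unfolding B_def by (rule adjoint_row_contraction_hadj[OF row comm])
  obtain \<xi> where \<xi>: "UNIV = closure (cvs.span (range (\<lambda>w. word_op UNIV T w \<xi>)))"
    using cyc by (auto simp: cyclic_tuple_def)
  define u where "u n = word_op UNIV T (from_nat n) \<xi>" for n :: nat
  have "range u = range (\<lambda>w. word_op UNIV T w \<xi>)"
    using image_image[of "\<lambda>w. word_op UNIV T w \<xi>" from_nat "UNIV :: nat set"] by (simp add: u_def[abs_def])
  then have "closure (cvs.span (range u)) = UNIV"
    using \<xi> by simp
  then obtain v where v: "\<And>x. (\<lambda>i :: nat. (cmod (cinner x (v i)))\<^sup>2) sums defect x"
    using defect_rank_one_decomposition by metis
  \<comment> \<open>The Poisson maps are those of \<open>T\<close> on the whole space. They serve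
    the compression because co-invariance makes its adjoint the restriction of \<open>B k\<close> to
    \<open>M\<close>.\<close>
  interpret poisson_calculus B v M "compression M T"
  proof
    show "(\<lambda>n. level n x) \<longlonglongrightarrow> 0" for x
      using pure level_words[OF row comm] by (simp add: pure_tuple_def B_def[abs_def])
    show "B k x \<in> M" if "x \<in> M" for k x
      using coinv that by (auto simp: coinvariant_def B_def)
    show "cinner (compression M T k x) y = cinner x (B k y)" if "x \<in> M" "y \<in> M" for k x y
    proof -
      have "cinner (compression M T k x) y = cinner (T k x) y"
        using that by (simp add: compression_def cinner_orth_proj_left[OF M])
      also have "\<dots> = cinner x (B k y)"
        unfolding B_def by (rule cinner_hadj) (auto simp: T)
      finally show ?thesis .
    qed
  qed (use v M compression_bounded_ops[of M T, OF M T] in auto)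
  have "functional_calculus M (compression M T) = calc"
    unfolding functional_calculus_def
  proof (rule the_equality)
    show "is_functional_calculus M (compression M T) calc"
      by (rule is_functional_calculus_calc)
    show "\<Phi> = calc" if "is_functional_calculus M (compression M T) \<Phi>" for \<Phi>
      by (rule functional_calculus_unique[OF M that is_functional_calculus_calc])
  qed
  then show ?thesis
    using is_functional_calculus_calc by simp
qed

section \<open>Invariant subspaces are generated by multipliers\<close>

text \<open>A weak form of the Beurling-type theorem of McCullough and Trent.  The adjoints of the Poisson maps of
  the restriction of the coordinate multipliers to \<open>E\<close> are multipliers with range in \<open>E\<close>.  If \<open>f\<close> is orthogonal
  to their ranges, then the defects of all \<open>mpow B \<alpha> f\<close> vanish, hence \<open>mpow B \<alpha> f = mpow coord_adj \<alpha> f\<close>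
  has vanishing constant coefficient for every \<open>\<alpha>\<close>.\<close>

lemma invariant_subspace_multipliers:
  fixes E :: "'d::finite drury_arveson set"
  assumes E: "closed_csubspace E" and inv: "\<And>k f. f \<in> E \<Longrightarrow> coord_mult k f \<in> E"
    and f: "f \<in> E"
    and orth: "\<And>A g. A \<in> multiplier_algebra \<Longrightarrow> (\<And>h. A h \<in> E) \<Longrightarrow> cinner f (A g) = 0"
  shows "f = 0"
proof -
  define P where "P = orth_proj E"
  \<comment> \<open>The adjoint of the restriction of \<open>coord_mult k\<close> to
    \<open>E\<close>, extended by zero to the orthogonal complement so that it acts on the whole
    type.\<close>
  define B where "B k x = P (coord_adj k (P x))" for k x
  have PE: "P x \<in> E" and P_id: "x \<in> E \<Longrightarrow> P x = x" and P_sa: "cinner (P x) y = cinner x (P y)"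
    and P_norm: "norm (P x) \<le> norm x" for x y
    using orth_proj_in[OF E] orth_proj_id[OF E] orth_proj_self_adjoint[OF E] norm_orth_proj_le[OF E]
    by (auto simp: P_def)
  have P_op: "P \<in> bounded_ops UNIV UNIV"
    unfolding bounded_ops_UNIV_iff P_def using norm_orth_proj_le[OF E]
    by (auto simp: orth_proj_add[OF E] orth_proj_scaleC[OF E] intro!: exI[of _ 1])
  have cB: "cinner (B k x) y = cinner x (coord_mult k (P y))" for k x y
    by (simp add: B_def P_sa cinner_coord_adj P_id[OF inv[OF PE]])
  interpret adjoint_row_contraction B
  proof
    show "B k \<in> bounded_ops UNIV UNIV" for k
      using bounded_ops_comp[OF P_op bounded_ops_comp[OF coord_adj_bounded_ops P_op]]
      by (simp add: B_def[abs_def])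
    show "B j (B k x) = B k (B j x)" for j k x
      by (rule cinner_ext[of UNIV]) (simp_all add: cB P_id[OF inv[OF PE]] coord_mult_commute)
    fix x
    have "(\<Sum>k\<in>UNIV. (norm (B k x))\<^sup>2) \<le> (\<Sum>k\<in>UNIV. (norm (coord_adj k (P x)))\<^sup>2)"
      unfolding B_def by (intro sum_mono power_mono P_norm) simp
    also have "\<dots> \<le> (norm (P x))\<^sup>2"
      by (simp add: sum_norm_coord_adj)
    also have "\<dots> \<le> (norm x)\<^sup>2"
      by (intro power_mono P_norm) simp
    finally show "(\<Sum>k\<in>UNIV. (norm (B k x))\<^sup>2) \<le> (norm x)\<^sup>2" .
  qed
  have B_adj: "B_adj k y = coord_mult k (P y)" for k y
  proof (rule cinner_ext[of UNIV])
    fix x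
    have "cinner x (B_adj k y) = cinner x (coord_mult k (P y))"
      by (simp add: cinner_B[symmetric] cB)
    then show "cinner (B_adj k y) x = cinner (coord_mult k (P y)) x"
      by (metis cinner_commute)
  qed auto
  have mpow_E: "mpow B \<alpha> f \<in> E" for \<alpha>
  proof (induction \<alpha> rule: multiindex_induct)
    case 1
    then show ?case
      using f by simp
  next
    case (2 \<beta> k)
    show ?case
      unfolding mpow_B_bump by (simp add: B_def PE)
  qed
  have mpow_0: "mpow B \<alpha> 0 = 0" for \<alpha>
    using mpow_B_linear[of \<alpha> 0 0 0] by simp
  have zero: "cinner (mpow B \<alpha> f) (defect_op g) = 0" if g: "g \<in> E" for \<alpha> g
  proof -
    \<comment> \<open>An admissible vector for a Poisson map. The adjoint \<open>L\<close> of that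
      map will be a multiplier into \<open>E\<close>, so \<open>orth\<close> makes the Poisson image
      of \<open>f\<close> vanish.\<close>
    define v where "v = defect_op g"
    have vE: "v \<in> E"
      unfolding v_def defect_op_def B_adj
      by (intro closed_csubspaceD(5)[OF E] g cvs.subspace_sum closed_csubspaceD(1)[OF E] inv PE)
    have v: "(cmod (cinner x v))\<^sup>2 \<le> defect g * defect x" for x
      unfolding v_def by (rule cinner_defect_op_sq_le)
    define L where "L = adjoint (poisson v)"
    have K: "poisson v \<in> bounded_ops UNIV UNIV"
      by (rule poisson_bounded_ops[OF v])
    have L: "L \<in> bounded_ops UNIV UNIV"
      unfolding L_def by (rule hadj_bounded_ops) (auto simp: K)
    have KL: "cinner (poisson v h) x = cinner h (L x)" for h x
      unfolding L_def by (rule cinner_hadj) (auto simp: K)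
    \<comment> \<open>The Poisson map annihilates the orthogonal complement of \<open>E\<close>, so
      its adjoint has range in \<open>E\<close>.\<close>
    have K0: "poisson v h = 0" if h: "h \<in> orth_compl E" for h
    proof -
      have "P h = 0"
        unfolding P_def
        by (rule orth_proj_unique[OF E]) (use h closed_csubspaceD(3)[OF E] in auto)
      then have Bh: "B k h = 0" for k
        using bounded_ops_zero[OF coord_adj_bounded_ops, of k] P_id[OF closed_csubspaceD(3)[OF E]]
        by (simp add: B_def)
      have "cinner (mpow B \<alpha> h) v = 0" for \<alpha>
      proof (induction \<alpha> rule: multiindex_induct)
        case 1
        then show ?case
          using h vE by (simp add: orth_compl_def)
      next
        case (2 \<beta> k)
        show ?case
          unfolding mpow_B_bump' Bh mpow_0 by (rule cinner.zero_left)
      qed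
      then show ?thesis
        unfolding da_coeff_inject[symmetric] by (simp add: fun_eq_iff da_coeff_poisson[OF v] da_coeff_zero)
    qed
    have LE: "L x \<in> E" for x
    proof -
      have "cinner (L x) h = 0" if "h \<in> orth_compl E" for h
        using KL[of h x] K0[OF that] by (simp add: cinner.zero_left cinner_eq_0_commute[of "L x"])
      then have "L x \<in> orth_compl (orth_compl E)"
        by (simp add: orth_compl_def)
      then show ?thesis
        using orth_compl_orth_compl[OF closed_csubspaceD(1)[OF E]] closed_csubspaceD(2)[OF E] by simp
    qed
    \<comment> \<open>The adjoint of \<open>B k\<close> is \<open>coord_mult k\<close> preceded by
      \<open>P\<close>, and \<open>P\<close> fixes the range of \<open>L\<close>.\<close>
    have "L (coord_mult k x) = coord_mult k (L x)" for k x
    proof (rule cinner_ext[of UNIV])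
      fix h
      have "cinner h (L (coord_mult k x)) = cinner (B k h) (L x)"
        by (simp add: KL[symmetric] poisson_intertwine[OF v] cinner_coord_adj)
      also have "\<dots> = cinner h (coord_mult k (L x))"
        by (simp add: cB P_id[OF LE])
      finally show "cinner (L (coord_mult k x)) h = cinner (coord_mult k (L x)) h"
        by (metis cinner_commute)
    qed auto
    then have "L \<in> multiplier_algebra"
      by (rule multiplier_algebraI[OF L])
    then have "cinner f (L x) = 0" for x
      by (rule orth) (rule LE)
    then have "cinner (poisson v f) (poisson v f) = 0"
      by (simp add: KL)
    then have "poisson v f = 0"
      by (simp add: cinner_self)
    then show ?thesis
      unfolding v_def[symmetric] by (rule cinner_mpow_poisson_zero[OF v])
  qed
  \<comment> \<open>The choice \<open>g = mpow B \<alpha> f\<close> in \<open>zero\<close> turns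
    orthogonality into vanishing of the quadratic form.\<close>
  have defect_0: "defect (mpow B \<alpha> f) = 0" for \<alpha>
    using zero[OF mpow_E, of \<alpha> \<alpha>] cinner_defect_op_self[of "mpow B \<alpha> f"]
    by (simp add: defect_op_self_adjoint)
  \<comment> \<open>In \<open>(norm x)\<^sup>2 = (\<Sum>k\<in>UNIV. (norm (B k x))\<^sup>2) \<le>
    (\<Sum>k\<in>UNIV. (norm (coord_adj k x))\<^sup>2) = (norm x)\<^sup>2 - (cmod (da_coeff x
    (\<lambda>_. 0)))\<^sup>2\<close> equality must hold throughout: the constant coefficient is
    zero, and \<open>P\<close> does not shorten any \<open>coord_adj k x\<close>, hence fixes
    it.\<close>
  have extremal: "da_coeff x (\<lambda>_. 0) = 0 \<and> (\<forall>k. B k x = coord_adj k x)"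
    if x: "x \<in> E" "defect x = 0" for x
  proof -
    have le: "(norm (B k x))\<^sup>2 \<le> (norm (coord_adj k x))\<^sup>2" for k
      unfolding B_def P_id[OF x(1)] by (intro power_mono P_norm) simp
    have eq: "(\<Sum>k\<in>UNIV. (norm (B k x))\<^sup>2) = (norm x)\<^sup>2"
      using x(2) by (simp add: defect_def)
    have sum_le: "(\<Sum>k\<in>UNIV. (norm (B k x))\<^sup>2) \<le> (\<Sum>k\<in>UNIV. (norm (coord_adj k x))\<^sup>2)"
      by (intro sum_mono le)
    then have "(cmod (da_coeff x (\<lambda>_. 0)))\<^sup>2 \<le> 0"
      using eq by (simp add: sum_norm_coord_adj)
    then have 0: "da_coeff x (\<lambda>_. 0) = 0"
      by simp
    then have "(\<Sum>k\<in>UNIV. (norm (coord_adj k x))\<^sup>2 - (norm (B k x))\<^sup>2) = 0"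
      using eq by (simp add: sum_subtractf sum_norm_coord_adj)
    then have same: "(norm (coord_adj k x))\<^sup>2 - (norm (B k x))\<^sup>2 = 0" for k
      using le by (subst (asm) sum_nonneg_eq_0_iff) auto
    have "B k x = coord_adj k x" for k
    proof -
      have "(norm (coord_adj k x - P (coord_adj k x)))\<^sup>2 = 0"
        using orth_proj_pythagoras[OF E, of "coord_adj k x", folded P_def] same[of k]
        by (simp add: B_def P_id[OF x(1)])
      then show ?thesis
        by (simp add: B_def P_id[OF x(1)])
    qed
    with 0 show ?thesis
      by blast
  qed
  have same: "mpow B \<alpha> f = mpow coord_adj \<alpha> f" for \<alpha>
  proof (induction \<alpha> rule: multiindex_induct)
    case (2 \<beta> k)
    then show ?case
      using extremal[OF mpow_E defect_0, of \<beta>]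
      by (simp only: mpow_B_bump mpow_bump[of coord_adj, OF coord_adj_commute])
  qed simp
  have adj: "cinner (mpow coord_adj \<alpha> f) h = cinner f (mpow coord_mult \<alpha> h)" for \<alpha> h
  proof (induction \<alpha> arbitrary: h rule: multiindex_induct)
    case (2 \<beta> k)
    then show ?case
      by (simp only: mpow_bump[of coord_adj, OF coord_adj_commute] mpow_bump'[of coord_mult, OF coord_mult_commute]
          cinner_coord_adj)
  qed simp
  have "da_coeff f \<alpha> = 0" for \<alpha>
  proof -
    have "complex_of_real (da_weight \<alpha>) * da_coeff f \<alpha> = cinner f (da_mono \<alpha>)"
      by (rule cinner_da_mono[symmetric])
    also have "\<dots> = cinner (mpow B \<alpha> f) (da_mono (\<lambda>_. 0))"
      unfolding same adj mpow_coord_mono_zero ..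
    also have "\<dots> = 0"
      using extremal[OF mpow_E defect_0, of \<alpha>] by (simp add: cinner_da_mono)
    finally show ?thesis
      using da_weight_pos[of \<alpha>] by simp
  qed
  then show ?thesis
    unfolding da_coeff_inject[symmetric] by (simp add: fun_eq_iff da_coeff_zero)
qed

section \<open>Co-invariant subspaces and their annihilators\<close>

lemma closed_csubspace_model_space: "closed_csubspace (model_space J)"
  unfolding model_space_def by (rule closed_csubspace_orth_compl)

lemma mem_model_space:
  "h \<in> model_space J \<longleftrightarrow> (\<forall>\<theta>\<in>J. \<forall>f. cinner h (\<theta> f) = 0)"
proof
  assume "h \<in> model_space J"
  then show "\<forall>\<theta>\<in>J. \<forall>f. cinner h (\<theta> f) = 0"
    unfolding model_space_def orth_compl_closure unfolding orth_compl_def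
    using cvs.span_superset[of "{\<theta> f | \<theta> f. \<theta> \<in> J}"] by blast
next
  assume h: "\<forall>\<theta>\<in>J. \<forall>f. cinner h (\<theta> f) = 0"
  have "cinner h g = 0" if "g \<in> cvs.span {\<theta> f | \<theta> f. \<theta> \<in> J}" for g
    using that
    by (induction rule: cvs.span_induct_alt)
       (use h in \<open>auto simp: cinner.zero_right cinner.add_right cinner_scaleC_right\<close>)
  then show "h \<in> model_space J"
    unfolding model_space_def orth_compl_closure by (simp add: orth_compl_def)
qed

lemma coord_adj_model_space:
  assumes "J \<subseteq> multiplier_algebra" and "h \<in> model_space J"
  shows "coord_adj k h \<in> model_space J"
  using assms by (auto simp: mem_model_space cinner_coord_adj multiplier_algebraD(2)[symmetric] subset_iff)

locale coinvariant_model =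
  fixes T :: "'d::finite \<Rightarrow> 'a::complex_hilbert_space \<Rightarrow> 'a"
    and J :: "('d drury_arveson \<Rightarrow> 'd drury_arveson) set"
    and X :: "'d drury_arveson \<Rightarrow> 'a" and M :: "'a set"
  assumes row: "row_contraction UNIV T" and comm: "commuting_tuple UNIV T"
    and pure: "pure_tuple UNIV T" and cyc: "cyclic_tuple UNIV T"
    and J: "J \<subseteq> multiplier_algebra"
    and X: "X \<in> quasi_intertwiners (model_space J) (model_tuple J) UNIV T"
    and M: "closed_csubspace M" and coinv: "coinvariant UNIV T M"
begin

abbreviation "S \<equiv> compression M T"
abbreviation "Xs \<equiv> hadj (model_space J) UNIV X"

lemma T_op: "T k \<in> bounded_ops UNIV UNIV"
  using row by (simp add: row_contraction_def)

lemma X_op: "X \<in> bounded_ops (model_space J) UNIV"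
  using X by (simp add: quasi_intertwiners_def)

lemma Xs_op: "Xs \<in> bounded_ops UNIV (model_space J)"
  by (rule hadj_bounded_ops[OF closed_csubspace_model_space X_op]) simp

lemma cinner_X: "x \<in> model_space J \<Longrightarrow> cinner (X x) y = cinner x (Xs y)"
  by (rule cinner_hadj[OF closed_csubspace_model_space X_op]) auto

lemma X_dense: "x \<in> closure (X ` model_space J)"
  using X by (auto simp: quasi_intertwiners_def)

lemma Xs_add: "Xs (x + y) = Xs x + Xs y" and Xs_scaleC: "Xs (c *\<^sub>C x) = c *\<^sub>C Xs x"
  using bounded_opsD(3,4)[OF Xs_op] by auto

lemma Xs_inj: "inj Xs"
proof (rule injI)
  fix x y assume eq: "Xs x = Xs y"
  have "cinner (X h) (x - y) = 0" if "h \<in> model_space J" for h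
    using cinner_X[OF that] eq by (simp add: cinner.diff_right)
  then have "x - y \<in> orth_compl (X ` model_space J)"
    by (auto simp: orth_compl_def cinner_eq_0_commute[of "x - y"])
  then have "x - y \<in> orth_compl (closure (X ` model_space J))"
    by (simp add: orth_compl_closure)
  then have "x - y = 0"
    using X_dense by (rule orth_compl_disjoint[rotated])
  then show "x = y"
    by simp
qed

definition Y :: "'d drury_arveson \<Rightarrow> 'a" where
  "Y f = orth_proj M (X (orth_proj (model_space J) f))"

lemma Y_in: "Y f \<in> M"
  unfolding Y_def by (rule orth_proj_in[OF M])

lemma cinner_Y:
  assumes "y \<in> M"
  shows "cinner (Y f) y = cinner f (Xs y)"
  using assms bounded_opsD(1)[OF Xs_op]
  by (simp add: Y_def cinner_orth_proj_left[OF M] cinner_X[OF orth_proj_in[OF closed_csubspace_model_space]]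
      cinner_orth_proj_left[OF closed_csubspace_model_space])

lemma hadj_in: "y \<in> M \<Longrightarrow> adjoint (T k) y \<in> M"
  using coinv by (auto simp: coinvariant_def)

lemma cinner_T: "cinner (T k x) y = cinner x (adjoint (T k) y)"
  by (rule cinner_hadj) (auto simp: T_op)

lemma Y_coord: "Y (coord_mult k f) = S k (Y f)"
proof (rule cinner_ext[OF closed_csubspaceD(1)[OF M] Y_in])
  note MJ = closed_csubspace_model_space[of J]
  show "S k (Y f) \<in> M"
    by (rule bounded_opsD(1)[OF compression_bounded_ops[OF M T_op] Y_in])
  fix y assume y: "y \<in> M"
  define p where "p = orth_proj (model_space J) f"
  have p: "p \<in> model_space J"
    by (simp add: p_def orth_proj_in[OF MJ])
  have Xs_in: "Xs z \<in> model_space J" for z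
    using bounded_opsD(1)[OF Xs_op] by simp
  have "cinner (Y (coord_mult k f)) y = cinner f (coord_adj k (Xs y))"
    by (simp add: cinner_Y[OF y] cinner_coord_mult)
  \<comment> \<open>The model space is invariant under \<open>coord_adj k\<close>, so
    \<open>f\<close> may be replaced by its projection \<open>p\<close>.\<close>
  also have "\<dots> = cinner p (coord_adj k (Xs y))"
    by (simp add: p_def cinner_orth_proj_left[OF MJ coord_adj_model_space[OF J Xs_in]])
  also have "\<dots> = cinner (coord_mult k p) (Xs y)"
    by (simp add: cinner_coord_mult)
  also have "\<dots> = cinner (model_tuple J k p) (Xs y)"
    using p by (simp add: model_tuple_def compression_def cinner_orth_proj_left[OF MJ Xs_in])
  also have "\<dots> = cinner (X (model_tuple J k p)) y"
    using p by (subst cinner_X) (auto simp: model_tuple_def compression_def orth_proj_in[OF MJ])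
  also have "\<dots> = cinner (T k (X p)) y"
    using X p by (simp add: quasi_intertwiners_def)
  also have "\<dots> = cinner (Y f) (adjoint (T k) y)"
    by (simp add: cinner_T Y_def p_def cinner_orth_proj_left[OF M hadj_in[OF y]])
  also have "\<dots> = cinner (S k (Y f)) y"
    using Y_in y by (simp add: compression_def cinner_orth_proj_left[OF M] cinner_T)
  finally show "cinner (Y (coord_mult k f)) y = cinner (S k (Y f)) y" .
qed

lemma Y_linear: "Y (f + g) = Y f + Y g" "Y (c *\<^sub>C f) = c *\<^sub>C Y f"
proof -
  note MJ = closed_csubspace_model_space[of J]
  show "Y (f + g) = Y f + Y g"
    by (simp add: Y_def orth_proj_add[OF MJ] orth_proj_add[OF M] bounded_opsD(3)[OF X_op] orth_proj_in[OF MJ])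
  show "Y (c *\<^sub>C f) = c *\<^sub>C Y f"
    by (simp add: Y_def orth_proj_scaleC[OF MJ] orth_proj_scaleC[OF M] bounded_opsD(4)[OF X_op] orth_proj_in[OF MJ])
qed

lemma Y_dense:
  assumes "x \<in> M" "e > 0"
  obtains f where "norm (x - Y f) < e"
proof -
  obtain h where h: "h \<in> model_space J" "dist (X h) x < e"
    using X_dense[of x] \<open>e > 0\<close> by (auto simp: closure_approachable)
  have "x - Y h = orth_proj M (x - X h)"
  proof (rule orth_proj_unique[OF M, symmetric])
    show "x - Y h \<in> M"
      by (rule closed_csubspaceD(5)[OF M \<open>x \<in> M\<close> Y_in])
    have "X h - orth_proj M (X h) \<in> orth_compl M"
      using orth_proj_works[OF M] by blast
    then have "- (X h - orth_proj M (X h)) \<in> orth_compl M"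
      by (simp add: cvs.subspace_neg[OF closed_csubspaceD(1)[OF closed_csubspace_orth_compl]] del: minus_diff_eq)
    then show "x - X h - (x - Y h) \<in> orth_compl M"
      using h(1) by (simp add: Y_def orth_proj_id[OF closed_csubspace_model_space])
  qed
  then have "norm (x - Y h) \<le> norm (x - X h)"
    by (simp add: norm_orth_proj_le[OF M])
  then show ?thesis
    using h(2) that[of h] by (simp add: dist_norm norm_minus_commute)
qed

lemma Ann_c_iff:
  "A \<in> Ann_c M S \<longleftrightarrow> A \<in> multiplier_algebra \<and> (\<forall>f. A f \<in> orth_compl (Xs ` M))"
proof -
  define \<Phi> where "\<Phi> = functional_calculus M S"
  have \<Phi>: "is_functional_calculus M S \<Phi>"
    unfolding \<Phi>_def by (rule functional_calculus_compression[OF row comm pure cyc M coinv])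
  have "(\<forall>x\<in>M. \<Phi> A x = 0) \<longleftrightarrow> (\<forall>f. A f \<in> orth_compl (Xs ` M))" if A: "A \<in> multiplier_algebra"
  proof -
    have tw: "\<Phi> A (Y f) = Y (A f)" for f
      by (rule functional_calculus_intertwine[OF M \<Phi> A Y_in Y_linear Y_coord cinner_Y])
    note \<Phi>A = functional_calculusD(1)[OF \<Phi> A]
    show ?thesis
    proof
      assume "\<forall>x\<in>M. \<Phi> A x = 0"
      then have "Y (A f) = 0" for f
        using tw[of f] Y_in by simp
      then show "\<forall>f. A f \<in> orth_compl (Xs ` M)"
        by (auto simp: orth_compl_def cinner_Y[symmetric] cinner.zero_left)
    next
      assume "\<forall>f. A f \<in> orth_compl (Xs ` M)"
      then have "cinner (Y (A f)) (Y (A f)) = 0" for f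
        using Y_in[of "A f"] by (auto simp: cinner_Y[OF Y_in] orth_compl_def)
      then have AY: "\<Phi> A (Y f) = 0" for f
        by (simp add: tw cinner_self)
      obtain C where C: "C \<ge> 0" "\<And>x. x \<in> M \<Longrightarrow> norm (\<Phi> A x) \<le> C * norm x"
        using bounded_ops_bound[OF \<Phi>A] by blast
      show "\<forall>x\<in>M. \<Phi> A x = 0"
      proof
        fix x assume x: "x \<in> M"
        have "norm (\<Phi> A x) \<le> 0 + e" if e: "e > 0" for e
        proof -
          \<comment> \<open>The bound \<open>C\<close> may be zero; dividing by \<open>C + 1\<close>
            keeps the tolerance well defined.\<close>
          obtain f where f: "norm (x - Y f) < e / (C + 1)"
            using Y_dense[OF x, of "e / (C + 1)"] C(1) e by auto
          have "\<Phi> A x = \<Phi> A (x - Y f)"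
            using bounded_ops_diff[OF \<Phi>A closed_csubspaceD(1)[OF M] x Y_in, of f] by (simp add: AY)
          then have "norm (\<Phi> A x) \<le> C * norm (x - Y f)"
            using C(2)[OF closed_csubspaceD(5)[OF M x Y_in], of f] by simp
          also have "\<dots> \<le> (C + 1) * norm (x - Y f)"
            by (intro mult_right_mono) auto
          also have "\<dots> \<le> e"
            using f C(1) by (simp add: field_simps)
          finally show ?thesis
            by simp
        qed
        then have "norm (\<Phi> A x) \<le> 0"
          by (rule field_le_epsilon)
        then show "\<Phi> A x = 0"
          by simp
      qed
    qed
  qed
  then show ?thesis
    by (auto simp: Ann_c_def \<Phi>_def)
qed

lemma orth_compl_invariant:
  assumes f: "f \<in> orth_compl (Xs ` M)"
  shows "coord_mult k f \<in> orth_compl (Xs ` M)"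
proof -
  have "cinner (coord_mult k f) (Xs y) = 0" if y: "y \<in> M" for y
  proof -
    have "cinner (coord_mult k f) (Xs y) = cinner (S k (Y f)) y"
      by (simp add: cinner_Y[OF y, symmetric] Y_coord)
    also have "\<dots> = cinner (Y f) (adjoint (T k) y)"
      using Y_in y by (simp add: compression_def cinner_orth_proj_left[OF M] cinner_T)
    also have "\<dots> = cinner f (Xs (adjoint (T k) y))"
      by (rule cinner_Y[OF hadj_in[OF y]])
    also have "\<dots> = 0"
      using f hadj_in[OF y] by (auto simp: orth_compl_def)
    finally show ?thesis .
  qed
  then show ?thesis
    by (auto simp: orth_compl_def)
qed

lemma closure_image: "closure (Xs ` M) = orth_compl (orth_compl (Xs ` M))"
proof (rule orth_compl_orth_compl[symmetric])
  show "cvs.subspace (Xs ` M)"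
    unfolding cvs.subspace_def
  proof (intro conjI ballI allI)
    show "0 \<in> Xs ` M"
      using bounded_ops_zero[OF Xs_op] closed_csubspaceD(3)[OF M] by (metis UNIV_I image_eqI)
    show "x + y \<in> Xs ` M" if "x \<in> Xs ` M" "y \<in> Xs ` M" for x y
      using that closed_csubspaceD(4)[OF M] by (auto simp flip: Xs_add)
    show "c *\<^sub>C x \<in> Xs ` M" if "x \<in> Xs ` M" for c x
      using that closed_csubspaceD(6)[OF M] by (auto simp flip: Xs_scaleC)
  qed
qed

end

text \<open>A multiplier with range in \<open>E\<close> annihilates the compression to
  \<open>M\<close>, hence the one to \<open>N\<close>, so its range lies in \<open>F\<close>. The
  part \<open>g\<close> of \<open>f\<close> orthogonal to \<open>F\<close> is thus orthogonal to the
  ranges of all multipliers into \<open>E\<close>, and vanishes because they generate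
  \<open>E\<close>.\<close>

lemma orth_compl_subset_of_Ann_c:
  assumes M: "coinvariant_model T J X M" and N: "coinvariant_model T J X N"
    and Ann: "Ann_c M (compression M T) \<subseteq> Ann_c N (compression N T)"
  shows "orth_compl (hadj (model_space J) UNIV X ` M) \<subseteq> orth_compl (hadj (model_space J) UNIV X ` N)"
proof
  interpret M: coinvariant_model T J X M
    by (rule M)
  interpret N: coinvariant_model T J X N
    by (rule N)
  define E where "E = orth_compl (M.Xs ` M)"
  define F where "F = E \<inter> orth_compl (M.Xs ` N)"
  have E: "closed_csubspace E"
    unfolding E_def by (rule closed_csubspace_orth_compl)
  have F: "closed_csubspace F"
    using E closed_csubspace_orth_compl[of "M.Xs ` N"] unfolding F_def closed_csubspace_def
    by (auto intro: cvs.subspace_inter)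
  fix f assume "f \<in> orth_compl (M.Xs ` M)"
  then have f: "f \<in> E"
    by (simp add: E_def)
  define g where "g = f - orth_proj F f"
  have pF: "orth_proj F f \<in> F" and g: "g \<in> orth_compl F"
    using orth_proj_works[OF F] by (auto simp: g_def)
  have "g = 0"
  proof (rule invariant_subspace_multipliers[OF E])
    show "coord_mult k h \<in> E" if "h \<in> E" for k h
      using that M.orth_compl_invariant by (simp add: E_def)
    show "g \<in> E"
      using f pF closed_csubspaceD(5)[OF E] by (auto simp: g_def F_def)
    fix A h assume "A \<in> multiplier_algebra" and AE: "\<And>h. A h \<in> E"
    then have "A \<in> Ann_c M (compression M T)"
      by (simp add: M.Ann_c_iff E_def)
    then have "A h \<in> F"
      using Ann AE by (auto simp: N.Ann_c_iff F_def)
    then show "cinner g (A h) = 0"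
      using g by (simp add: orth_compl_def)
  qed
  then show "f \<in> orth_compl (M.Xs ` N)"
    using pF by (simp add: g_def F_def)
qed

theorem theorem4p3:
  fixes T :: "'d::finite \<Rightarrow> 'a::complex_hilbert_space \<Rightarrow> 'a"
    and J :: "('d drury_arveson \<Rightarrow> 'd drury_arveson) set"
    and M N :: "'a set"
  assumes "row_contraction UNIV T" and "commuting_tuple UNIV T"
    and "pure_tuple UNIV T" and "cyclic_tuple UNIV T"
    and "J = Ann_c UNIV T"
    and "closed_csubspace M" and "coinvariant UNIV T M"
    and "closed_csubspace N" and "coinvariant UNIV T N"
    and "Ann_c M (compression M T) = Ann_c N (compression N T)"
  shows "(\<forall>X \<in> quasi_intertwiners (model_space J) (model_tuple J) UNIV T.
            closure (hadj (model_space J) UNIV X ` M) = closure (hadj (model_space J) UNIV X ` N)) \<and>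
         ((\<exists>X \<in> quasi_intertwiners (model_space J) (model_tuple J) UNIV T.
            closed (hadj (model_space J) UNIV X ` M) \<and> closed (hadj (model_space J) UNIV X ` N))
          \<longrightarrow> M = N)"
proof -
  have J: "J \<subseteq> multiplier_algebra"
    using assms(5) by (auto simp: Ann_c_def)
  have models: "coinvariant_model T J X M" "coinvariant_model T J X N"
    if "X \<in> quasi_intertwiners (model_space J) (model_tuple J) UNIV T" for X
    using that assms J by (simp_all add: coinvariant_model_def)
  have eq: "closure (hadj (model_space J) UNIV X ` M) = closure (hadj (model_space J) UNIV X ` N)"
    if X: "X \<in> quasi_intertwiners (model_space J) (model_tuple J) UNIV T" for X
  proof -
    have "orth_compl (hadj (model_space J) UNIV X ` M) = orth_compl (hadj (model_space J) UNIV X ` N)"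
      using orth_compl_subset_of_Ann_c[OF models[OF X]] orth_compl_subset_of_Ann_c[OF models(2,1)[OF X]]
        assms(10) by blast
    then show ?thesis
      using coinvariant_model.closure_image[OF models(1)[OF X]] coinvariant_model.closure_image[OF models(2)[OF X]]
      by simp
  qed
  moreover have "M = N"
    if X: "X \<in> quasi_intertwiners (model_space J) (model_tuple J) UNIV T"
      and cl: "closed (hadj (model_space J) UNIV X ` M)" "closed (hadj (model_space J) UNIV X ` N)" for X
  proof -
    have "hadj (model_space J) UNIV X ` M = hadj (model_space J) UNIV X ` N"
      using eq[OF X] cl by simp
    then show ?thesis
      using coinvariant_model.Xs_inj[OF models(1)[OF X]] by (simp add: inj_image_eq_iff)
  qed
  ultimately show ?thesis
    by blast
qed

end
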